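(* Let $K<\infty$ and let $P_{Y_0},P_{Y_1},\dots,P_{Y_K}$ be distributions on a common space $\mathcal Y$. Assume: - $P_{Y_0}$ is absolutely continuous with respect to each $P_{Y_k}$ and $0<D(P_{Y_0}\|P_{Y_k})<\infty$ for $k=1,\dots,K$; - the covariance matrix $\mathsf V$ of $h_1^{\rm LLR}(Y_0)$, $Y_0\sim P_{Y_0}$, is positive definite; - $\mathbb E\|h_1^{\rm LLR}(Y_0)-\mathbf D\|_2^3<\infty$, where $\mathbf D=\mathbb E[h_1^{\rm LLR}(Y_0)]$. Then for every $\epsilon_0\in(0,1)$, as $n\to\infty$, $$\beta_{\epsilon_0}(P_{Y_0},\{P_{Y_k}\}_{k=1}^K)=\exp\Big\{-nD_{\min}+\sqrt n\,b-\tfrac12\log n+O(1)\Big\},$$ where $b$ is the solution of $\mathbb P[\mathbf Z\le b\mathbf 1]=1-\epsilon_0$ for $\mathbf Z\sim\mathcal N(\mathbf 0,\mathsf V_{\min})$ in $\mathbb R^{|\mathcal I_{\min}|}$. Moreover, this minimax error is achieved by a log-likelihood-ratio test with some threshold vector $\boldsymbol\tau$.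
   Context: Hypothesis testing problem. The null hypothesis is $H_0$: $Y^n\sim P_{Y_0}^n$; the alternative is $H_1$: $Y^n\sim P_{Y_k}^n$ for some $k\in[K]$. For a (possibly randomized) test based on $Y^n$: - the type-I error is $\alpha=\mathbb P_{P_{Y_0}^n}[\text{decide }H_1]$; - the type-II errors are $\beta_k=\mathbb P_{P_{Y_k}^n}[\text{decide }H_0]$. The minimax type-II error is $$\beta_{\epsilon_0}(P_{Y_0},\{P_{Y_k}\}_{k=1}^K)=\min_{\text{tests}:\ \alpha\le\epsilon_0}\ \max_{k\in[K]}\beta_k,$$ the minimum being over all randomized tests on $\mathcal Y^n$. Define $h_1^{\rm LLR}(y)=\big(\log\frac{P_{Y_0}(y)}{P_{Y_1}(y)},\dots,\log\frac{P_{Y_0}(y)}{P_{Y_K}(y)}\big)\in\mathbb R^K$, with densities interpreted as Radon–Nikodym derivatives, and $h_n^{\rm LLR}(y^n)=\sum_{i=1}^nh_1^{\rm LLR}(y_i)$. A LLR test with threshold vector $\boldsymbol\tau\in\mathbb R^K$ decides $H_0$ iff $h_n^{\rm LLR}(y^n)\ge\boldsymbol\tau$ componentwise. Further notation: - $D_{\min}=\min_kD(P_{Y_0}\|P_{Y_k})$; - $\mathcal I_{\min}=\{k: D(P_{Y_0}\|P_{Y_k})=D_{\min}\}$; - $\mathsf V_{\min}$ is the covariance matrix of the subvector $(h_1^{\rm LLR}(Y_0))_{\mathcal I_{\min}}$. *)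

theory Defs
  imports "HOL-Probability.Probability"
begin

definition lnE :: "ennreal \<Rightarrow> ereal" where
  "lnE x = (if x = 0 then -\<infinity> else if x = \<infinity> then \<infinity> else ereal (ln (enn2real x)))"

definition llrE :: "(nat \<Rightarrow> 'a measure) \<Rightarrow> nat \<Rightarrow> 'a \<Rightarrow> ereal" where
  "llrE P k y = lnE (RN_deriv (P k) (P 0) y)"

definition llrE_n :: "(nat \<Rightarrow> 'a measure) \<Rightarrow> nat \<Rightarrow> nat \<Rightarrow> (nat \<Rightarrow> 'a) \<Rightarrow> ereal" where
  "llrE_n P n k ys = (\<Sum>i<n. llrE P k (ys i))"

text \<open>Real-valued LLR component (agrees with llrE P0-a.s.), used for moments under P_0.\<close>
definition llr0 :: "(nat \<Rightarrow> 'a measure) \<Rightarrow> nat \<Rightarrow> 'a \<Rightarrow> real" where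
  "llr0 P k = entropy_density (exp 1) (P k) (P 0)"

definition KLk :: "(nat \<Rightarrow> 'a measure) \<Rightarrow> nat \<Rightarrow> real" where
  "KLk P k = KL_divergence (exp 1) (P k) (P 0)"

definition covV :: "(nat \<Rightarrow> 'a measure) \<Rightarrow> nat \<Rightarrow> nat \<Rightarrow> real" where
  "covV P j k = (\<integral>y. (llr0 P j y - KLk P j) * (llr0 P k y - KLk P k) \<partial>(P 0))"

definition Dmin :: "(nat \<Rightarrow> 'a measure) \<Rightarrow> nat \<Rightarrow> real" where
  "Dmin P K = Min (KLk P ` {1..K})"

definition Imin :: "(nat \<Rightarrow> 'a measure) \<Rightarrow> nat \<Rightarrow> nat set" where
  "Imin P K = {k \<in> {1..K}. KLk P k = Dmin P K}"

definition prodP :: "(nat \<Rightarrow> 'a measure) \<Rightarrow> nat \<Rightarrow> nat \<Rightarrow> (nat \<Rightarrow> 'a) measure" where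
  "prodP P k n = PiM {..<n} (\<lambda>_. P k)"

text \<open>A randomized test: measurable phi : Y^n -> [0,1], the probability of deciding H_1.\<close>
definition is_test :: "(nat \<Rightarrow> 'a measure) \<Rightarrow> nat \<Rightarrow> ((nat \<Rightarrow> 'a) \<Rightarrow> real) \<Rightarrow> bool" where
  "is_test P n \<phi> \<longleftrightarrow> \<phi> \<in> borel_measurable (prodP P 0 n) \<and>
     (\<forall>x\<in>space (prodP P 0 n). 0 \<le> \<phi> x \<and> \<phi> x \<le> 1)"

definition type1_err :: "(nat \<Rightarrow> 'a measure) \<Rightarrow> nat \<Rightarrow> ((nat \<Rightarrow> 'a) \<Rightarrow> real) \<Rightarrow> real" where
  "type1_err P n \<phi> = (\<integral>x. \<phi> x \<partial>(prodP P 0 n))"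

definition type2_err :: "(nat \<Rightarrow> 'a measure) \<Rightarrow> nat \<Rightarrow> nat \<Rightarrow> ((nat \<Rightarrow> 'a) \<Rightarrow> real) \<Rightarrow> real" where
  "type2_err P n k \<phi> = (\<integral>x. 1 - \<phi> x \<partial>(prodP P k n))"

definition max_type2 :: "(nat \<Rightarrow> 'a measure) \<Rightarrow> nat \<Rightarrow> nat \<Rightarrow> ((nat \<Rightarrow> 'a) \<Rightarrow> real) \<Rightarrow> real" where
  "max_type2 P K n \<phi> = Max ((\<lambda>k. type2_err P n k \<phi>) ` {1..K})"

definition minimax_beta :: "(nat \<Rightarrow> 'a measure) \<Rightarrow> nat \<Rightarrow> real \<Rightarrow> nat \<Rightarrow> real" where
  "minimax_beta P K \<epsilon>0 n =
     (INF \<phi> \<in> {\<phi>. is_test P n \<phi> \<and> type1_err P n \<phi> \<le> \<epsilon>0}. max_type2 P K n \<phi>)"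

definition llr_test :: "(nat \<Rightarrow> 'a measure) \<Rightarrow> nat \<Rightarrow> nat \<Rightarrow> (nat \<Rightarrow> real) \<Rightarrow> (nat \<Rightarrow> 'a) \<Rightarrow> real" where
  "llr_test P K n \<tau> ys = (if \<forall>k\<in>{1..K}. ereal (\<tau> k) \<le> llrE_n P n k ys then 0 else 1)"

definition std_gauss :: "nat set \<Rightarrow> (nat \<Rightarrow> real) measure" where
  "std_gauss I = PiM I (\<lambda>_. density lborel (\<lambda>x. ennreal (std_normal_density x)))"

text \<open>For Z ~ N(0,V) on R^I, P[Z <= b 1] = p.  Z ~ N(0,V) is realised as Z = A W with
  W standard Gaussian and A A^T = V; the condition is required for every such A.\<close>
definition gauss_orthant :: "nat set \<Rightarrow> (nat \<Rightarrow> nat \<Rightarrow> real) \<Rightarrow> real \<Rightarrow> real \<Rightarrow> bool" where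
  "gauss_orthant I V b p \<longleftrightarrow>
     (\<forall>A. (\<forall>i\<in>I. \<forall>j\<in>I. (\<Sum>l\<in>I. A i l * A j l) = V i j) \<longrightarrow>
        measure (std_gauss I) {w \<in> space (std_gauss I). \<forall>i\<in>I. (\<Sum>l\<in>I. A i l * w l) \<le> b} = p)"

end

theory Submission
  imports Defs
begin

text \<open>
The LLR vector of \<open>n\<close> observations is a sum of independent vectors, so both bounds reduce to a
Berry--Esseen theorem for orthants, with error \<open>O(1 / sqrt n)\<close>, and to a change of measure:
a threshold \<open>\<tau>\<close> on the LLR turns \<open>P k\<close>-probabilities into \<open>P 0\<close>-probabilities times \<open>exp (- \<tau>)\<close>.
The additional \<open>1 / sqrt n\<close> is, in the converse, the shift of the threshold that the Berry--Esseen error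
forces and, in the direct part, the probability that the LLR falls into a given unit interval.

The Berry--Esseen theorem is proved by Bergstroem's induction. Summands are exchanged for Gaussian ones
one by one in the presence of an independent Gaussian vector of variance \<open>v\<close>. By the Cameron--Martin
formula and a second-order expansion of the Gaussian density ratio each exchange costs
\<open>O(v powr (- 3/2))\<close> times the supremum of the test function; since orthants are closed under
translations, the test function may be taken to be the Berry--Esseen error for fewer summands, and the
resulting recursion closes once the smoothing variance is a large constant. The same theorem shows that
the law of \<open>A W\<close> depends on \<open>A A\<^sup>T\<close> only.
\<close>

section \<open>Standard Gaussian vectors\<close>

text \<open>An error of order \<open>1 / sqrt n\<close> is harmless only if moving the threshold by
  a constant, that is, the normalised argument by a constant over \<open>sqrt n\<close>, changes the
  Gaussian orthant probability by at least a comparable amount. Upper bounds on the Gaussian density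
  do not give this. The increments of P[A W \<le> s 1] near s = b therefore need a linear lower
  bound; it comes from Cameron--Martin shifts along \<open>lin I B (\<lambda>_. 1)\<close>, which
  move all components of A W by the same amount and make increments over nearby intervals
  comparable. It also gives the uniqueness of b.

  Orthant indicators are not smooth, so every expansion falls on the Gaussian density and uses only
  a bound on the test function. Monotonicity of distribution functions then removes the smoothing.

  Only components in \<open>Imin P K\<close> compete with the threshold. The others exceed it by
  order n except with probability \<open>O(1 / sqrt n)\<close>, which a constant change of the
  threshold absorbs as well.\<close>

lemma indicator_PiE_restrict:
  assumes "finite I"
  shows "indicator (Pi\<^sub>E I A) (\<lambda>i\<in>I. x i) = (\<Prod>i\<in>I. indicator (A i) (x i) :: ennreal)"
proof (cases "\<forall>i\<in>I. x i \<in> A i")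
  case True
  then show ?thesis by auto
next
  case False
  then obtain i where i: "i \<in> I" "x i \<notin> A i" by auto
  then have "(\<Prod>i\<in>I. indicator (A i) (x i) :: ennreal) = 0"
    using assms by (intro prod_zero) (auto intro!: bexI[of _ i])
  then show ?thesis using i by (auto simp: PiE_iff indicator_def)
qed

text \<open>Boxes determine a product measure, and on a box the integral of a product of
  one-coordinate functions factorises. There are two uses: the Cameron--Martin density in several
  dimensions and the likelihood ratio of \<open>n\<close> observations.\<close>

lemma PiM_density:
  assumes fin: "finite I"
    and M: "\<And>i. prob_space (M i)"
    and f[measurable]: "\<And>i. f i \<in> borel_measurable (M i)"
    and D: "\<And>i. prob_space (density (M i) (f i))"
  shows "PiM I (\<lambda>i. density (M i) (f i)) = density (PiM I M) (\<lambda>x. \<Prod>i\<in>I. f i (x i))"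
proof -
  interpret M: product_prob_space M by (simp add: product_prob_spaceI M)
  interpret D: product_prob_space "\<lambda>i. density (M i) (f i)" by (simp add: product_prob_spaceI D)
  have S: "sets (PiM I (\<lambda>i. density (M i) (f i))) = sets (PiM I M)"
    by (intro sets_PiM_cong) auto
  have "density (PiM I M) (\<lambda>x. \<Prod>i\<in>I. f i (x i)) = PiM I (\<lambda>i. density (M i) (f i))"
  proof (rule D.PiM_eqI[OF fin])
    show "sets (density (PiM I M) (\<lambda>x. \<Prod>i\<in>I. f i (x i))) = sets (PiM I (\<lambda>i. density (M i) (f i)))"
      using S by simp
    fix A assume A: "\<And>i. i \<in> I \<Longrightarrow> A i \<in> sets (density (M i) (f i))"
    then have A': "\<And>i. i \<in> I \<Longrightarrow> A i \<in> sets (M i)" by simp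
    have [measurable]: "Pi\<^sub>E I A \<in> sets (PiM I M)"
      using A' fin by (intro sets_PiM_I_finite) auto
    have "emeasure (density (PiM I M) (\<lambda>x. \<Prod>i\<in>I. f i (x i))) (Pi\<^sub>E I A)
      = (\<integral>\<^sup>+x. (\<Prod>i\<in>I. f i (x i)) * indicator (Pi\<^sub>E I A) x \<partial>PiM I M)"
      using fin by (subst emeasure_density) auto
    also have "\<dots> = (\<integral>\<^sup>+x. (\<Prod>i\<in>I. f i (x i) * indicator (A i) (x i)) \<partial>PiM I M)"
    proof (rule nn_integral_cong)
      fix x assume x: "x \<in> space (PiM I M)"
      have "(\<lambda>i\<in>I. x i) = x" using x by (auto simp: space_PiM PiE_iff extensional_restrict)
      then have "indicator (Pi\<^sub>E I A) x = (\<Prod>i\<in>I. indicator (A i) (x i) :: ennreal)"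
        using indicator_PiE_restrict[OF fin, of A x] by simp
      then show "(\<Prod>i\<in>I. f i (x i)) * indicator (Pi\<^sub>E I A) x
        = (\<Prod>i\<in>I. f i (x i) * indicator (A i) (x i))"
        by (simp add: prod.distrib)
    qed
    also have "\<dots> = (\<Prod>i\<in>I. \<integral>\<^sup>+x. f i x * indicator (A i) x \<partial>M i)"
      using A' by (intro M.product_nn_integral_prod fin) auto
    also have "\<dots> = (\<Prod>i\<in>I. emeasure (density (M i) (f i)) (A i))"
      using A' by (intro prod.cong refl) (simp add: emeasure_density)
    finally show "emeasure (density (PiM I M) (\<lambda>x. \<Prod>i\<in>I. f i (x i))) (Pi\<^sub>E I A)
      = (\<Prod>i\<in>I. emeasure (density (M i) (f i)) (A i))" .
  qed
  then show ?thesis by simp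
qed

abbreviation norm1 :: "nat set \<Rightarrow> (nat \<Rightarrow> real) \<Rightarrow> real" where
  "norm1 I w \<equiv> \<Sum>l\<in>I. \<bar>w l\<bar>"

abbreviation dotp :: "nat set \<Rightarrow> (nat \<Rightarrow> real) \<Rightarrow> (nat \<Rightarrow> real) \<Rightarrow> real" where
  "dotp I a w \<equiv> \<Sum>l\<in>I. a l * w l"

abbreviation quad :: "nat set \<Rightarrow> real \<Rightarrow> (nat \<Rightarrow> real) \<Rightarrow> (nat \<Rightarrow> nat \<Rightarrow> real) \<Rightarrow> (nat \<Rightarrow> real) \<Rightarrow> real" where
  "quad I c0 c1 c2 a \<equiv> c0 + (\<Sum>l\<in>I. c1 l * a l) + (\<Sum>l\<in>I. \<Sum>m\<in>I. c2 l m * (a l * a m))"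

abbreviation std_gauss1 :: "real measure" where
  "std_gauss1 \<equiv> density lborel (\<lambda>x. ennreal (std_normal_density x))"

lemma prob_space_std_gauss1: "prob_space std_gauss1"
  by (rule prob_space_normal_density) simp

lemma product_prob_space_std_gauss1: "product_prob_space (\<lambda>_. std_gauss1)"
  by (simp add: product_prob_spaceI prob_space_std_gauss1)

lemma prob_space_std_gauss: "prob_space (std_gauss I)"
proof -
  show ?thesis unfolding std_gauss_def by (intro prob_space_PiM prob_space_std_gauss1)
qed

lemma sets_std_gauss [measurable_cong]: "sets (std_gauss I) = sets (PiM I (\<lambda>_. borel))"
  unfolding std_gauss_def by (intro sets_PiM_cong) auto

lemma space_std_gauss: "space (std_gauss I) = PiE I (\<lambda>_. UNIV)"
  by (simp add: std_gauss_def space_PiM)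

text \<open>Dividing the density of N(a, 1) by that of N(0, 1) leaves this exponential: the
  Cameron--Martin formula in one dimension.\<close>

lemma distr_std_gauss1_shift:
  "distr std_gauss1 std_gauss1 (\<lambda>x. x + a) = density std_gauss1 (\<lambda>x. ennreal (exp (a * x - a\<^sup>2 / 2)))"
proof -
  have "distr std_gauss1 lborel (\<lambda>x. x + a) = density lborel (\<lambda>x. ennreal (normal_density a 1 x))"
  proof -
    interpret prob_space std_gauss1 by (rule prob_space_std_gauss1)
    have "distributed std_gauss1 lborel (\<lambda>x. x) std_normal_density"
      by (auto simp: distributed_def cong: distr_cong) (subst distr_id2; simp)
    from normal_density_affine[OF this, of 1 a] show ?thesis
      by (simp add: distributed_def add.commute)
  qed
  also have "\<dots> = density std_gauss1 (\<lambda>x. ennreal (exp (a * x - a\<^sup>2 / 2)))"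
  proof -
    have "normal_density a 1 x = std_normal_density x * exp (a * x - a\<^sup>2 / 2)" for x
      unfolding normal_density_def
      by (simp add: exp_add[symmetric] exp_diff[symmetric] algebra_simps power2_eq_square add_divide_distrib diff_divide_distrib)
    then show ?thesis
      by (subst density_density_eq) (auto simp: ennreal_mult)
  qed
  finally show ?thesis by (simp cong: distr_cong)
qed

lemma distr_std_gauss1_scale:
  assumes "0 < s"
  shows "distr std_gauss1 borel (\<lambda>x. s * x) = density lborel (\<lambda>x. ennreal (normal_density 0 s x))"
proof -
  interpret prob_space std_gauss1 by (rule prob_space_std_gauss1)
  have "distributed std_gauss1 lborel (\<lambda>x. x) std_normal_density"
    by (auto simp: distributed_def cong: distr_cong) (subst distr_id2; simp)
  from normal_density_affine[OF this, of s 0] assms show ?thesis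
    by (simp add: distributed_def cong: distr_cong)
qed

lemma nn_integral_std_gauss1_add:
  assumes [measurable]: "f \<in> borel_measurable borel" and ab: "0 < a" "0 < b"
  shows "(\<integral>\<^sup>+x. \<integral>\<^sup>+y. f (sqrt a * x + sqrt b * y) \<partial>std_gauss1 \<partial>std_gauss1) =
    (\<integral>\<^sup>+x. f (sqrt (a + b) * x) \<partial>std_gauss1)"
proof -
  define Nd where "Nd s = density lborel (\<lambda>x. ennreal (normal_density 0 s x))" for s
  have fm: "finite_measure (Nd s)" if "0 < s" for s
    unfolding Nd_def using prob_space_normal_density[OF that] by (simp add: prob_space_def)
  have s: "0 < sqrt a" "0 < sqrt b" "0 < sqrt (a + b)" using ab by auto
  have [measurable_cong]: "sets (Nd s) = sets borel" for s by (simp add: Nd_def)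
  then have [simp]: "sets (Nd s) = sets borel" for s .
  have "(\<integral>\<^sup>+x. f (sqrt (a + b) * x) \<partial>std_gauss1) = (\<integral>\<^sup>+x. f x \<partial>distr std_gauss1 borel (\<lambda>x. sqrt (a + b) * x))"
    by (subst nn_integral_distr) auto
  also have "\<dots> = (\<integral>\<^sup>+x. f x \<partial>Nd (sqrt (a + b)))"
    using s by (simp add: distr_std_gauss1_scale Nd_def)
  also have "Nd (sqrt (a + b)) = convolution (Nd (sqrt a)) (Nd (sqrt b))"
    unfolding Nd_def
    using convolution_density[OF _ _ fm[OF s(1), unfolded Nd_def] fm[OF s(2), unfolded Nd_def]]
      conv_normal_density_zero_mean[OF s(1,2)] ab
    by (simp add: ennreal_mult)
  also have "(\<integral>\<^sup>+x. f x \<partial>convolution (Nd (sqrt a)) (Nd (sqrt b))) =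
      (\<integral>\<^sup>+x. \<integral>\<^sup>+y. f (x + y) \<partial>Nd (sqrt b) \<partial>Nd (sqrt a))"
    using s by (subst nn_integral_convolution) (auto intro!: fm)
  also have "\<dots> = (\<integral>\<^sup>+x. \<integral>\<^sup>+y. f (x + sqrt b * y) \<partial>std_gauss1 \<partial>Nd (sqrt a))"
    unfolding Nd_def distr_std_gauss1_scale[OF s(2), symmetric]
    by (subst nn_integral_distr) auto
  also have "\<dots> = (\<integral>\<^sup>+x. \<integral>\<^sup>+y. f (sqrt a * x + sqrt b * y) \<partial>std_gauss1 \<partial>std_gauss1)"
  proof -
    interpret prob_space std_gauss1 by (rule prob_space_std_gauss1)
    show ?thesis
    unfolding Nd_def distr_std_gauss1_scale[OF s(1), symmetric]
    by (subst nn_integral_distr) auto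
  qed
  finally show ?thesis by simp
qed

lemma distr_std_gauss_shift:
  assumes fin: "finite I"
  shows "distr (std_gauss I) (std_gauss I) (\<lambda>w. \<lambda>l\<in>I. w l + a l) =
    density (std_gauss I) (\<lambda>w. ennreal (exp ((dotp I a w) - (\<Sum>l\<in>I. (a l)\<^sup>2) / 2)))"
proof -
  interpret G: prob_space std_gauss1 by (rule prob_space_std_gauss1)
  interpret GG: product_prob_space "\<lambda>_. std_gauss1" by (rule product_prob_space_std_gauss1)
  define e where "e i x = ennreal (exp (a i * x - (a i)\<^sup>2 / 2))" for i x
  have e: "density std_gauss1 (e i) = distr std_gauss1 std_gauss1 (\<lambda>x. x + a i)" for i
    unfolding distr_std_gauss1_shift e_def ..
  have pe: "prob_space (density std_gauss1 (e i))" for i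
    unfolding e by (rule G.prob_space_distr) simp
  interpret E: product_prob_space "\<lambda>i. density std_gauss1 (e i)" by (simp add: product_prob_spaceI pe)
  have me[measurable]: "e i \<in> borel_measurable borel" for i unfolding e_def by simp
  have "distr (std_gauss I) (std_gauss I) (\<lambda>w. \<lambda>l\<in>I. w l + a l) = PiM I (\<lambda>i. density std_gauss1 (e i))"
  proof (rule E.PiM_eqI[OF fin])
    show "sets (distr (std_gauss I) (std_gauss I) (\<lambda>w. \<lambda>l\<in>I. w l + a l)) = sets (PiM I (\<lambda>i. density std_gauss1 (e i)))"
      by (simp add: sets_std_gauss) (intro sets_PiM_cong; simp)
    fix A assume "\<And>i. i \<in> I \<Longrightarrow> A i \<in> sets (density std_gauss1 (e i))"
    then have A: "\<And>i. i \<in> I \<Longrightarrow> A i \<in> sets borel" by simp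
    have [measurable]: "Pi\<^sub>E I A \<in> sets (PiM I (\<lambda>_. borel))"
      using A fin by (intro sets_PiM_I_finite) auto
    have "emeasure (distr (std_gauss I) (std_gauss I) (\<lambda>w. \<lambda>l\<in>I. w l + a l)) (Pi\<^sub>E I A) =
      emeasure (std_gauss I) ((\<lambda>w. \<lambda>l\<in>I. w l + a l) -` (Pi\<^sub>E I A) \<inter> space (std_gauss I))"
      by (subst emeasure_distr) auto
    also have "(\<lambda>w. \<lambda>l\<in>I. w l + a l) -` (Pi\<^sub>E I A) \<inter> space (std_gauss I) = Pi\<^sub>E I (\<lambda>i. (\<lambda>x. x + a i) -` A i)"
      by (auto simp: space_std_gauss PiE_iff extensional_def)
    also have "emeasure (std_gauss I) \<dots> = (\<Prod>i\<in>I. emeasure std_gauss1 ((\<lambda>x. x + a i) -` A i))"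
      unfolding std_gauss_def using A fin
      by (intro GG.emeasure_PiM fin) (auto intro!: measurable_sets_borel[where f="\<lambda>x. x + _" and M=borel])
    also have "\<dots> = (\<Prod>i\<in>I. emeasure (density std_gauss1 (e i)) (A i))"
      using A by (intro prod.cong refl) (simp add: e emeasure_distr)
    finally show "emeasure (distr (std_gauss I) (std_gauss I) (\<lambda>w. \<lambda>l\<in>I. w l + a l)) (Pi\<^sub>E I A) = 
      (\<Prod>i\<in>I. emeasure (density std_gauss1 (e i)) (A i))" .
  qed
  also have "\<dots> = density (std_gauss I) (\<lambda>w. \<Prod>i\<in>I. e i (w i))"
    unfolding std_gauss_def using fin pe prob_space_std_gauss1 by (intro PiM_density) auto
  also have "(\<lambda>w. \<Prod>i\<in>I. e i (w i)) = (\<lambda>w. ennreal (exp ((dotp I a w) - (\<Sum>l\<in>I. (a l)\<^sup>2) / 2)))"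
    unfolding e_def using fin
    by (subst prod_ennreal) (auto simp: exp_sum[symmetric] sum_subtractf sum_divide_distrib)
  finally show ?thesis .
qed

lemma integral_std_gauss_shift:
  fixes g :: "(nat \<Rightarrow> real) \<Rightarrow> real"
  assumes fin: "finite I" and g[measurable]: "g \<in> borel_measurable (std_gauss I)"
  shows "(\<integral>w. g (\<lambda>l\<in>I. w l + a l) \<partial>std_gauss I) =
    (\<integral>w. exp ((dotp I a w) - (\<Sum>l\<in>I. (a l)\<^sup>2) / 2) * g w \<partial>std_gauss I)"
proof -
  have [measurable]: "(\<lambda>w. \<lambda>l\<in>I. w l + a l) \<in> std_gauss I \<rightarrow>\<^sub>M std_gauss I"
    by measurable
  have "(\<integral>w. g (\<lambda>l\<in>I. w l + a l) \<partial>std_gauss I) =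
     (\<integral>w. g w \<partial>distr (std_gauss I) (std_gauss I) (\<lambda>w. \<lambda>l\<in>I. w l + a l))"
    by (subst integral_distr) auto
  also have "\<dots> = (\<integral>w. exp ((dotp I a w) - (\<Sum>l\<in>I. (a l)\<^sup>2) / 2) * g w \<partial>std_gauss I)"
    unfolding distr_std_gauss_shift[OF fin]
    by (subst integral_density) auto
  finally show ?thesis .
qed

text \<open>Evaluated on boxes, both laws are products of copies of N(0, a + b), by the convolution
  formula in one dimension. This is the source of the semigroup property of Gaussian
  smoothing.\<close>

lemma distr_std_gauss_add:
  assumes fin: "finite I" and ab: "0 < a" "0 < b"
  shows "distr (std_gauss I \<Otimes>\<^sub>M std_gauss I) (PiM I (\<lambda>_. borel)) (\<lambda>(v, w). \<lambda>l\<in>I. sqrt a * v l + sqrt b * w l) =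
    distr (std_gauss I) (PiM I (\<lambda>_. borel)) (\<lambda>w. \<lambda>l\<in>I. sqrt (a + b) * w l)"
proof -
  interpret G: prob_space std_gauss1 by (rule prob_space_std_gauss1)
  interpret GG: product_prob_space "\<lambda>_. std_gauss1" by (rule product_prob_space_std_gauss1)
  interpret GI: prob_space "std_gauss I" by (rule prob_space_std_gauss)
  interpret GI2: pair_prob_space "std_gauss I" "std_gauss I" ..
  define N where "N = distr std_gauss1 borel (\<lambda>x. sqrt (a + b) * x)"
  have pN: "prob_space N" unfolding N_def by (rule G.prob_space_distr) simp
  interpret NN: product_prob_space "\<lambda>_. N" by (simp add: product_prob_spaceI pN)
  have sN[simp]: "sets (PiM I (\<lambda>_. N)) = sets (PiM I (\<lambda>_. borel))"
    by (intro sets_PiM_cong) (auto simp: N_def)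
  have box: "Pi\<^sub>E I A \<in> sets (PiM I (\<lambda>_. borel))" if "\<And>i. i \<in> I \<Longrightarrow> A i \<in> sets N" for A :: "nat \<Rightarrow> real set"
    using that fin by (intro sets_PiM_I_finite) (auto simp: N_def)
  have "distr (std_gauss I) (PiM I (\<lambda>_. borel)) (\<lambda>w. \<lambda>l\<in>I. sqrt (a + b) * w l) = PiM I (\<lambda>_. N)"
  proof (rule NN.PiM_eqI[OF fin])
    fix A assume A: "\<And>i. i \<in> I \<Longrightarrow> A i \<in> sets N"
    then have A': "\<And>i. i \<in> I \<Longrightarrow> A i \<in> sets borel" by (simp add: N_def)
    note box[OF A, measurable]
    have "emeasure (distr (std_gauss I) (PiM I (\<lambda>_. borel)) (\<lambda>w. \<lambda>l\<in>I. sqrt (a + b) * w l)) (Pi\<^sub>E I A)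
      = (\<integral>\<^sup>+w. indicator (Pi\<^sub>E I A) (\<lambda>l\<in>I. sqrt (a + b) * w l) \<partial>std_gauss I)"
      by (subst nn_integral_indicator[symmetric], simp, subst nn_integral_distr) auto
    also have "\<dots> = (\<integral>\<^sup>+w. (\<Prod>i\<in>I. indicator (A i) (sqrt (a + b) * w i)) \<partial>std_gauss I)"
      by (simp add: indicator_PiE_restrict[OF fin])
    also have "\<dots> = (\<Prod>i\<in>I. \<integral>\<^sup>+x. indicator (A i) (sqrt (a + b) * x) \<partial>std_gauss1)"
      unfolding std_gauss_def using A' by (intro GG.product_nn_integral_prod[OF fin]) auto
    also have "\<dots> = (\<Prod>i\<in>I. emeasure N (A i))"
      using A' by (intro prod.cong refl) (simp add: N_def nn_integral_indicator[symmetric] nn_integral_distr del: nn_integral_indicator)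
    finally show "emeasure (distr (std_gauss I) (PiM I (\<lambda>_. borel)) (\<lambda>w. \<lambda>l\<in>I. sqrt (a + b) * w l)) (Pi\<^sub>E I A) = (\<Prod>i\<in>I. emeasure N (A i))" .
  qed simp
  moreover have "distr (std_gauss I \<Otimes>\<^sub>M std_gauss I) (PiM I (\<lambda>_. borel)) (\<lambda>(v, w). \<lambda>l\<in>I. sqrt a * v l + sqrt b * w l) = PiM I (\<lambda>_. N)"
  proof (rule NN.PiM_eqI[OF fin])
    fix A assume A: "\<And>i. i \<in> I \<Longrightarrow> A i \<in> sets N"
    then have A': "\<And>i. i \<in> I \<Longrightarrow> A i \<in> sets borel" by (simp add: N_def)
    note box[OF A, measurable]
    have "emeasure (distr (std_gauss I \<Otimes>\<^sub>M std_gauss I) (PiM I (\<lambda>_. borel)) (\<lambda>(v, w). \<lambda>l\<in>I. sqrt a * v l + sqrt b * w l)) (Pi\<^sub>E I A)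
      = (\<integral>\<^sup>+(v, w). indicator (Pi\<^sub>E I A) (\<lambda>l\<in>I. sqrt a * v l + sqrt b * w l) \<partial>(std_gauss I \<Otimes>\<^sub>M std_gauss I))"
      by (subst nn_integral_indicator[symmetric], simp, subst nn_integral_distr) (auto simp: split_beta')
    also have "\<dots> = (\<integral>\<^sup>+v. \<integral>\<^sup>+w. indicator (Pi\<^sub>E I A) (\<lambda>l\<in>I. sqrt a * v l + sqrt b * w l) \<partial>std_gauss I \<partial>std_gauss I)"
      by (subst GI.nn_integral_fst[symmetric]) auto
    also have "\<dots> = (\<integral>\<^sup>+v. \<integral>\<^sup>+w. (\<Prod>i\<in>I. indicator (A i) (sqrt a * v i + sqrt b * w i)) \<partial>std_gauss I \<partial>std_gauss I)"
      by (simp add: indicator_PiE_restrict[OF fin])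
    also have "\<dots> = (\<integral>\<^sup>+v. (\<Prod>i\<in>I. \<integral>\<^sup>+y. indicator (A i) (sqrt a * v i + sqrt b * y) \<partial>std_gauss1) \<partial>std_gauss I)"
      unfolding std_gauss_def using A' 
      by (subst GG.product_nn_integral_prod[where f="\<lambda>i y. indicator (A i) (sqrt a * _ i + sqrt b * y)", OF fin]) auto
    also have "\<dots> = (\<Prod>i\<in>I. \<integral>\<^sup>+x. \<integral>\<^sup>+y. indicator (A i) (sqrt a * x + sqrt b * y) \<partial>std_gauss1 \<partial>std_gauss1)"
      unfolding std_gauss_def using A' 
      by (intro GG.product_nn_integral_prod[where f="\<lambda>i x. \<integral>\<^sup>+y. indicator (A i) (sqrt a * x + sqrt b * y) \<partial>std_gauss1", OF fin]) auto
    also have "\<dots> = (\<Prod>i\<in>I. emeasure N (A i))"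
      using A' by (intro prod.cong refl)
        (simp add: N_def nn_integral_indicator[symmetric] nn_integral_distr nn_integral_std_gauss1_add[OF _ ab] del: nn_integral_indicator)
    finally show "emeasure (distr (std_gauss I \<Otimes>\<^sub>M std_gauss I) (PiM I (\<lambda>_. borel)) (\<lambda>(v, w). \<lambda>l\<in>I. sqrt a * v l + sqrt b * w l)) (Pi\<^sub>E I A) = (\<Prod>i\<in>I. emeasure N (A i))" .
  qed simp
  ultimately show ?thesis by simp
qed

lemma integral_std_gauss_add:
  fixes g :: "(nat \<Rightarrow> real) \<Rightarrow> real"
  assumes fin: "finite I" and ab: "0 < a" "0 < b" and g[measurable]: "g \<in> borel_measurable (PiM I (\<lambda>_. borel))"
    and bd: "\<And>w. \<bar>g w\<bar> \<le> C"
  shows "(\<integral>v. \<integral>w. g (\<lambda>l\<in>I. sqrt a * v l + sqrt b * w l) \<partial>std_gauss I \<partial>std_gauss I) =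
    (\<integral>w. g (\<lambda>l\<in>I. sqrt (a + b) * w l) \<partial>std_gauss I)"
proof -
  interpret GI: prob_space "std_gauss I" by (rule prob_space_std_gauss)
  interpret GI2: pair_prob_space "std_gauss I" "std_gauss I" ..
  have "(\<integral>w. g (\<lambda>l\<in>I. sqrt (a + b) * w l) \<partial>std_gauss I) =
     (\<integral>w. g w \<partial>distr (std_gauss I) (PiM I (\<lambda>_. borel)) (\<lambda>w. \<lambda>l\<in>I. sqrt (a + b) * w l))"
    by (subst integral_distr) auto
  also have "\<dots> = (\<integral>(v,w). g (\<lambda>l\<in>I. sqrt a * v l + sqrt b * w l) \<partial>(std_gauss I \<Otimes>\<^sub>M std_gauss I))"
    unfolding distr_std_gauss_add[OF fin ab, symmetric]
    by (subst integral_distr) (auto simp: split_beta')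
  also have "\<dots> = (\<integral>v. \<integral>w. g (\<lambda>l\<in>I. sqrt a * v l + sqrt b * w l) \<partial>std_gauss I \<partial>std_gauss I)"
    by (subst GI2.integral_fst'[symmetric])
       (auto intro!: GI2.P.integrable_const_bound[where B=C] simp: bd split_beta')
  finally show ?thesis by simp
qed

lemma integrable_exp_std_gauss1: "integrable std_gauss1 (\<lambda>x. exp (c * x))"
proof -
  interpret prob_space std_gauss1 by (rule prob_space_std_gauss1)
  interpret D: prob_space "distr std_gauss1 std_gauss1 (\<lambda>x. x + c)"
    by (rule prob_space_distr) simp
  have "(\<integral>\<^sup>+x. ennreal (exp (c * x - c\<^sup>2 / 2)) \<partial>std_gauss1) = emeasure (distr std_gauss1 std_gauss1 (\<lambda>x. x + c)) UNIV"
    unfolding distr_std_gauss1_shift by (subst emeasure_density) auto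
  also have "\<dots> = 1" using D.emeasure_space_1 by simp
  finally have "integrable std_gauss1 (\<lambda>x. exp (c * x - c\<^sup>2 / 2))"
    by (intro integrableI_nonneg) auto
  then have "integrable std_gauss1 (\<lambda>x. exp (c\<^sup>2 / 2) * exp (c * x - c\<^sup>2 / 2))"
    by (rule integrable_mult_right)
  then show ?thesis by (simp add: exp_add[symmetric])
qed

lemma integrable_exp_abs_std_gauss1: "integrable std_gauss1 (\<lambda>x. exp (c * \<bar>x\<bar>))"
proof (rule Bochner_Integration.integrable_bound)
  show "integrable std_gauss1 (\<lambda>x. exp (c * x) + exp ((- c) * x))"
    by (intro Bochner_Integration.integrable_add integrable_exp_std_gauss1)
  show "AE x in std_gauss1. norm (exp (c * \<bar>x\<bar>)) \<le> norm (exp (c * x) + exp (- c * x))"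
  proof (rule AE_I2)
    fix x
    show "norm (exp (c * \<bar>x\<bar>)) \<le> norm (exp (c * x) + exp (- c * x))"
      using exp_gt_zero[of "c * x"] exp_gt_zero[of "- c * x"] by (cases "x < 0") (simp_all add: abs_of_pos)
  qed
qed simp

text \<open>The l1 norm is preferred to the Euclidean one because its exponential is a product over
  the coordinates. It dominates every polynomial that occurs below.\<close>

lemma integrable_exp_std_gauss:
  assumes "finite I"
  shows "integrable (std_gauss I) (\<lambda>w. exp (c * (norm1 I w)))"
proof -
  interpret product_prob_space "\<lambda>_. std_gauss1" by (rule product_prob_space_std_gauss1)
  have "integrable (std_gauss I) (\<lambda>w. \<Prod>l\<in>I. exp (c * \<bar>w l\<bar>))"
    unfolding std_gauss_def by (intro product_integrable_prod assms integrable_exp_abs_std_gauss1)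
  then show ?thesis by (simp add: exp_sum assms sum_distrib_left)
qed

lemma integrable_std_gauss_bound:
  fixes g :: "(nat \<Rightarrow> real) \<Rightarrow> real"
  assumes "finite I" "g \<in> borel_measurable (std_gauss I)"
    and "\<And>w. \<bar>g w\<bar> \<le> K * exp (c * (norm1 I w))"
  shows "integrable (std_gauss I) g"
  by (rule Bochner_Integration.integrable_bound[OF integrable_mult_right[OF integrable_exp_std_gauss[OF assms(1), of c], of K]])
     (use assms in \<open>auto intro!: AE_I2 order_trans[OF assms(3)] abs_ge_self simp del: abs_mult simp: abs_mult[symmetric]\<close>)

lemma norm1_le_exp: "norm1 I w \<le> exp (norm1 I w)"
  using exp_ge_add_one_self[of "norm1 I w"] by linarith

lemma coordinate_le_exp:
  assumes "finite I" "l \<in> I"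
  shows "\<bar>w l\<bar> \<le> exp (norm1 I w)"
  using member_le_sum[OF assms(2), of "\<lambda>l. \<bar>w l\<bar>"] norm1_le_exp[where I=I and w=w] assms(1) by fastforce

lemma integral_std_gauss1_id: "integrable std_gauss1 (\<lambda>x. x)" "(\<integral>x. x \<partial>std_gauss1) = 0"
proof -
  show "integrable std_gauss1 (\<lambda>x. x)"
    using integrable_std_normal_moment[of 1] by (subst integrable_density) auto
  show "(\<integral>x. x \<partial>std_gauss1) = 0"
    using integral_std_normal_moment_odd[of 0] by (subst integral_density) auto
qed

lemma integral_std_gauss1_square: "integrable std_gauss1 (\<lambda>x. x * x)" "(\<integral>x. x * x \<partial>std_gauss1) = 1"
proof -
  show "integrable std_gauss1 (\<lambda>x. x * x)"
    using integrable_std_normal_moment[of 2] by (subst integrable_density) (auto simp: power2_eq_square)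
  show "(\<integral>x. x * x \<partial>std_gauss1) = 1"
    using integral_std_normal_moment_even[of 1] by (subst integral_density) (auto simp: power2_eq_square)
qed

lemma integral_std_gauss_coordinate:
  assumes "finite I" "l \<in> I"
  shows "(\<integral>w. w l \<partial>std_gauss I) = 0"
proof -
  have "(\<integral>w. w l \<partial>std_gauss I) = (\<integral>x. x \<partial>distr (std_gauss I) std_gauss1 (\<lambda>w. w l))"
    using assms by (subst integral_distr) auto
  also have "distr (std_gauss I) std_gauss1 (\<lambda>w. w l) = std_gauss1"
    unfolding std_gauss_def using assms by (intro distr_PiM_component prob_space_std_gauss1) auto
  finally show ?thesis by (simp add: integral_std_gauss1_id)
qed

lemma integral_std_gauss_coordinates:
  assumes "finite I" "l \<in> I" "m \<in> I"
  shows "(\<integral>w. w l * w m \<partial>std_gauss I) = (if l = m then 1 else 0)"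
proof -
  interpret product_prob_space "\<lambda>_. std_gauss1" by (rule product_prob_space_std_gauss1)
  have c: "integrable std_gauss1 (\<lambda>x. 1 :: real)" using integrable_exp_std_gauss1[of 0] by simp
  have d: "(\<integral>x. 1 \<partial>std_gauss1) = (1 :: real)" by (subst integral_density) auto
  define f :: "nat \<Rightarrow> real \<Rightarrow> real" where "f i x = (if i = l then x else 1) * (if i = m then x else 1)" for i x
  have "(\<integral>w. w l * w m \<partial>std_gauss I) = (\<integral>w. (\<Prod>i\<in>I. f i (w i)) \<partial>std_gauss I)"
    unfolding f_def prod.distrib using assms by (simp add: prod.delta' prod.delta)
  also have "\<dots> = (\<Prod>i\<in>I. integral\<^sup>L std_gauss1 (f i))"
    unfolding std_gauss_def using assms(1)
  proof (rule product_integral_prod)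
    fix i
    consider "f i = (\<lambda>x. x * x)" | "f i = (\<lambda>x. x)" | "f i = (\<lambda>x. 1)"
      unfolding f_def fun_eq_iff by fastforce
    then show "integrable std_gauss1 (f i)"
      by cases (simp_all only: integral_std_gauss1_id integral_std_gauss1_square c)
  qed
  also have "\<dots> = (if l = m then 1 else 0)"
  proof (cases "l = m")
    case True
    have "integral\<^sup>L std_gauss1 (f i) = 1" for i
    proof -
      have "f i = (\<lambda>x. x * x) \<or> f i = (\<lambda>x. 1)" using True by (cases "i = l") (auto simp: f_def fun_eq_iff)
      then show ?thesis
        by (elim disjE) (simp_all only: integral_std_gauss1_square d)
    qed
    then show ?thesis using True by simp
  next
    case False
    then have "f l = (\<lambda>x. x)" by (auto simp: f_def)
    then have "integral\<^sup>L std_gauss1 (f l) = 0" by (simp only: integral_std_gauss1_id)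
    then have "(\<Prod>i\<in>I. integral\<^sup>L std_gauss1 (f i)) = 0"
      using assms(1,2) by (intro prod_zero) blast+
    then show ?thesis using False by simp
  qed
  finally show ?thesis .
qed

section \<open>Expansion of the Cameron--Martin density in the shift\<close>

lemma exp_taylor_2: "\<bar>exp y - 1 - y - y\<^sup>2 / 2\<bar> \<le> \<bar>y\<bar> ^ 3 * exp \<bar>y\<bar>" for y :: real
proof -
  obtain t where t: "\<bar>t\<bar> \<le> \<bar>y\<bar>" "exp y = (\<Sum>m<3. y ^ m / fact m) + exp t / fact 3 * y ^ 3"
    using Maclaurin_exp_le by blast
  have "exp y - 1 - y - y\<^sup>2 / 2 = exp t / 6 * y ^ 3"
    using t(2) by (simp add: numeral_3_eq_3 eval_nat_numeral fact_numeral)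
  also have "\<bar>\<dots>\<bar> = exp t / 6 * \<bar>y\<bar> ^ 3" by (simp add: abs_mult power_abs)
  also have "\<dots> \<le> exp \<bar>y\<bar> * \<bar>y\<bar> ^ 3"
  proof (rule mult_right_mono)
    have "exp t \<le> exp \<bar>y\<bar>" using t(1) by simp
    moreover have "exp t / 6 \<le> exp t" by simp
    ultimately show "exp t / 6 \<le> exp \<bar>y\<bar>" by linarith
  qed simp
  finally show ?thesis by (simp add: mult.commute)
qed

text \<open>To be read with \<open>p\<close> the inner product of shift and point, \<open>q\<close>
  the squared length of the shift, and \<open>s\<close>, \<open>m\<close> the l1 norms of shift and
  point. For \<open>s \<le> 1\<close> the exponent is at most \<open>s * (m + 1)\<close> and
  Taylor's formula applies. For \<open>s > 1\<close> the polynomial terms are at most of order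
  \<open>s ^ 3\<close>, while the exponential is kept as it is: its integral is 1, whereas a
  pointwise bound such as \<open>exp (s * m)\<close> would have an integral growing faster than any
  power of \<open>s\<close>.\<close>

lemma tilt_remainder_bound:
  fixes p q s m :: real
  assumes s: "0 \<le> s" and m: "0 \<le> m" and p: "\<bar>p\<bar> \<le> s * m" and q: "0 \<le> q" "q \<le> s\<^sup>2"
  shows "\<bar>exp (p - q / 2) - 1 - p - (p\<^sup>2 - q) / 2\<bar> \<le>
    (if s \<le> 1 then 0 else exp (p - q / 2)) + 4 * s ^ 3 * exp (4 * m)"
proof -
  have m1: "1 + m \<le> exp m" by (rule exp_ge_add_one_self)
  show ?thesis
  proof (cases "s \<le> 1")
    case True
    define y where "y = p - q / 2"
    have s3: "s\<^sup>2 \<le> s" using s True by (simp add: power2_eq_square mult_left_le)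
    have y: "\<bar>y\<bar> \<le> s * (m + 1)" using p q s3 unfolding y_def by (simp add: algebra_simps)
    also have "\<dots> \<le> 1 * (m + 1)" using True m by (intro mult_right_mono) auto
    finally have y1: "\<bar>y\<bar> \<le> m + 1" by simp
    have eq: "exp (p - q / 2) - 1 - p - (p\<^sup>2 - q) / 2 = (exp y - 1 - y - y\<^sup>2 / 2) - p * q / 2 + q\<^sup>2 / 8"
      unfolding y_def by (simp add: power2_eq_square field_simps)
    have "\<bar>y\<bar> ^ 3 * exp \<bar>y\<bar> \<le> (s * (m + 1)) ^ 3 * exp (m + 1)"
      using y y1 by (intro mult_mono power_mono) auto
    also have "\<dots> = s ^ 3 * ((1 + m) ^ 3 * exp (m + 1))" by (simp add: power_mult_distrib add.commute)
    \<comment> \<open>Each factor \<open>1 + m\<close> is at most \<open>exp m\<close>, which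
      together with \<open>exp (m + 1)\<close> makes \<open>exp (4 * m)\<close> and a factor
      \<open>exp 1 \<le> 3\<close>. The fourth unit of the constant 4 pays for the terms
      \<open>p * q / 2\<close> and \<open>q\<^sup>2 / 8\<close> below.\<close>
    also have "\<dots> \<le> s ^ 3 * ((exp m) ^ 3 * exp (m + 1))"
      using m m1 s by (intro mult_mono mult_left_mono power_mono) auto
    also have "\<dots> = s ^ 3 * (exp (4 * m) * exp 1)"
      by (simp add: exp_add[symmetric] exp_of_nat_mult[symmetric])
    also have "\<dots> \<le> s ^ 3 * (exp (4 * m) * 3)"
      using s exp_le by (intro mult_left_mono) auto
    finally have 1: "\<bar>exp y - 1 - y - y\<^sup>2 / 2\<bar> \<le> 3 * s ^ 3 * exp (4 * m)"
      using exp_taylor_2[of y] by simp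
    have "\<bar>p * q / 2\<bar> \<le> s ^ 3 * m / 2"
    proof -
      have "\<bar>p\<bar> * q \<le> (s * m) * s\<^sup>2" using p q s m by (intro mult_mono) auto
      then show ?thesis using q by (simp add: abs_mult power2_eq_square power3_eq_cube algebra_simps)
    qed
    moreover have "q\<^sup>2 / 8 \<le> s ^ 3 / 8"
    proof -
      have "q * q \<le> s\<^sup>2 * s" using q s s3 by (intro mult_mono) auto
      then show ?thesis by (simp add: power2_eq_square power3_eq_cube)
    qed
    moreover have "s ^ 3 * m / 2 + s ^ 3 / 8 \<le> s ^ 3 * exp (4 * m)"
    proof -
      have "m / 2 + 1 / 8 \<le> exp (4 * m)" using exp_ge_add_one_self[of "4 * m"] m by linarith
      then have "s ^ 3 * (m / 2 + 1 / 8) \<le> s ^ 3 * exp (4 * m)" using s by (intro mult_left_mono) auto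
      then show ?thesis by (simp add: algebra_simps)
    qed
    moreover have "0 \<le> q\<^sup>2 / 8" by simp
    ultimately have "\<bar>exp (p - q / 2) - 1 - p - (p\<^sup>2 - q) / 2\<bar> \<le> 3 * s ^ 3 * exp (4 * m) + s ^ 3 * exp (4 * m)"
      unfolding eq using 1 by linarith
    then show ?thesis using True by simp
  next
    case False
    then have s1: "1 \<le> s" "1 \<le> s ^ 3" "s \<le> s ^ 3" "s\<^sup>2 \<le> s ^ 3"
      using power_increasing[of 1 3 s] power_increasing[of 2 3 s] by auto
    have p2: "p\<^sup>2 \<le> s\<^sup>2 * m\<^sup>2" using power_mono[OF p, of 2] by (simp add: power_mult_distrib)
    have "\<bar>p\<bar> \<le> s ^ 3 * m" using p s1 m mult_right_mono by (meson order_trans)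
    moreover have "p\<^sup>2 \<le> s ^ 3 * m\<^sup>2" using p2 s1(4) mult_right_mono[of "s\<^sup>2" "s^3" "m\<^sup>2"] by simp
    moreover have "q \<le> s ^ 3" using q s1 by simp
    ultimately have "1 + \<bar>p\<bar> + (p\<^sup>2 + q) / 2 \<le> s ^ 3 + s ^ 3 * m + (s ^ 3 * m\<^sup>2 + s ^ 3) / 2"
      using s1 by (intro add_mono divide_right_mono) auto
    also have "\<dots> \<le> s ^ 3 * (4 * (1 + m)\<^sup>2)"
    proof -
      have "1 + m + (m\<^sup>2 + 1) / 2 \<le> 4 * (1 + m)\<^sup>2"
        using m by (simp add: power2_eq_square algebra_simps)
      then have "s ^ 3 * (1 + m + (m\<^sup>2 + 1) / 2) \<le> s ^ 3 * (4 * (1 + m)\<^sup>2)"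
        using s by (intro mult_left_mono) auto
      then show ?thesis by (simp add: algebra_simps)
    qed
    also have "\<dots> \<le> s ^ 3 * (4 * (exp (2 * m))\<^sup>2)"
      using s m m1 by (intro mult_left_mono power_mono) (auto intro: order_trans[OF m1])
    also have "(exp (2 * m))\<^sup>2 = exp (4 * m)"
      by (simp add: power2_eq_square exp_add[symmetric])
    also have "s ^ 3 * (4 * exp (4 * m)) = 4 * s ^ 3 * exp (4 * m)" by simp
    finally have "1 + \<bar>p\<bar> + (p\<^sup>2 + q) / 2 \<le> 4 * s ^ 3 * exp (4 * m)" .
    moreover have "\<bar>exp (p - q / 2) - 1 - p - (p\<^sup>2 - q) / 2\<bar> \<le> exp (p - q / 2) + (1 + \<bar>p\<bar> + (p\<^sup>2 + q) / 2)"
    proof -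
      have "0 \<le> exp (p - q / 2)" by auto
      moreover have "\<bar>(p\<^sup>2 - q) / 2\<bar> \<le> (p\<^sup>2 + q) / 2"
        using q(1) zero_le_power2[of p] by (simp add: abs_le_iff)
      ultimately show ?thesis by linarith
    qed
    ultimately show ?thesis using False by simp
  qed
qed

text \<open>The Cameron--Martin density of the standard Gaussian measure shifted by
  \<open>a\<close>.\<close>

definition tilt :: "nat set \<Rightarrow> (nat \<Rightarrow> real) \<Rightarrow> (nat \<Rightarrow> real) \<Rightarrow> real" where
  "tilt I a w = exp ((dotp I a w) - (\<Sum>l\<in>I. (a l)\<^sup>2) / 2)"

lemma abs_sum_mult_le:
  fixes a w :: "nat \<Rightarrow> real"
  assumes "finite I"
  shows "\<bar>\<Sum>l\<in>I. a l * w l\<bar> \<le> (norm1 I a) * (norm1 I w)"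
proof -
  have "\<bar>\<Sum>l\<in>I. a l * w l\<bar> \<le> (\<Sum>l\<in>I. \<bar>a l\<bar> * \<bar>w l\<bar>)"
    by (rule order_trans[OF sum_abs]) (simp add: abs_mult)
  also have "\<dots> \<le> (\<Sum>l\<in>I. \<bar>a l\<bar> * (norm1 I w))"
    using assms by (intro sum_mono mult_left_mono member_le_sum) auto
  finally show ?thesis by (simp add: sum_distrib_right)
qed

lemma integrable_tilt:
  assumes "finite I"
  shows "integrable (std_gauss I) (tilt I a)" "(\<integral>w. tilt I a w \<partial>std_gauss I) = 1"
proof -
  interpret prob_space "std_gauss I" by (rule prob_space_std_gauss)
  show "integrable (std_gauss I) (tilt I a)"
  proof (rule integrable_std_gauss_bound[OF assms])
    show "tilt I a \<in> borel_measurable (std_gauss I)" unfolding tilt_def by measurable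
    fix w
    have "(dotp I a w) - (\<Sum>l\<in>I. (a l)\<^sup>2) / 2 \<le> (norm1 I a) * (norm1 I w)"
      using abs_sum_mult_le[OF assms, of a w] sum_nonneg[of I "\<lambda>l. (a l)\<^sup>2"] by auto
    then show "\<bar>tilt I a w\<bar> \<le> 1 * exp ((norm1 I a) * (norm1 I w))"
      unfolding tilt_def by simp
  qed
  show "(\<integral>w. tilt I a w \<partial>std_gauss I) = 1"
    using integral_std_gauss_shift[OF assms, of "\<lambda>_. 1" a] prob_space unfolding tilt_def by simp
qed

lemma integrable_std_gauss_quadratic:
  assumes "finite I"
  shows "integrable (std_gauss I) (\<lambda>w. \<Sum>l\<in>I. a l * w l)"
    "integrable (std_gauss I) (\<lambda>w. (dotp I a w)\<^sup>2)"
proof -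
  let ?s = "\<Sum>l\<in>I. \<bar>a l\<bar>"
  have p: "\<bar>\<Sum>l\<in>I. a l * w l\<bar> \<le> ?s * exp (norm1 I w)" for w
  proof -
    have "norm1 I w \<le> exp (norm1 I w)" by (rule norm1_le_exp)
    then have "?s * (norm1 I w) \<le> ?s * exp (norm1 I w)"
      by (intro mult_left_mono sum_nonneg) auto
    then show ?thesis using abs_sum_mult_le[OF assms, of a w] by linarith
  qed
  show "integrable (std_gauss I) (\<lambda>w. \<Sum>l\<in>I. a l * w l)"
    by (rule integrable_std_gauss_bound[OF assms, where K="?s" and c=1]) (use p in auto)
  show "integrable (std_gauss I) (\<lambda>w. (dotp I a w)\<^sup>2)"
  proof (rule integrable_std_gauss_bound[OF assms, where K="?s\<^sup>2" and c=2])
    fix w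
    show "\<bar>(dotp I a w)\<^sup>2\<bar> \<le> ?s\<^sup>2 * exp (2 * (norm1 I w))"
      using power_mono[OF p[of w], of 2] by (simp add: power_mult_distrib exp_of_nat_mult[symmetric])
  qed simp
qed

text \<open>The subtracted polynomial is the Hermite expansion of \<open>tilt\<close> up to degree
  two. The bound holds for all shifts, not only for small ones: when the l1 norm of \<open>a\<close>
  exceeds 1, the total mass 1 of \<open>tilt\<close> is itself below the cube of that norm.\<close>

lemma tilt_second_order:
  assumes fin: "finite I"
  shows "\<exists>C>0. \<forall>a. (\<integral>w. \<bar>tilt I a w - 1 - (dotp I a w) -
      ((dotp I a w)\<^sup>2 - (\<Sum>l\<in>I. (a l)\<^sup>2)) / 2\<bar> \<partial>std_gauss I) \<le> C * (norm1 I a) ^ 3"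
proof -
  interpret prob_space "std_gauss I" by (rule prob_space_std_gauss)
  define J where "J = (\<integral>w. exp (4 * (norm1 I w)) \<partial>std_gauss I)"
  have J: "0 \<le> J" unfolding J_def by simp
  show ?thesis
  proof (intro exI[of _ "1 + 4 * J"] conjI allI)
    fix a :: "nat \<Rightarrow> real"
    define s where "s = (norm1 I a)"
    define q where "q = (\<Sum>l\<in>I. (a l)\<^sup>2)"
    let ?p = "\<lambda>w. \<Sum>l\<in>I. a l * w l"
    let ?m = "\<lambda>w. \<Sum>l\<in>I. \<bar>w l\<bar>"
    have s: "0 \<le> s" unfolding s_def by (intro sum_nonneg) auto
    have q: "0 \<le> q" unfolding q_def by (intro sum_nonneg) auto
    have q2: "q \<le> s\<^sup>2"
      using abs_sum_mult_le[OF fin, of a a] unfolding q_def s_def by (simp add: power2_eq_square)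
    have pt: "\<bar>tilt I a w - 1 - ?p w - ((?p w)\<^sup>2 - q) / 2\<bar> \<le>
        (if s \<le> 1 then 0 else 1) * tilt I a w + 4 * s ^ 3 * exp (4 * ?m w)" for w
    proof -
      have "0 \<le> ?m w" by (intro sum_nonneg) auto
      from tilt_remainder_bound[OF s this _ q q2, of "?p w"]
      show ?thesis using abs_sum_mult_le[OF fin, of a w] unfolding tilt_def s_def q_def by auto
    qed
    have i1: "integrable (std_gauss I) (\<lambda>w. (if s \<le> 1 then 0 else 1) * tilt I a w + 4 * s ^ 3 * exp (4 * ?m w))"
      by (intro Bochner_Integration.integrable_add integrable_mult_right integrable_tilt integrable_exp_std_gauss fin)
    have "(\<integral>w. \<bar>tilt I a w - 1 - ?p w - ((?p w)\<^sup>2 - q) / 2\<bar> \<partial>std_gauss I) \<le>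
      (\<integral>w. (if s \<le> 1 then 0 else 1) * tilt I a w + 4 * s ^ 3 * exp (4 * ?m w) \<partial>std_gauss I)"
      using fin by (intro integral_mono i1 pt integrable_abs Bochner_Integration.integrable_diff integrable_tilt
        integrable_std_gauss_quadratic integrable_const integrable_divide) 
    also have "\<dots> = (if s \<le> 1 then 0 else 1) + 4 * s ^ 3 * J"
      unfolding J_def
      by (subst Bochner_Integration.integral_add)
         (auto intro!: integrable_mult_right integrable_tilt integrable_exp_std_gauss fin simp: integrable_tilt fin)
    also have "\<dots> \<le> s ^ 3 + 4 * s ^ 3 * J" using s by auto
    finally show "(\<integral>w. \<bar>tilt I a w - 1 - ?p w - ((?p w)\<^sup>2 - (\<Sum>l\<in>I. (a l)\<^sup>2)) / 2\<bar> \<partial>std_gauss I)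
      \<le> (1 + 4 * J) * (norm1 I a) ^ 3"
      unfolding q_def s_def by (simp add: algebra_simps)
  qed (use J in simp)
qed

text \<open>The shift is moved from \<open>g\<close> to the density, so boundedness of
  \<open>g\<close> replaces differentiability. The coefficients are integrals of \<open>g\<close>
  against Hermite polynomials of degree at most two. They do not depend on \<open>a\<close>; hence,
  once \<open>a\<close> is random, the main part sees only its first two moments.\<close>

lemma std_gauss_shift_second_order:
  assumes fin: "finite I"
  shows "\<exists>C>0. \<forall>g H. g \<in> borel_measurable (std_gauss I) \<longrightarrow> (\<forall>w. \<bar>g w\<bar> \<le> H) \<longrightarrow>
    (\<exists>c0 c1 c2. \<forall>a. \<bar>(\<integral>w. g (\<lambda>l\<in>I. w l + a l) \<partial>std_gauss I) -
      (quad I c0 c1 c2 a)\<bar> \<le> C * H * (norm1 I a) ^ 3)"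
proof -
  interpret prob_space "std_gauss I" by (rule prob_space_std_gauss)
  obtain C where C: "0 < C" "\<And>a. (\<integral>w. \<bar>tilt I a w - 1 - (dotp I a w) -
      ((dotp I a w)\<^sup>2 - (\<Sum>l\<in>I. (a l)\<^sup>2)) / 2\<bar> \<partial>std_gauss I) \<le> C * (norm1 I a) ^ 3"
    using tilt_second_order[OF fin] by auto
  show ?thesis
  proof (rule exI[of _ C], intro conjI allI impI)
    fix g :: "(nat \<Rightarrow> real) \<Rightarrow> real" and H :: real
    assume g[measurable]: "g \<in> borel_measurable (std_gauss I)" and H: "\<forall>w. \<bar>g w\<bar> \<le> H"
    have H0: "0 \<le> H" using H abs_ge_zero order_trans by blast
    have ig: "integrable (std_gauss I) g"
      using H by (intro integrable_const_bound[where B=H]) auto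
    have img: "integrable (std_gauss I) (\<lambda>w. f w * g w)" if f: "integrable (std_gauss I) f" for f :: "(nat \<Rightarrow> real) \<Rightarrow> real"
    proof (rule Bochner_Integration.integrable_bound)
      show "integrable (std_gauss I) (\<lambda>w. H * f w)" using f by simp
      show "(\<lambda>w. f w * g w) \<in> borel_measurable (std_gauss I)" using f by measurable
      show "AE w in std_gauss I. norm (f w * g w) \<le> norm (H * f w)"
        using H H0 by (intro AE_I2) (auto simp: abs_mult mult.commute[of "\<bar>f _\<bar>"] intro!: mult_right_mono)
    qed
    define c0 where "c0 = (\<integral>w. g w \<partial>std_gauss I)"
    define c1 where "c1 l = (\<integral>w. w l * g w \<partial>std_gauss I)" for l
    \<comment> \<open>The diagonal correction is the constant term of the Hermite polynomial
      \<open>(w l)\<^sup>2 - 1\<close>, halved like the rest of the second-order term.\<close>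
    define c2 where "c2 l m = (\<integral>w. (w l * w m) * g w \<partial>std_gauss I) / 2 - (if l = m then c0 / 2 else 0)" for l m
    have il: "integrable (std_gauss I) (\<lambda>w. w l)" if "l \<in> I" for l
      using integrable_std_gauss_quadratic(1)[OF fin, of "\<lambda>i. if i = l then 1 else 0"] that fin
      by (simp add: if_distrib[of "\<lambda>x. x * _"] sum.delta cong: if_cong)
    have iss: "integrable (std_gauss I) (\<lambda>w. w l * w m)" if "l \<in> I" "m \<in> I" for l m
    proof (rule integrable_std_gauss_bound[OF fin, where K=1 and c=2])
      fix w :: "nat \<Rightarrow> real"
      have "\<bar>w l\<bar> * \<bar>w m\<bar> \<le> exp (norm1 I w) * exp (norm1 I w)"
        using coordinate_le_exp[OF fin] that by (intro mult_mono) auto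
      then show "\<bar>w l * w m\<bar> \<le> 1 * exp (2 * (norm1 I w))"
        by (simp add: abs_mult exp_add[symmetric] )
    qed (use that in measurable)
    show "\<exists>c0 c1 c2. \<forall>a. \<bar>(\<integral>w. g (\<lambda>l\<in>I. w l + a l) \<partial>std_gauss I) -
      (quad I c0 c1 c2 a)\<bar> \<le> C * H * (norm1 I a) ^ 3"
    proof (intro exI[of _ c0] exI[of _ c1] exI[of _ c2] allI)
      fix a :: "nat \<Rightarrow> real"
      let ?p = "\<lambda>w. \<Sum>l\<in>I. a l * w l"
      let ?q = "\<Sum>l\<in>I. (a l)\<^sup>2"
      let ?rho = "\<lambda>w. tilt I a w - 1 - ?p w - ((?p w)\<^sup>2 - ?q) / 2"
      have irho: "integrable (std_gauss I) ?rho"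
        using fin by (intro Bochner_Integration.integrable_diff integrable_tilt
          integrable_std_gauss_quadratic integrable_const integrable_divide)
      have I1: "(\<integral>w. ?p w * g w \<partial>std_gauss I) = (\<Sum>l\<in>I. c1 l * a l)"
      proof -
        have "(\<integral>w. ?p w * g w \<partial>std_gauss I) = (\<integral>w. (\<Sum>l\<in>I. a l * (w l * g w)) \<partial>std_gauss I)"
          by (simp add: sum_distrib_right mult.assoc)
        also have "\<dots> = (\<Sum>l\<in>I. \<integral>w. a l * (w l * g w) \<partial>std_gauss I)"
          by (intro Bochner_Integration.integral_sum integrable_mult_right img il)
        finally show ?thesis by (simp add: c1_def mult.commute)
      qed
      have I2: "(\<integral>w. (?p w)\<^sup>2 * g w \<partial>std_gauss I) / 2 - ?q / 2 * c0 = (\<Sum>l\<in>I. \<Sum>m\<in>I. c2 l m * (a l * a m))"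
      proof -
        have "(\<integral>w. (?p w)\<^sup>2 * g w \<partial>std_gauss I) = (\<integral>w. (\<Sum>l\<in>I. \<Sum>m\<in>I. (a l * a m) * ((w l * w m) * g w)) \<partial>std_gauss I)"
          by (simp only: power2_eq_square sum_product, simp only: sum_distrib_right, simp only: mult_ac)
        also have "\<dots> = (\<Sum>l\<in>I. \<integral>w. (\<Sum>m\<in>I. (a l * a m) * ((w l * w m) * g w)) \<partial>std_gauss I)"
          by (rule Bochner_Integration.integral_sum)
             (intro Bochner_Integration.integrable_sum integrable_mult_right img iss; assumption)
        also have "\<dots> = (\<Sum>l\<in>I. \<Sum>m\<in>I. \<integral>w. (a l * a m) * ((w l * w m) * g w) \<partial>std_gauss I)"
          by (intro sum.cong refl Bochner_Integration.integral_sum integrable_mult_right img iss; assumption)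
        finally have 1: "(\<integral>w. (?p w)\<^sup>2 * g w \<partial>std_gauss I) = (\<Sum>l\<in>I. \<Sum>m\<in>I. (a l * a m) * (\<integral>w. (w l * w m) * g w \<partial>std_gauss I))"
          by simp
        have 2: "?q / 2 * c0 = (\<Sum>l\<in>I. \<Sum>m\<in>I. (if l = m then c0 / 2 else 0) * (a l * a m))"
        proof -
          have "(\<Sum>l\<in>I. \<Sum>m\<in>I. (if l = m then c0 / 2 else 0) * (a l * a m)) = (\<Sum>l\<in>I. c0 / 2 * (a l * a l))"
            using fin by (intro sum.cong refl) (simp add: if_distrib[of "\<lambda>x. x * _"] sum.delta' cong: if_cong)
          also have "\<dots> = c0 / 2 * ?q" unfolding sum_distrib_left power2_eq_square ..
          finally show ?thesis by simp
        qed
        show ?thesis unfolding 1 2 unfolding c2_def sum_divide_distrib sum_subtractf[symmetric]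
          by (intro sum.cong refl) (auto simp: field_simps)
      qed
      have "(\<integral>w. g (\<lambda>l\<in>I. w l + a l) \<partial>std_gauss I) = (\<integral>w. tilt I a w * g w \<partial>std_gauss I)"
        using integral_std_gauss_shift[OF fin g] unfolding tilt_def .
      also have "\<dots> = (\<integral>w. ?rho w * g w + (1 * g w + ?p w * g w + ((?p w)\<^sup>2 * g w / 2 - ?q / 2 * g w)) \<partial>std_gauss I)"
      proof (intro Bochner_Integration.integral_cong refl)
        have "T * x = (T - 1 - p - (p\<^sup>2 - q) / 2) * x + (1 * x + p * x + (p\<^sup>2 * x / 2 - q / 2 * x))" for T p q x :: real
          by (simp add: left_diff_distrib diff_divide_distrib)
        then show "tilt I a w * g w = ?rho w * g w + (1 * g w + ?p w * g w + ((?p w)\<^sup>2 * g w / 2 - ?q / 2 * g w))" for w .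
      qed
      also have "\<dots> = (\<integral>w. ?rho w * g w \<partial>std_gauss I) + (c0 + (\<integral>w. ?p w * g w \<partial>std_gauss I) +
           ((\<integral>w. (?p w)\<^sup>2 * g w \<partial>std_gauss I) / 2 - ?q / 2 * c0))"
      proof -
        have 1: "integrable (std_gauss I) (\<lambda>w. ?rho w * g w)" by (rule img[OF irho])
        have 2: "integrable (std_gauss I) (\<lambda>w. ?p w * g w)"
          using integrable_std_gauss_quadratic(1)[OF fin, of a] by (rule img)
        have 3: "integrable (std_gauss I) (\<lambda>w. (?p w)\<^sup>2 * g w)"
          using integrable_std_gauss_quadratic(2)[OF fin, of a] by (rule img)
        have *: "(\<integral>w. f1 w + (1 * g w + f2 w + (f3 w / 2 - ?q / 2 * g w)) \<partial>std_gauss I) =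
          (\<integral>w. f1 w \<partial>std_gauss I) + (c0 + (\<integral>w. f2 w \<partial>std_gauss I) + ((\<integral>w. f3 w \<partial>std_gauss I) / 2 - ?q / 2 * c0))"
          if "integrable (std_gauss I) f1" "integrable (std_gauss I) f2" "integrable (std_gauss I) f3" for f1 f2 f3
          using that ig by (simp add: c0_def)
        show ?thesis by (rule *[OF 1 2 3])
      qed
      finally have "\<bar>(\<integral>w. g (\<lambda>l\<in>I. w l + a l) \<partial>std_gauss I) -
        (quad I c0 c1 c2 a)\<bar> = \<bar>\<integral>w. ?rho w * g w \<partial>std_gauss I\<bar>"
        unfolding I1 I2 by simp
      also have "\<dots> \<le> (\<integral>w. \<bar>?rho w * g w\<bar> \<partial>std_gauss I)" by (rule integral_abs_bound)
      also have "\<dots> \<le> (\<integral>w. H * \<bar>?rho w\<bar> \<partial>std_gauss I)"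
        using irho img[OF irho] H
        by (intro integral_mono integrable_abs integrable_mult_right)
           (auto simp: abs_mult mult.commute[of "\<bar>g _\<bar>"] mult.commute[of H] intro!: mult_left_mono)
      also have "\<dots> \<le> H * (C * (norm1 I a) ^ 3)"
        using C(2)[of a] H0 by (simp add: mult_left_mono)
      finally show "\<bar>(\<integral>w. g (\<lambda>l\<in>I. w l + a l) \<partial>std_gauss I) -
        (quad I c0 c1 c2 a)\<bar> \<le> C * H * (norm1 I a) ^ 3"
        by (simp add: mult_ac)
    qed
  qed (rule C(1))
qed

text \<open>For shifts of l1 norm at most 1 the second-order remainder and the linear and quadratic
  terms are all at most a multiple of that norm, with factors \<open>C\<close> and \<open>J\<close>.
  For longer shifts two integrals of a function bounded by 1 differ by at most 2, which is the last
  summand of the constant.\<close>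

lemma std_gauss_shift_first_order:
  assumes fin: "finite I"
  shows "\<exists>C>0. \<forall>g a. g \<in> borel_measurable (std_gauss I) \<longrightarrow> (\<forall>w. \<bar>g w\<bar> \<le> 1) \<longrightarrow>
    \<bar>(\<integral>w. g (\<lambda>l\<in>I. w l + a l) \<partial>std_gauss I) - (\<integral>w. g w \<partial>std_gauss I)\<bar> \<le> C * (norm1 I a)"
proof -
  interpret prob_space "std_gauss I" by (rule prob_space_std_gauss)
  obtain C where C: "0 < C" "\<And>a. (\<integral>w. \<bar>tilt I a w - 1 - (dotp I a w) -
      ((dotp I a w)\<^sup>2 - (\<Sum>l\<in>I. (a l)\<^sup>2)) / 2\<bar> \<partial>std_gauss I) \<le> C * (norm1 I a) ^ 3"
    using tilt_second_order[OF fin] by auto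
  define J where "J = (\<integral>w. exp (4 * (norm1 I w)) \<partial>std_gauss I)"
  have J: "0 \<le> J" unfolding J_def by simp
  show ?thesis
  proof (intro exI[of _ "C + J + 2"] conjI allI impI)
    fix g :: "(nat \<Rightarrow> real) \<Rightarrow> real" and a :: "nat \<Rightarrow> real"
    assume g[measurable]: "g \<in> borel_measurable (std_gauss I)" and H: "\<forall>w. \<bar>g w\<bar> \<le> 1"
    define s where "s = (norm1 I a)"
    define q where "q = (\<Sum>l\<in>I. (a l)\<^sup>2)"
    let ?p = "\<lambda>w. \<Sum>l\<in>I. a l * w l"
    let ?m = "\<lambda>w. \<Sum>l\<in>I. \<bar>w l\<bar>"
    let ?rho = "\<lambda>w. tilt I a w - 1 - ?p w - ((?p w)\<^sup>2 - q) / 2"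
    have s: "0 \<le> s" unfolding s_def by (intro sum_nonneg) auto
    have q: "0 \<le> q" unfolding q_def by (intro sum_nonneg) auto
    have q2: "q \<le> s\<^sup>2"
      using abs_sum_mult_le[OF fin, of a a] unfolding q_def s_def by (simp add: power2_eq_square)
    have ig: "integrable (std_gauss I) g"
      using H by (intro integrable_const_bound[where B=1]) auto
    have irho: "integrable (std_gauss I) ?rho"
      using fin by (intro Bochner_Integration.integrable_diff integrable_tilt
        integrable_std_gauss_quadratic integrable_const integrable_divide)
    show "\<bar>(\<integral>w. g (\<lambda>l\<in>I. w l + a l) \<partial>std_gauss I) - (\<integral>w. g w \<partial>std_gauss I)\<bar> \<le> (C + J + 2) * (norm1 I a)"
    proof (cases "s \<le> 1")
      case False
      have ig2: "integrable (std_gauss I) (\<lambda>w. g (\<lambda>l\<in>I. w l + a l))"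
        using H by (intro integrable_const_bound[where B=1]) auto
      have "\<bar>(\<integral>w. g (\<lambda>l\<in>I. w l + a l) \<partial>std_gauss I)\<bar> \<le> (\<integral>w. 1 \<partial>std_gauss I)"
        using H ig2 by (intro order_trans[OF integral_abs_bound] integral_mono) auto
      moreover have "\<bar>(\<integral>w. g w \<partial>std_gauss I)\<bar> \<le> (\<integral>w. 1 \<partial>std_gauss I)"
        using H ig by (intro order_trans[OF integral_abs_bound] integral_mono) auto
      ultimately have "\<bar>(\<integral>w. g (\<lambda>l\<in>I. w l + a l) \<partial>std_gauss I) - (\<integral>w. g w \<partial>std_gauss I)\<bar> \<le> 2"
        by (simp add: prob_space)
      also have "\<dots> \<le> (C + J + 2) * 1" using C(1) J by simp
      also have "\<dots> \<le> (C + J + 2) * s" using False C(1) J by (intro mult_left_mono) auto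
      finally show ?thesis unfolding s_def .
    next
      case True
      have s3: "s\<^sup>2 \<le> s" "s ^ 3 \<le> s" using s True power_decreasing[of 1 2 s] power_decreasing[of 1 3 s] by auto
      have it: "integrable (std_gauss I) (\<lambda>w. (tilt I a w - 1) * g w)"
        by (rule Bochner_Integration.integrable_bound[OF Bochner_Integration.integrable_diff[OF integrable_tilt(1)[OF fin, of a] integrable_const[of 1]]])
           (use H in \<open>auto simp: abs_mult tilt_def intro!: mult_left_le\<close>)
      have pt: "\<bar>(tilt I a w - 1) * g w\<bar> \<le> \<bar>?rho w\<bar> + s * exp (4 * ?m w)" for w
      proof -
        have m: "0 \<le> ?m w" by (intro sum_nonneg) auto
        have p: "\<bar>?p w\<bar> \<le> s * ?m w" using abs_sum_mult_le[OF fin, of a w] unfolding s_def .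
        have "(?p w)\<^sup>2 \<le> s\<^sup>2 * (?m w)\<^sup>2" using power_mono[OF p, of 2] by (simp add: power_mult_distrib)
        also have "\<dots> \<le> s * (?m w)\<^sup>2" using s3 by (intro mult_right_mono) auto
        finally have p2: "(?p w)\<^sup>2 \<le> s * (?m w)\<^sup>2" .
        have "\<bar>(tilt I a w - 1) * g w\<bar> \<le> \<bar>tilt I a w - 1\<bar>"
          using H by (simp add: abs_mult mult_left_le)
        also have "\<dots> \<le> \<bar>?rho w\<bar> + (\<bar>?p w\<bar> + ((?p w)\<^sup>2 + q) / 2)"
        proof -
          have "\<bar>((?p w)\<^sup>2 - q) / 2\<bar> \<le> ((?p w)\<^sup>2 + q) / 2"
            using q zero_le_power2[of "?p w"] by (simp add: abs_le_iff)
          then show ?thesis by linarith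
        qed
        also have "\<bar>?p w\<bar> + ((?p w)\<^sup>2 + q) / 2 \<le> s * ?m w + (s * (?m w)\<^sup>2 + s) / 2"
          using p p2 order_trans[OF q2 s3(1)] by (intro add_mono divide_right_mono) auto
        also have "\<dots> \<le> s * (1 + ?m w)\<^sup>2"
          using s m by (simp add: power2_eq_square field_simps)
        also have "\<dots> \<le> s * (exp (?m w))\<^sup>2"
          using s m exp_ge_add_one_self[of "?m w"] by (intro mult_left_mono power_mono) auto
        also have "\<dots> \<le> s * exp (4 * ?m w)"
          using s m by (intro mult_left_mono) (auto simp: exp_of_nat_mult[symmetric])
        finally show ?thesis by simp
      qed
      have "(\<integral>w. g (\<lambda>l\<in>I. w l + a l) \<partial>std_gauss I) = (\<integral>w. tilt I a w * g w \<partial>std_gauss I)"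
        using integral_std_gauss_shift[OF fin g] unfolding tilt_def .
      also have "\<dots> = (\<integral>w. (tilt I a w - 1) * g w + g w \<partial>std_gauss I)"
        by (intro Bochner_Integration.integral_cong refl) (simp add: algebra_simps)
      also have "\<dots> = (\<integral>w. (tilt I a w - 1) * g w \<partial>std_gauss I) + (\<integral>w. g w \<partial>std_gauss I)"
        using it ig by simp
      finally have "\<bar>(\<integral>w. g (\<lambda>l\<in>I. w l + a l) \<partial>std_gauss I) - (\<integral>w. g w \<partial>std_gauss I)\<bar> =
         \<bar>\<integral>w. (tilt I a w - 1) * g w \<partial>std_gauss I\<bar>" by simp
      also have "\<dots> \<le> (\<integral>w. \<bar>?rho w\<bar> + s * exp (4 * ?m w) \<partial>std_gauss I)"
        using it irho pt fin
        by (intro order_trans[OF integral_abs_bound] integral_mono integrable_abs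
             Bochner_Integration.integrable_add integrable_mult_right integrable_exp_std_gauss)
      also have "\<dots> = (\<integral>w. \<bar>?rho w\<bar> \<partial>std_gauss I) + s * J"
        unfolding J_def using irho fin
        by (subst Bochner_Integration.integral_add)
           (auto intro!: integrable_mult_right integrable_exp_std_gauss integrable_abs)
      also have "\<dots> \<le> C * s ^ 3 + s * J" using C(2)[of a] unfolding s_def q_def by simp
      also have "\<dots> \<le> C * s + s * J + 2 * s" using s3 C(1) s by (simp add: add_increasing2)
      finally show ?thesis unfolding s_def by (simp add: algebra_simps)
    qed
  qed (use C(1) J in simp)
qed

section \<open>Averaging operators and Gaussian smoothing\<close>

abbreviation fun_borel :: "(nat \<Rightarrow> real) measure" where
  "fun_borel \<equiv> PiM UNIV (\<lambda>_. borel)"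

lemma measurable_fun_borel:
  assumes "\<And>k. (\<lambda>x. f x k) \<in> borel_measurable N"
  shows "f \<in> N \<rightarrow>\<^sub>M fun_borel"
  by (rule measurable_PiM_single'[where f="\<lambda>k x. f x k"]) (use assms in \<open>simp_all add: PiE_UNIV_domain\<close>)

text \<open>Test functions take total vectors, whereas \<open>std_gauss I\<close> lives on functions
  that are \<open>undefined\<close> outside \<open>I\<close>. Dependence on the coordinates in
  \<open>I\<close> alone lets the two meet without restricting arguments.\<close>

definition local_on :: "nat set \<Rightarrow> ((nat \<Rightarrow> real) \<Rightarrow> real) \<Rightarrow> bool" where
  "local_on I h \<longleftrightarrow> h \<in> borel_measurable fun_borel \<and> (\<forall>z z'. (\<forall>k\<in>I. z k = z' k) \<longrightarrow> h z = h z')"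

lemma local_onD: "local_on I h \<Longrightarrow> (\<And>k. k \<in> I \<Longrightarrow> z k = z' k) \<Longrightarrow> h z = h z'"
  by (simp add: local_on_def)

lemma local_on_diff: "local_on I f \<Longrightarrow> local_on I g \<Longrightarrow> local_on I (\<lambda>z. f z - g z)"
proof -
  assume f: "local_on I f" and g: "local_on I g"
  have "(\<lambda>z. f z - g z) \<in> borel_measurable fun_borel"
    using f g unfolding local_on_def by (intro borel_measurable_diff) simp_all
  moreover have "f z - g z = f z' - g z'" if "\<forall>k\<in>I. z k = z' k" for z z'
    using local_onD[OF f, of z z'] local_onD[OF g, of z z'] that by simp
  ultimately show ?thesis unfolding local_on_def by simp
qed

lemma local_on_measurable_comp:
  assumes "local_on I h" "\<And>k. (\<lambda>x. f x k) \<in> borel_measurable N"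
  shows "(\<lambda>x. h (f x)) \<in> borel_measurable N"
  by (rule measurable_compose[OF measurable_fun_borel[of f N]]) (use assms in \<open>simp_all add: local_on_def\<close>)

text \<open>Convolution of \<open>h\<close> with the law of the vector \<open>X\<close>: the
  expectation of h(z - X). Its \<open>n\<close>-th iterate belongs to the sum of \<open>n\<close>
  independent copies, so that exchanging a summand becomes exchanging an operator.\<close>

definition avg :: "'b measure \<Rightarrow> (nat \<Rightarrow> 'b \<Rightarrow> real) \<Rightarrow> ((nat \<Rightarrow> real) \<Rightarrow> real) \<Rightarrow> (nat \<Rightarrow> real) \<Rightarrow> real" where
  "avg M X h z = (\<integral>y. h (\<lambda>k. z k - X k y) \<partial>M)"

lemma avg_integrable:
  assumes M: "prob_space M" and [measurable]: "\<And>k. X k \<in> borel_measurable M"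
    and h: "local_on I h" and bd: "\<And>z. \<bar>h z\<bar> \<le> H"
  shows "integrable M (\<lambda>y. h (\<lambda>k. z k - X k y))"
proof -
  interpret prob_space M by fact
  show ?thesis
    by (intro integrable_const_bound[where B=H] local_on_measurable_comp[OF h] AE_I2) (auto simp: bd)
qed

lemma avg_local_on:
  assumes M: "prob_space M" and [measurable]: "\<And>k. X k \<in> borel_measurable M"
    and h: "local_on I h"
  shows "local_on I (avg M X h)"
proof -
  interpret prob_space M by fact
  have [measurable]: "(\<lambda>(z, y). h (\<lambda>k. z k - X k y)) \<in> borel_measurable (fun_borel \<Otimes>\<^sub>M M)"
    unfolding split_beta' by (intro local_on_measurable_comp[OF h]) measurable
  have "avg M X h \<in> borel_measurable fun_borel" unfolding avg_def by measurable
  moreover have "avg M X h z = avg M X h z'" if "\<forall>k\<in>I. z k = z' k" for z z'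
    unfolding avg_def using that by (intro Bochner_Integration.integral_cong refl local_onD[OF h]) auto
  ultimately show ?thesis unfolding local_on_def by simp
qed

lemma avg_bounds:
  assumes M: "prob_space M" and X: "\<And>k. X k \<in> borel_measurable M"
    and h: "local_on I h" and bd: "\<And>z. \<bar>h z\<bar> \<le> H"
  shows "\<bar>avg M X h z\<bar> \<le> H"
proof -
  interpret prob_space M by fact
  have "\<bar>avg M X h z\<bar> \<le> (\<integral>y. \<bar>h (\<lambda>k. z k - X k y)\<bar> \<partial>M)"
    unfolding avg_def by (rule integral_abs_bound)
  also have "\<dots> \<le> (\<integral>y. H \<partial>M)"
    using avg_integrable[OF M X h bd] bd by (intro integral_mono integrable_abs) auto
  finally show ?thesis by (simp add: prob_space)
qed

lemma avg_diff:
  assumes M: "prob_space M" and X: "\<And>k. X k \<in> borel_measurable M"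
    and f: "local_on I f" "\<And>z. \<bar>f z\<bar> \<le> F" and g: "local_on I g" "\<And>z. \<bar>g z\<bar> \<le> G"
  shows "avg M X (\<lambda>z. f z - g z) z = avg M X f z - avg M X g z"
  unfolding avg_def using avg_integrable[OF M X f] avg_integrable[OF M X g] by simp

lemma avg_add:
  assumes M: "prob_space M" and X: "\<And>k. X k \<in> borel_measurable M"
    and f: "local_on I f" "\<And>z. \<bar>f z\<bar> \<le> F" and g: "local_on I g" "\<And>z. \<bar>g z\<bar> \<le> G"
  shows "avg M X (\<lambda>z. f z + g z) z = avg M X f z + avg M X g z"
  unfolding avg_def using avg_integrable[OF M X f] avg_integrable[OF M X g] by simp

lemma avg_mono_pointwise:
  assumes M: "prob_space M" and X: "\<And>k. X k \<in> borel_measurable M"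
    and f: "local_on I f" "\<And>z. \<bar>f z\<bar> \<le> F"
    and mono: "\<And>z z'. (\<And>k. k \<in> I \<Longrightarrow> z k \<le> z' k) \<Longrightarrow> f z \<le> f z'"
    and "\<And>k. k \<in> I \<Longrightarrow> z k \<le> z' k"
  shows "avg M X f z \<le> avg M X f z'"
  unfolding avg_def using avg_integrable[OF M X f] assms(6) by (intro integral_mono mono) auto

lemma avg_commute:
  assumes M: "prob_space M" and [measurable]: "\<And>k. X k \<in> borel_measurable M"
    and N: "prob_space N" and [measurable]: "\<And>k. Y k \<in> borel_measurable N"
    and h: "local_on I h" and bd: "\<And>z. \<bar>h z\<bar> \<le> H"
  shows "avg M X (avg N Y h) z = avg N Y (avg M X h) z"
proof -
  interpret M: prob_space M by fact
  interpret N: prob_space N by fact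
  interpret MN: pair_prob_space M N ..
  have "integrable (M \<Otimes>\<^sub>M N) (\<lambda>(x, y). h (\<lambda>k. z k - X k x - Y k y))"
    unfolding split_beta'
    by (intro MN.P.integrable_const_bound[where B=H] local_on_measurable_comp[OF h] AE_I2) (auto simp: bd)
  from MN.Fubini_integral[OF this] show ?thesis
    unfolding avg_def by (simp add: diff_diff_eq add.commute)
qed

section \<open>Gaussian smoothing with covariance proportional to A A^T\<close>

definition lin :: "nat set \<Rightarrow> (nat \<Rightarrow> nat \<Rightarrow> real) \<Rightarrow> (nat \<Rightarrow> real) \<Rightarrow> nat \<Rightarrow> real" where
  "lin I A w k = (\<Sum>l\<in>I. A k l * w l)"

lemma lin_add: "lin I A (\<lambda>l\<in>I. v l + w l) k = lin I A v k + lin I A w k"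
  unfolding lin_def by (simp add: algebra_simps sum.distrib)

lemma lin_scale: "lin I A (\<lambda>l. c * w l) k = c * lin I A w k"
  unfolding lin_def by (simp add: sum_distrib_left mult_ac)

lemma lin_restrict: "lin I A (\<lambda>l\<in>I. w l) k = lin I A w k"
  unfolding lin_def by (intro sum.cong) auto

lemma lin_measurable [measurable]: "(\<lambda>w. lin I A w k) \<in> borel_measurable (std_gauss I)"
  unfolding lin_def by measurable

lemma lin_measurable_PiM [measurable]: "(\<lambda>w. lin I A w k) \<in> borel_measurable (PiM I (\<lambda>_. borel))"
  unfolding lin_def by measurable

text \<open>Convolution with the centred Gaussian law of covariance v A A^T. The parameter is the
  variance, so that successive smoothings add their parameters.\<close>

definition sm :: "nat set \<Rightarrow> (nat \<Rightarrow> nat \<Rightarrow> real) \<Rightarrow> real \<Rightarrow> ((nat \<Rightarrow> real) \<Rightarrow> real) \<Rightarrow> (nat \<Rightarrow> real) \<Rightarrow> real" where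
  "sm I A v = avg (std_gauss I) (\<lambda>k w. sqrt v * lin I A w k)"

lemma sm_measurable [measurable]: "(\<lambda>w. sqrt v * lin I A w k) \<in> borel_measurable (std_gauss I)"
  by measurable

lemma sm_local_on: "local_on I h \<Longrightarrow> local_on I (sm I A v h)"
  unfolding sm_def by (rule avg_local_on[OF prob_space_std_gauss sm_measurable])

lemma sm_bounds: "local_on I h \<Longrightarrow> (\<And>z. \<bar>h z\<bar> \<le> H) \<Longrightarrow> \<bar>sm I A v h z\<bar> \<le> H"
  unfolding sm_def by (rule avg_bounds[OF prob_space_std_gauss sm_measurable])

lemma sm_integrable:
  "local_on I h \<Longrightarrow> (\<And>z. \<bar>h z\<bar> \<le> H) \<Longrightarrow>
    integrable (std_gauss I) (\<lambda>w. h (\<lambda>k. z k - sqrt v * lin I A w k))"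
  by (rule avg_integrable[OF prob_space_std_gauss sm_measurable])

lemma sm_sm:
  assumes fin: "finite I" and ab: "0 < a" "0 < b" and h: "local_on I h" and bd: "\<And>z. \<bar>h z\<bar> \<le> H"
  shows "sm I A a (sm I A b h) z = sm I A (a + b) h z"
proof -
  define g where "g u = h (\<lambda>k. z k - lin I A u k)" for u
  have g: "g \<in> borel_measurable (PiM I (\<lambda>_. borel))"
    unfolding g_def by (intro local_on_measurable_comp[OF h]) measurable
  have "sm I A a (sm I A b h) z = (\<integral>v. \<integral>w. g (\<lambda>l\<in>I. sqrt a * v l + sqrt b * w l) \<partial>std_gauss I \<partial>std_gauss I)"
    unfolding sm_def avg_def g_def lin_add lin_scale by (simp add: diff_diff_eq)
  also have "\<dots> = (\<integral>w. g (\<lambda>l\<in>I. sqrt (a + b) * w l) \<partial>std_gauss I)"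
    by (rule integral_std_gauss_add[OF fin ab g, of H]) (auto simp: g_def bd)
  also have "\<dots> = sm I A (a + b) h z"
    unfolding sm_def avg_def g_def lin_restrict lin_scale ..
  finally show ?thesis .
qed

lemma lin_inverse:
  assumes fin: "finite I" and AB: "\<And>i j. i \<in> I \<Longrightarrow> j \<in> I \<Longrightarrow> (\<Sum>l\<in>I. A i l * B l j) = (if i = j then 1 else 0)"
    and k: "k \<in> I"
  shows "lin I A (lin I B x) k = x k"
proof -
  have "lin I A (lin I B x) k = (\<Sum>l\<in>I. \<Sum>j\<in>I. A k l * B l j * x j)"
    unfolding lin_def by (simp add: sum_distrib_left mult.assoc)
  also have "\<dots> = (\<Sum>j\<in>I. (\<Sum>l\<in>I. A k l * B l j) * x j)"
    by (subst sum.swap) (simp add: sum_distrib_right)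
  also have "\<dots> = x k" using k fin by (simp add: AB if_distrib[of "\<lambda>x. x * _"] sum.delta cong: if_cong)
  finally show ?thesis .
qed

text \<open>\<open>A\<close> is a square root of a nondegenerate covariance matrix A A^T, and
  \<open>B\<close> is its two-sided inverse on \<open>I\<close>; \<open>B\<close> maps a vector of
  that covariance to one with identity covariance.\<close>

locale factor =
  fixes I :: "nat set" and A B :: "nat \<Rightarrow> nat \<Rightarrow> real"
  assumes fin: "finite I"
    and AB: "\<And>i j. i \<in> I \<Longrightarrow> j \<in> I \<Longrightarrow> (\<Sum>l\<in>I. A i l * B l j) = (if i = j then 1 else 0)"
    and BA: "\<And>i j. i \<in> I \<Longrightarrow> j \<in> I \<Longrightarrow> (\<Sum>l\<in>I. B i l * A l j) = (if i = j then 1 else 0)"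
begin

lemma lin_A_B: "k \<in> I \<Longrightarrow> lin I A (lin I B x) k = x k"
  by (rule lin_inverse[OF fin AB])

text \<open>Since A B is the identity on \<open>I\<close>, translating the argument by
  \<open>x\<close> is the same as shifting the Gaussian variable by B x / sqrt v. This brings
  translations within reach of the Cameron--Martin formula.\<close>

lemma sm_translate:
  assumes v: "0 < v" and h: "local_on I h"
  shows "sm I A v h (\<lambda>k. z k - x k) =
    (\<integral>w. h (\<lambda>k. z k - sqrt v * lin I A (\<lambda>l\<in>I. w l + lin I B x l / sqrt v) k) \<partial>std_gauss I)"
  unfolding sm_def avg_def
proof (intro Bochner_Integration.integral_cong refl local_onD[OF h])
  fix w :: "nat \<Rightarrow> real" and k assume k: "k \<in> I"
  have "lin I A (\<lambda>l\<in>I. w l + lin I B x l / sqrt v) k = lin I A w k + lin I A (lin I B x) k / sqrt v"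
    unfolding lin_add by (simp add: lin_scale[of I A "1 / sqrt v", simplified])
  then show "z k - x k - sqrt v * lin I A w k =
      z k - sqrt v * lin I A (\<lambda>l\<in>I. w l + lin I B x l / sqrt v) k"
    using v by (simp add: lin_A_B[OF k] field_simps)
qed

text \<open>The expansion of the Gaussian shift at B x / sqrt v. The cubic remainder is where the
  factor \<open>1 / sqrt v ^ 3\<close> arises, and the expansion is in the whitened coordinates of
  \<open>x\<close>.\<close>

lemma sm_second_order:
  "\<exists>C>0. \<forall>h H v z. local_on I h \<longrightarrow> (\<forall>z. \<bar>h z\<bar> \<le> H) \<longrightarrow> 0 < v \<longrightarrow>
    (\<exists>c0 c1 c2. \<forall>x. \<bar>sm I A v h (\<lambda>k. z k - x k) - (quad I c0 c1 c2 (lin I B x))\<bar> \<le> C * H / (sqrt v) ^ 3 * (norm1 I (lin I B x)) ^ 3)"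
proof -
  obtain C where C: "0 < C" "\<forall>g H. g \<in> borel_measurable (std_gauss I) \<longrightarrow> (\<forall>w. \<bar>g w\<bar> \<le> H) \<longrightarrow>
    (\<exists>c0 c1 c2. \<forall>a. \<bar>(\<integral>w. g (\<lambda>l\<in>I. w l + a l) \<partial>std_gauss I) -
      (quad I c0 c1 c2 a)\<bar> \<le> C * H * (norm1 I a) ^ 3)"
    using std_gauss_shift_second_order[OF fin] by (elim exE conjE) (rule that)
  show ?thesis
  proof (rule exI[of _ C], intro conjI allI impI)
    fix h and H v :: real and z :: "nat \<Rightarrow> real"
    assume h: "local_on I h" and bd: "\<forall>z. \<bar>h z\<bar> \<le> H" and v: "0 < v"
    define g where "g w = h (\<lambda>k. z k - sqrt v * lin I A w k)" for w
    have g: "g \<in> borel_measurable (std_gauss I)"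
      unfolding g_def by (intro local_on_measurable_comp[OF h]) measurable
    have "\<forall>w. \<bar>g w\<bar> \<le> H" unfolding g_def using bd by blast
    from C(2)[THEN spec, THEN spec, THEN mp, OF g, THEN mp, OF this] obtain c0 c1 c2 where c: "\<And>a. \<bar>(\<integral>w. g (\<lambda>l\<in>I. w l + a l) \<partial>std_gauss I) -
      (quad I c0 c1 c2 a)\<bar> \<le> C * H * (norm1 I a) ^ 3"
      by blast
    show "\<exists>c0 c1 c2. \<forall>x. \<bar>sm I A v h (\<lambda>k. z k - x k) - (quad I c0 c1 c2 (lin I B x))\<bar> \<le> C * H / (sqrt v) ^ 3 * (norm1 I (lin I B x)) ^ 3"
    proof (intro exI[of _ c0] exI[of _ "\<lambda>l. c1 l / sqrt v"] exI[of _ "\<lambda>l m. c2 l m / (sqrt v * sqrt v)"] allI)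
      fix x
      have "(\<Sum>l\<in>I. \<bar>lin I B x l / sqrt v\<bar>) = (norm1 I (lin I B x)) / sqrt v"
        using v by (simp add: sum_divide_distrib abs_divide)
      with c[of "\<lambda>l. lin I B x l / sqrt v"]
      show "\<bar>sm I A v h (\<lambda>k. z k - x k) - (c0 + (\<Sum>l\<in>I. c1 l / sqrt v * lin I B x l) +
        (\<Sum>l\<in>I. \<Sum>m\<in>I. c2 l m / (sqrt v * sqrt v) * (lin I B x l * lin I B x m)))\<bar> \<le> C * H / (sqrt v) ^ 3 * (norm1 I (lin I B x)) ^ 3"
        unfolding sm_translate[OF v h] g_def by (simp add: power_divide)
    qed
  qed (rule C(1))
qed

lemma sm_first_order:
  "\<exists>C>0. \<forall>h v z t. local_on I h \<longrightarrow> (\<forall>z. \<bar>h z\<bar> \<le> 1) \<longrightarrow> 0 < v \<longrightarrow> 0 \<le> t \<longrightarrow>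
    \<bar>sm I A v h (\<lambda>k. z k + t) - sm I A v h z\<bar> \<le> C * t / sqrt v"
proof -
  obtain C where C: "0 < C" "\<forall>g a. g \<in> borel_measurable (std_gauss I) \<longrightarrow> (\<forall>w. \<bar>g w\<bar> \<le> 1) \<longrightarrow>
    \<bar>(\<integral>w. g (\<lambda>l\<in>I. w l + a l) \<partial>std_gauss I) - (\<integral>w. g w \<partial>std_gauss I)\<bar> \<le> C * (norm1 I a)"
    using std_gauss_shift_first_order[OF fin] by (elim exE conjE) (rule that)
  define L where "L = (\<Sum>l\<in>I. \<bar>lin I B (\<lambda>_. 1) l\<bar>)"
  have L: "0 \<le> L" unfolding L_def by (intro sum_nonneg) auto
  show ?thesis
  \<comment> \<open>The summand 1 keeps the constant positive even if \<open>L = 0\<close>, as for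
    empty \<open>I\<close>.\<close>
  proof (rule exI[of _ "C * L + 1"], intro conjI allI impI)
    fix h and v :: real and z :: "nat \<Rightarrow> real" and t :: real
    assume h: "local_on I h" and bd: "\<forall>z. \<bar>h z\<bar> \<le> 1" and v: "0 < v" and t: "0 \<le> t"
    define g where "g w = h (\<lambda>k. z k - sqrt v * lin I A w k)" for w
    have g: "g \<in> borel_measurable (std_gauss I)"
      unfolding g_def by (intro local_on_measurable_comp[OF h]) measurable
    have g1: "\<forall>w. \<bar>g w\<bar> \<le> 1" unfolding g_def using bd by blast
    have "(\<Sum>l\<in>I. \<bar>lin I B (\<lambda>_. - t) l / sqrt v\<bar>) = L * t / sqrt v"
    proof -
      have "lin I B (\<lambda>_. - t) l = - t * lin I B (\<lambda>_. 1) l" for l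
        using lin_scale[of I B "- t" "\<lambda>_. 1" l] by simp
      then show ?thesis unfolding L_def using v t
        by (simp add: sum_divide_distrib[symmetric] abs_mult sum_distrib_left[symmetric] mult.commute)
    qed
    with C(2)[THEN spec, THEN spec, THEN mp, OF g, THEN mp, OF g1, of "\<lambda>l. lin I B (\<lambda>_. - t) l / sqrt v"]
    have "\<bar>sm I A v h (\<lambda>k. z k - (- t)) - sm I A v h z\<bar> \<le> C * (L * t / sqrt v)"
      unfolding sm_translate[OF v h] g_def by (simp add: sm_def avg_def)
    also have "\<dots> \<le> (C * L + 1) * t / sqrt v"
      using v t by (simp add: field_simps)
    finally show "\<bar>sm I A v h (\<lambda>k. z k + t) - sm I A v h z\<bar> \<le> (C * L + 1) * t / sqrt v" by simp
  qed (use C(1) L in \<open>simp add: add_nonneg_pos\<close>)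
qed

lemma lin_box:
  "\<exists>r>0. 3/4 \<le> \<P>(w in std_gauss I. \<forall>k\<in>I. \<bar>lin I A w k\<bar> \<le> r)"
proof -
  interpret G: prob_space "std_gauss I" by (rule prob_space_std_gauss)
  define T where "T w = (\<Sum>k\<in>I. \<bar>lin I A w k\<bar>)" for w
  have [measurable]: "T \<in> borel_measurable (std_gauss I)" unfolding T_def by measurable
  have iT: "integrable (std_gauss I) T"
    unfolding T_def lin_def using fin by (intro Bochner_Integration.integrable_sum integrable_abs integrable_std_gauss_quadratic)
  define r where "r = 4 * (\<integral>w. T w \<partial>std_gauss I) + 1"
  have T0: "0 \<le> T w" for w unfolding T_def by (intro sum_nonneg) auto
  then have E0: "0 \<le> (\<integral>w. T w \<partial>std_gauss I)" by simp
  then have r: "0 < r" unfolding r_def by simp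
  have "\<P>(w in std_gauss I. r \<le> T w) \<le> (\<integral>w. T w \<partial>std_gauss I) / r"
    using integral_Markov_inequality_measure[OF iT, of "{}" r] r T0 by simp
  also have "\<dots> \<le> 1/4" using r E0 unfolding r_def by (simp add: field_simps)
  finally have "3/4 \<le> 1 - \<P>(w in std_gauss I. r \<le> T w)" by simp
  also have "\<dots> = measure (std_gauss I) (space (std_gauss I) - {w \<in> space (std_gauss I). r \<le> T w})"
    by (subst G.prob_compl) auto
  also have "\<dots> \<le> \<P>(w in std_gauss I. \<forall>k\<in>I. \<bar>lin I A w k\<bar> \<le> r)"
  proof (rule G.finite_measure_mono)
    have "\<bar>lin I A w k\<bar> \<le> T w" if "k \<in> I" for w k
      unfolding T_def using that fin by (intro member_le_sum[where f="\<lambda>k. \<bar>lin I A w k\<bar>"]) auto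
    then show "space (std_gauss I) - {w \<in> space (std_gauss I). r \<le> T w} \<subseteq> {w \<in> space (std_gauss I). \<forall>k\<in>I. \<bar>lin I A w k\<bar> \<le> r}"
      by (auto simp: not_le) (meson less_imp_le order_trans)
  qed (use fin in measurable)
  finally show ?thesis using r by blast
qed

text \<open>Let \<open>D\<close> be the supremum of \<open>\<bar>F - G\<bar>\<close>. Smoothing at a
  point displaced by \<open>r * sqrt v\<close> along the diagonal keeps, on an event of probability
  at least 3/4, the full discrepancy at \<open>z\<close> up to \<open>\<eta>\<close>, by
  monotonicity; on the remaining event the discrepancy is at least \<open>- D\<close>. Comparing
  with \<open>\<delta>\<close> gives \<open>D \<le> \<eta> + (4 * \<delta> + D) / 3\<close>, which
  can be solved for \<open>D\<close>. Any probability above 1/2 would leave a coefficient of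
  \<open>D\<close> below 1 on the right.\<close>

lemma desmooth:
  assumes r: "0 < r" "3/4 \<le> \<P>(w in std_gauss I. \<forall>k\<in>I. \<bar>lin I A w k\<bar> \<le> r)"
    and v: "0 < v"
    and F: "local_on I F" "\<And>z. \<bar>F z\<bar> \<le> 1" "\<And>z z'. (\<And>k. k \<in> I \<Longrightarrow> z k \<le> z' k) \<Longrightarrow> F z \<le> F z'"
    and G: "local_on I G" "\<And>z. \<bar>G z\<bar> \<le> 1" "\<And>z z'. (\<And>k. k \<in> I \<Longrightarrow> z k \<le> z' k) \<Longrightarrow> G z \<le> G z'"
    and d: "\<And>z. \<bar>sm I A v F z - sm I A v G z\<bar> \<le> \<delta>"
    and e: "\<And>z. G (\<lambda>k. z k + 2 * r * sqrt v) - G z \<le> \<eta>"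
  shows "\<bar>F z - G z\<bar> \<le> 2 * \<delta> + 2 * \<eta>"
proof -
  interpret N: prob_space "std_gauss I" by (rule prob_space_std_gauss)
  define E where "E = {w \<in> space (std_gauss I). \<forall>k\<in>I. \<bar>lin I A w k\<bar> \<le> r}"
  have E[measurable]: "E \<in> sets (std_gauss I)" unfolding E_def using fin by measurable
  have pE: "3/4 \<le> measure (std_gauss I) E" using r(2) unfolding E_def .
  define D where "D = (SUP z. \<bar>F z - G z\<bar>)"
  have bdd: "bdd_above (range (\<lambda>z. \<bar>F z - G z\<bar>))"
  proof (rule bdd_aboveI2)
    fix z show "\<bar>F z - G z\<bar> \<le> 2" using F(2)[of z] G(2)[of z] by linarith
  qed
  have D: "\<bar>F z - G z\<bar> \<le> D" for z unfolding D_def by (rule cSUP_upper[OF _ bdd]) auto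
  have D0: "0 \<le> D" using D[of "\<lambda>_. 0"] by linarith
  have eta: "0 \<le> \<eta>"
  proof -
    have "G (\<lambda>_. 0) \<le> G (\<lambda>k. 0 + 2 * r * sqrt v)" using r v by (intro G(3)) auto
    with e[of "\<lambda>_. 0"] show ?thesis by simp
  qed
  have core: "x \<le> \<eta> + (4 * \<delta> + D) / 3"
    if Q: "integrable (std_gauss I) Q" "(\<integral>w. Q w \<partial>std_gauss I) \<le> \<delta>"
      "\<And>w. w \<in> E \<Longrightarrow> x - \<eta> \<le> Q w" "\<And>w. - D \<le> Q w" for Q x
  \<comment> \<open>Replacing the mass of \<open>E\<close> by its lower bound 3/4 is legitimate only
    for a nonnegative factor \<open>x - \<eta>\<close>. In the other case the claim follows from the
    signs of \<open>\<delta>\<close> and \<open>D\<close>.\<close>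
  proof (cases "x - \<eta> \<le> 0")
    case True
    have "0 \<le> \<delta>" using d[of z] by linarith
    then have "0 \<le> (4 * \<delta> + D) / 3" using D0 by simp
    then show ?thesis using True by linarith
  next
    case False
    have "(\<integral>w. (x - \<eta>) * indicator E w - D * indicator (space (std_gauss I) - E) w \<partial>std_gauss I) \<le> (\<integral>w. Q w \<partial>std_gauss I)"
    proof (rule integral_mono[OF _ Q(1)])
      show "integrable (std_gauss I) (\<lambda>w. (x - \<eta>) * indicator E w - D * indicator (space (std_gauss I) - E) w)"
        by (intro Bochner_Integration.integrable_diff integrable_mult_right integrable_real_indicator)
           (auto simp: N.emeasure_eq_measure)
      show "(x - \<eta>) * indicator E w - D * indicator (space (std_gauss I) - E) w \<le> Q w" if "w \<in> space (std_gauss I)" for w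
        using Q(3,4)[of w] that by (auto simp: indicator_def)
    qed
    also have "(\<integral>w. (x - \<eta>) * indicator E w - D * indicator (space (std_gauss I) - E) w \<partial>std_gauss I) =
       (x - \<eta>) * measure (std_gauss I) E - D * (1 - measure (std_gauss I) E)"
    proof (subst Bochner_Integration.integral_diff)
      show "integrable (std_gauss I) (\<lambda>w. (x - \<eta>) * indicator E w)"
        "integrable (std_gauss I) (\<lambda>w. D * indicator (space (std_gauss I) - E) w)"
        by (intro integrable_mult_right integrable_real_indicator; simp add: N.emeasure_eq_measure)+
      show "(\<integral>w. (x - \<eta>) * indicator E w \<partial>std_gauss I) - (\<integral>w. D * indicator (space (std_gauss I) - E) w \<partial>std_gauss I) =
        (x - \<eta>) * measure (std_gauss I) E - D * (1 - measure (std_gauss I) E)"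
        unfolding integral_mult_right_zero N.prob_compl[OF E, symmetric]
        using sets.sets_into_space[OF E] by (simp add: Int_absorb1 Int_absorb2)
    qed
    finally have 1: "(x - \<eta>) * measure (std_gauss I) E - D * (1 - measure (std_gauss I) E) \<le> \<delta>" using Q(2) by linarith
    have "(x - \<eta>) * (3/4) \<le> (x - \<eta>) * measure (std_gauss I) E" using False pE by (intro mult_left_mono) auto
    moreover have "D * (1 - measure (std_gauss I) E) \<le> D * (1/4)" using D0 pE by (intro mult_left_mono) auto
    ultimately have "(x - \<eta>) * (3/4) - D * (1/4) \<le> \<delta>" using 1 by linarith
    then show ?thesis by (simp add: field_simps)
  qed
  have main: "\<bar>F z - G z\<bar> \<le> \<eta> + (4 * \<delta> + D) / 3" for z
  proof -
    let ?sF = "\<lambda>y w. F (\<lambda>k. y k - sqrt v * lin I A w k)"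
    let ?sG = "\<lambda>y w. G (\<lambda>k. y k - sqrt v * lin I A w k)"
    have iF: "integrable (std_gauss I) (?sF y)" for y by (rule sm_integrable[OF F(1,2)])
    have iG: "integrable (std_gauss I) (?sG y)" for y by (rule sm_integrable[OF G(1,2)])
    have smd: "(\<integral>w. ?sF y w - ?sG y w \<partial>std_gauss I) = sm I A v F y - sm I A v G y" for y
      unfolding sm_def avg_def using iF iG by simp
    have Ek: "sqrt v * lin I A w k \<le> r * sqrt v" "- (r * sqrt v) \<le> sqrt v * lin I A w k" if "w \<in> E" "k \<in> I" for w k
    proof -
      have "\<bar>lin I A w k\<bar> \<le> r" using that unfolding E_def by auto
      then have "lin I A w k \<le> r" "- r \<le> lin I A w k" by linarith+
      then have "sqrt v * lin I A w k \<le> sqrt v * r" "sqrt v * (- r) \<le> sqrt v * lin I A w k"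
        using v by (intro mult_left_mono; simp)+
      then show "sqrt v * lin I A w k \<le> r * sqrt v" "- (r * sqrt v) \<le> sqrt v * lin I A w k"
        by (simp_all add: mult.commute)
    qed
    have "F z - G z \<le> \<eta> + (4 * \<delta> + D) / 3"
    proof (rule core)
      \<comment> \<open>From this centre the points reached on \<open>E\<close> lie, in each
        coordinate of \<open>I\<close>, between \<open>z\<close> and \<open>z\<close> raised by
        \<open>2 * r * sqrt v\<close>. So \<open>F\<close> there is at least \<open>F z\<close>, and
        \<open>G\<close> is at most \<open>G z + \<eta>\<close>. The reverse inequality uses the
        centre lowered by the same amount.\<close>
      let ?y = "\<lambda>k. z k + r * sqrt v"
      show "integrable (std_gauss I) (\<lambda>w. ?sF ?y w - ?sG ?y w)" using iF iG by simp
      show "(\<integral>w. ?sF ?y w - ?sG ?y w \<partial>std_gauss I) \<le> \<delta>" unfolding smd using d[of ?y] by linarith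
      show "- D \<le> ?sF ?y w - ?sG ?y w" for w using D[of "\<lambda>k. ?y k - sqrt v * lin I A w k"] by linarith
      fix w assume w: "w \<in> E"
      have "F z \<le> ?sF ?y w"
      proof (rule F(3))
        fix k assume "k \<in> I"
        from Ek[OF w this] show "z k \<le> ?y k - sqrt v * lin I A w k" by linarith
      qed
      moreover have "?sG ?y w \<le> G (\<lambda>k. z k + 2 * r * sqrt v)"
      proof (rule G(3))
        fix k assume "k \<in> I"
        from Ek[OF w this] show "?y k - sqrt v * lin I A w k \<le> z k + 2 * r * sqrt v" by linarith
      qed
      ultimately show "F z - G z - \<eta> \<le> ?sF ?y w - ?sG ?y w" using e[of z] by linarith
    qed
    moreover have "G z - F z \<le> \<eta> + (4 * \<delta> + D) / 3"
    proof (rule core)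
      let ?y = "\<lambda>k. z k - r * sqrt v"
      show "integrable (std_gauss I) (\<lambda>w. - (?sF ?y w - ?sG ?y w))" using iF iG by simp
      show "(\<integral>w. - (?sF ?y w - ?sG ?y w) \<partial>std_gauss I) \<le> \<delta>"
        unfolding Bochner_Integration.integral_minus smd using d[of ?y] by linarith
      show "- D \<le> - (?sF ?y w - ?sG ?y w)" for w using D[of "\<lambda>k. ?y k - sqrt v * lin I A w k"] by linarith
      fix w assume w: "w \<in> E"
      have "?sF ?y w \<le> F z"
      proof (rule F(3))
        fix k assume "k \<in> I"
        from Ek[OF w this] show "?y k - sqrt v * lin I A w k \<le> z k" by linarith
      qed
      moreover have "G (\<lambda>k. z k - 2 * r * sqrt v) \<le> ?sG ?y w"
      proof (rule G(3))
        fix k assume "k \<in> I"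
        from Ek[OF w this] show "z k - 2 * r * sqrt v \<le> ?y k - sqrt v * lin I A w k" by linarith
      qed
      ultimately show "G z - F z - \<eta> \<le> - (?sF ?y w - ?sG ?y w)" using e[of "\<lambda>k. z k - 2 * r * sqrt v"] by simp
    qed
    ultimately show ?thesis by linarith
  qed
  have "D \<le> \<eta> + (4 * \<delta> + D) / 3"
    unfolding D_def by (rule cSUP_least) (use main in \<open>auto simp: D_def\<close>)
  then have "3 * D \<le> 3 * \<eta> + 4 * \<delta> + D" by (simp add: field_simps)
  then show ?thesis using D[of z] eta by linarith
qed

end

section \<open>The Berry--Esseen theorem for orthants\<close>

text \<open>The nonnegative orthant at z - X encodes the event X \<le> z, so averaging this function
  produces multivariate distribution functions.\<close>

definition orthant :: "nat set \<Rightarrow> (nat \<Rightarrow> real) \<Rightarrow> real" where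
  "orthant I z = (if \<forall>k\<in>I. 0 \<le> z k then 1 else 0)"

lemma orthant_bounds: "0 \<le> orthant I z" "\<bar>orthant I z\<bar> \<le> 1"
  unfolding orthant_def by auto

lemma orthant_local_on:
  assumes "finite I"
  shows "local_on I (orthant I)"
proof -
  have "orthant I \<in> borel_measurable fun_borel"
    unfolding orthant_def using assms by measurable
  moreover have "orthant I z = orthant I z'" if "\<forall>k\<in>I. z k = z' k" for z z'
    using that unfolding orthant_def by auto
  ultimately show ?thesis unfolding local_on_def by simp
qed

lemma orthant_mono: "(\<And>k. k \<in> I \<Longrightarrow> z k \<le> z' k) \<Longrightarrow> orthant I z \<le> orthant I z'"
  unfolding orthant_def by (auto intro: order_trans)

text \<open>Comparison with the telescoping differences of 2 / sqrt, a discrete form of integrating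
  the power -3/2. The offset \<open>1 + real N ^ 2\<close> makes the whole sum as small as desired
  by choosing \<open>N\<close>, uniformly in \<open>n\<close>.\<close>

lemma sum_inverse_sqrt_cube_bound:
  fixes N n :: nat
  assumes "1 \<le> N"
  shows "(\<Sum>j<n. 1 / sqrt (real j + (1 + real N ^ 2)) ^ 3) \<le> 2 / N"
proof -
  let ?f = "\<lambda>j::nat. 2 / sqrt (real j + real N ^ 2)"
  have step: "1 / sqrt (real j + (1 + real N ^ 2)) ^ 3 \<le> ?f j - ?f (Suc j)" for j
  proof -
    define x where "x = sqrt (real j + real N ^ 2)"
    define y where "y = sqrt (real j + (1 + real N ^ 2))"
    have x: "0 < x" unfolding x_def using assms by (simp add: add_nonneg_pos)
    have xy: "x \<le> y" unfolding x_def y_def by simp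
    then have y: "0 < y" using x by simp
    have sq: "y\<^sup>2 = x\<^sup>2 + 1" unfolding x_def y_def by simp
    have "(y - x) * (y + x) = 1" using sq by (simp add: algebra_simps power2_eq_square)
    then have d: "y - x = 1 / (y + x)" using x y by (simp add: field_simps)
    have "2 / x - 2 / y = 2 * (y - x) / (x * y)" using x y by (simp add: field_simps)
    also have "\<dots> = 2 / (x * y * (y + x))" unfolding d using x y by (simp add: field_simps)
    also have "\<dots> \<ge> 2 / (y * y * (y + y))"
      using x y xy by (intro divide_left_mono mult_mono add_mono mult_pos_pos add_pos_pos) auto
    also have "2 / (y * y * (y + y)) = 1 / y ^ 3" using y by (simp add: field_simps power3_eq_cube)
    finally have "1 / y ^ 3 \<le> 2 / x - 2 / y" .
    then show ?thesis unfolding x_def y_def by (simp add: add_ac)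
  qed
  have "(\<Sum>j<n. 1 / sqrt (real j + (1 + real N ^ 2)) ^ 3) \<le> (\<Sum>j<n. ?f j - ?f (Suc j))"
    by (intro sum_mono step)
  also have "\<dots> = ?f 0 - ?f n" by (rule sum_lessThan_telescope')
  also have "\<dots> \<le> 2 / N" using assms by simp
  finally show ?thesis .
qed

lemma integrable_sum_cube:
  fixes f :: "'j \<Rightarrow> 'b \<Rightarrow> real"
  assumes "finite J" "\<And>j. j \<in> J \<Longrightarrow> f j \<in> borel_measurable M" "\<And>j. j \<in> J \<Longrightarrow> integrable M (\<lambda>y. \<bar>f j y\<bar> ^ 3)"
  shows "integrable M (\<lambda>y. (\<Sum>j\<in>J. \<bar>f j y\<bar>) ^ 3)"
  using assms
proof (induction J)
  case empty
  then show ?case by simp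
next
  case (insert k J)
  have [measurable]: "\<And>j. j \<in> insert k J \<Longrightarrow> f j \<in> borel_measurable M" by (rule insert.prems)
  have IH: "integrable M (\<lambda>y. (\<Sum>j\<in>J. \<bar>f j y\<bar>) ^ 3)" using insert by simp
  have cube: "(a + s) ^ 3 \<le> 8 * (a ^ 3 + s ^ 3)" if "0 \<le> a" "0 \<le> s" for a s :: real
  proof -
    have "(a + s) ^ 3 \<le> (2 * max a s) ^ 3" using that by (intro power_mono) auto
    also have "\<dots> = 8 * max a s ^ 3" by (simp add: power_mult_distrib)
    also have "max a s ^ 3 \<le> a ^ 3 + s ^ 3" using that by (simp add: max_def)
    finally show ?thesis by simp
  qed
  show ?case
  proof (rule Bochner_Integration.integrable_bound)
    show "integrable M (\<lambda>y. 8 * (\<bar>f k y\<bar> ^ 3 + (\<Sum>j\<in>J. \<bar>f j y\<bar>) ^ 3))"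
      using insert.prems IH by (intro integrable_mult_right Bochner_Integration.integrable_add) auto
    show "(\<lambda>y. (\<Sum>j\<in>insert k J. \<bar>f j y\<bar>) ^ 3) \<in> borel_measurable M" by measurable
    show "AE y in M. norm ((\<Sum>j\<in>insert k J. \<bar>f j y\<bar>) ^ 3) \<le> norm (8 * (\<bar>f k y\<bar> ^ 3 + (\<Sum>j\<in>J. \<bar>f j y\<bar>) ^ 3))"
      using insert.hyps cube by (intro AE_I2) (auto simp: sum_nonneg)
  qed
qed

lemma (in prob_space) integrable_of_cube:
  fixes f g :: "'a \<Rightarrow> real"
  assumes [measurable]: "f \<in> borel_measurable M" "g \<in> borel_measurable M"
    and f: "integrable M (\<lambda>y. \<bar>f y\<bar> ^ 3)" and g: "integrable M (\<lambda>y. \<bar>g y\<bar> ^ 3)"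
  shows "integrable M f" "integrable M (\<lambda>y. f y * g y)"
proof -
  have a: "a \<le> 1 + a ^ 3" if "0 \<le> a" for a :: real
  proof (cases "a \<le> 1")
    case True then show ?thesis using that by (simp add: add_increasing2)
  next
    case False then show ?thesis using power_increasing[of 1 3 a] by simp
  qed
  have b: "a * c \<le> 2 + a ^ 3 + c ^ 3" if "0 \<le> a" "0 \<le> c" for a c :: real
  proof -
    have sq: "x * x \<le> 1 + x ^ 3" if "0 \<le> x" for x :: real
    proof (cases "x \<le> 1")
      case True then show ?thesis using that mult_le_one[of x x] by (simp add: add_increasing2)
    next
      case False then show ?thesis using power_increasing[of 2 3 x] by (simp add: power2_eq_square)
    qed
    have "a * c \<le> max a c * max a c" using that by (intro mult_mono) auto
    also have "\<dots> \<le> a * a + c * c" by (simp add: max_def)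
    also have "\<dots> \<le> 2 + a ^ 3 + c ^ 3" using sq[OF that(1)] sq[OF that(2)] by simp
    finally show ?thesis .
  qed
  show "integrable M f"
    by (rule Bochner_Integration.integrable_bound[OF Bochner_Integration.integrable_add[OF integrable_const[of 1] f]])
       (use a in \<open>auto simp: add_nonneg_nonneg\<close>)
  show "integrable M (\<lambda>y. f y * g y)"
    by (rule Bochner_Integration.integrable_bound[OF Bochner_Integration.integrable_add[OF Bochner_Integration.integrable_add[OF integrable_const[of 2] f] g]])
       (use b in \<open>auto simp: add_nonneg_nonneg abs_mult\<close>)
qed

section \<open>Exchange of summands with matching first and second moments\<close>

context factor
begin

text \<open>After multiplication by \<open>B\<close> the vector is centred with identity covariance
  and finite third absolute moment. Components outside \<open>I\<close> are required to be
  measurable because \<open>avg\<close> acts on total vectors.\<close>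

definition white :: "'b measure \<Rightarrow> (nat \<Rightarrow> 'b \<Rightarrow> real) \<Rightarrow> bool" where
  "white M X \<longleftrightarrow> prob_space M \<and> (\<forall>k. X k \<in> borel_measurable M) \<and>
    (\<forall>l\<in>I. integrable M (\<lambda>y. lin I B (\<lambda>k. X k y) l) \<and> (\<integral>y. lin I B (\<lambda>k. X k y) l \<partial>M) = 0) \<and>
    (\<forall>l\<in>I. \<forall>m\<in>I. integrable M (\<lambda>y. lin I B (\<lambda>k. X k y) l * lin I B (\<lambda>k. X k y) m) \<and>
       (\<integral>y. lin I B (\<lambda>k. X k y) l * lin I B (\<lambda>k. X k y) m \<partial>M) = (if l = m then 1 else 0)) \<and>
    integrable M (\<lambda>y. (norm1 I (lin I B (\<lambda>k. X k y))) ^ 3)"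

text \<open>If the covariance is A A^T, that of B X is B A A^T B^T, the identity. The third moment
  of B X is controlled by those of the components.\<close>

lemma white_of_covariance:
  assumes M: "prob_space M" and X[measurable]: "\<And>k. X k \<in> borel_measurable M"
    and cube: "\<And>k. k \<in> I \<Longrightarrow> integrable M (\<lambda>y. \<bar>X k y\<bar> ^ 3)"
    and mean: "\<And>k. k \<in> I \<Longrightarrow> (\<integral>y. X k y \<partial>M) = 0"
    and cov: "\<And>j k. j \<in> I \<Longrightarrow> k \<in> I \<Longrightarrow> (\<integral>y. X j y * X k y \<partial>M) = (\<Sum>l\<in>I. A j l * A k l)"
  shows "white M X"
proof -
  interpret prob_space M by fact
  have i1: "integrable M (X k)" if "k \<in> I" for k
    using integrable_of_cube(1)[OF X X cube cube] that by blast
  have i2: "integrable M (\<lambda>y. X j y * X k y)" if "j \<in> I" "k \<in> I" for j k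
    using integrable_of_cube(2)[OF X X cube cube] that by blast
  have Um[measurable]: "(\<lambda>y. lin I B (\<lambda>k. X k y) l) \<in> borel_measurable M" for l
    unfolding lin_def by measurable
  have Ucube: "integrable M (\<lambda>y. \<bar>lin I B (\<lambda>k. X k y) l\<bar> ^ 3)" for l
  proof (rule Bochner_Integration.integrable_bound)
    show "integrable M (\<lambda>y. (\<Sum>j\<in>I. \<bar>B l j * X j y\<bar>) ^ 3)"
      using cube fin by (intro integrable_sum_cube) (auto simp: abs_mult power_mult_distrib)
    show "AE y in M. norm (\<bar>lin I B (\<lambda>k. X k y) l\<bar> ^ 3) \<le> norm ((\<Sum>j\<in>I. \<bar>B l j * X j y\<bar>) ^ 3)"
      unfolding lin_def by (intro AE_I2) (auto intro!: power_mono sum_abs simp: sum_nonneg)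
  qed simp
  show ?thesis
    unfolding white_def
  proof (intro conjI ballI allI)
    show "prob_space M" by fact
    show "X k \<in> borel_measurable M" for k by fact
    show "integrable M (\<lambda>y. lin I B (\<lambda>k. X k y) l)" for l
      unfolding lin_def by (intro Bochner_Integration.integrable_sum integrable_mult_right i1)
    show "(\<integral>y. lin I B (\<lambda>k. X k y) l \<partial>M) = 0" for l
    proof -
      have "(\<integral>y. lin I B (\<lambda>k. X k y) l \<partial>M) = (\<Sum>j\<in>I. \<integral>y. B l j * X j y \<partial>M)"
        unfolding lin_def by (intro Bochner_Integration.integral_sum integrable_mult_right i1)
      then show ?thesis by (simp add: mean)
    qed
    have eq: "lin I B (\<lambda>k. X k y) l * lin I B (\<lambda>k. X k y) m = (\<Sum>i\<in>I. \<Sum>j\<in>I. (B l i * B m j) * (X i y * X j y))" for l m y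
      unfolding lin_def sum_product by (intro sum.cong refl) (simp add: mult_ac)
    show "integrable M (\<lambda>y. lin I B (\<lambda>k. X k y) l * lin I B (\<lambda>k. X k y) m)" for l m
      unfolding eq by (intro Bochner_Integration.integrable_sum integrable_mult_right i2)
    show "(\<integral>y. lin I B (\<lambda>k. X k y) l * lin I B (\<lambda>k. X k y) m \<partial>M) = (if l = m then 1 else 0)"
      if l: "l \<in> I" and m: "m \<in> I" for l m
    proof -
      have "(\<integral>y. lin I B (\<lambda>k. X k y) l * lin I B (\<lambda>k. X k y) m \<partial>M) =
        (\<Sum>i\<in>I. \<integral>y. (\<Sum>j\<in>I. (B l i * B m j) * (X i y * X j y)) \<partial>M)"
        unfolding eq
        by (intro Bochner_Integration.integral_sum Bochner_Integration.integrable_sum integrable_mult_right i2)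
      also have "\<dots> = (\<Sum>i\<in>I. \<Sum>j\<in>I. \<integral>y. (B l i * B m j) * (X i y * X j y) \<partial>M)"
        by (intro sum.cong refl Bochner_Integration.integral_sum integrable_mult_right i2)
      also have "\<dots> = (\<Sum>i\<in>I. \<Sum>j\<in>I. \<Sum>p\<in>I. (B l i * A i p) * (B m j * A j p))"
        by (intro sum.cong refl) (simp add: cov sum_distrib_left mult_ac)
      also have "\<dots> = (\<Sum>p\<in>I. \<Sum>i\<in>I. \<Sum>j\<in>I. (B l i * A i p) * (B m j * A j p))"
        by (subst (2) sum.swap, subst sum.swap) (rule refl)
      also have "\<dots> = (\<Sum>p\<in>I. (\<Sum>i\<in>I. B l i * A i p) * (\<Sum>j\<in>I. B m j * A j p))"
        unfolding sum_product ..
      also have "\<dots> = (\<Sum>p\<in>I. if l = p then (if m = p then 1 else 0) else 0)"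
        by (intro sum.cong refl) (simp add: BA l m)
      also have "\<dots> = (if l = m then 1 else 0)"
        using fin l by (simp add: sum.delta)
      finally show ?thesis .
    qed
    show "integrable M (\<lambda>y. (norm1 I (lin I B (\<lambda>k. X k y))) ^ 3)"
      by (intro integrable_sum_cube fin Um Ucube)
  qed
qed

text \<open>Allowing a second root \<open>A'\<close> of the same covariance costs nothing here, and
  it is what later shows that Gaussian orthant probabilities do not depend on the root. The factor
  \<open>sqrt 1\<close> makes the vector literally the one averaged over in
  \<open>sm I A' 1\<close>.\<close>

lemma white_std_gauss:
  assumes eq: "\<And>i j. i \<in> I \<Longrightarrow> j \<in> I \<Longrightarrow> (\<Sum>l\<in>I. A' i l * A' j l) = (\<Sum>l\<in>I. A i l * A j l)"
  shows "white (std_gauss I) (\<lambda>k w. sqrt 1 * lin I A' w k)"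
proof -
  interpret G: prob_space "std_gauss I" by (rule prob_space_std_gauss)
  have iw: "integrable (std_gauss I) (\<lambda>w. w l)" if l: "l \<in> I" for l
  proof -
    have "(\<lambda>w. \<Sum>j\<in>I. (if j = l then 1 else 0) * w j) = (\<lambda>w. w l :: real)"
      using l fin by (auto simp: if_distrib[of "\<lambda>x. x * _"] sum.delta cong: if_cong)
    then show ?thesis using integrable_std_gauss_quadratic(1)[OF fin, of "\<lambda>j. if j = l then 1 else 0"] by simp
  qed
  have ic: "integrable (std_gauss I) (\<lambda>w. \<bar>lin I A' w k\<bar> ^ 3)" for k
  proof (rule integrable_std_gauss_bound[OF fin, where K="(\<Sum>l\<in>I. \<bar>A' k l\<bar>) ^ 3" and c=3])
    fix w :: "nat \<Rightarrow> real"
    let ?m = "norm1 I w"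
    let ?s = "\<Sum>l\<in>I. \<bar>A' k l\<bar>"
    have "\<bar>lin I A' w k\<bar> \<le> ?s * ?m" unfolding lin_def by (rule abs_sum_mult_le[OF fin])
    also have "\<dots> \<le> ?s * exp ?m"
    proof (rule mult_left_mono)
      show "?m \<le> exp ?m" using exp_ge_add_one_self[of ?m] by linarith
    qed (intro sum_nonneg, simp)
    finally have "\<bar>lin I A' w k\<bar> ^ 3 \<le> (?s * exp ?m) ^ 3" by (intro power_mono) auto
    then show "\<bar>\<bar>lin I A' w k\<bar> ^ 3\<bar> \<le> ?s ^ 3 * exp (3 * ?m)"
      by (simp add: power_mult_distrib exp_of_nat_mult[symmetric])
  qed simp
  have iww: "integrable (std_gauss I) (\<lambda>w. w l * w m)" if "l \<in> I" "m \<in> I" for l m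
  proof -
    have "integrable (std_gauss I) (\<lambda>w. \<bar>w l\<bar> ^ 3)" if l: "l \<in> I" for l
    proof (rule integrable_std_gauss_bound[OF fin, where K=1 and c=3])
      show "(\<lambda>w. \<bar>w l\<bar> ^ 3) \<in> borel_measurable (std_gauss I)" using l by measurable
      fix w :: "nat \<Rightarrow> real"
      have "\<bar>w l\<bar> ^ 3 \<le> exp (norm1 I w) ^ 3"
        using coordinate_le_exp[OF fin l] by (intro power_mono) auto
      then show "\<bar>\<bar>w l\<bar> ^ 3\<bar> \<le> 1 * exp (3 * (norm1 I w))" by (simp add: exp_of_nat_mult[symmetric])
    qed
    with that show ?thesis by (intro G.integrable_of_cube(2)) (auto intro!: iw borel_measurable_integrable)
  qed
  show ?thesis
  proof (rule white_of_covariance[OF prob_space_std_gauss sm_measurable])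
    show "integrable (std_gauss I) (\<lambda>w. \<bar>sqrt 1 * lin I A' w k\<bar> ^ 3)" for k using ic by simp
    show "(\<integral>w. sqrt 1 * lin I A' w k \<partial>std_gauss I) = 0" for k
    proof -
      have "(\<integral>w. lin I A' w k \<partial>std_gauss I) = (\<Sum>l\<in>I. \<integral>w. A' k l * w l \<partial>std_gauss I)"
        unfolding lin_def by (intro Bochner_Integration.integral_sum integrable_mult_right iw)
      then show ?thesis by (simp add: integral_std_gauss_coordinate[OF fin])
    qed
    show "(\<integral>w. sqrt 1 * lin I A' w j * (sqrt 1 * lin I A' w k) \<partial>std_gauss I) = (\<Sum>l\<in>I. A j l * A k l)"
      if j: "j \<in> I" and k: "k \<in> I" for j k
    proof -
      have "(\<integral>w. lin I A' w j * lin I A' w k \<partial>std_gauss I) = (\<integral>w. (\<Sum>l\<in>I. \<Sum>m\<in>I. (A' j l * A' k m) * (w l * w m)) \<partial>std_gauss I)"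
        unfolding lin_def sum_product by (simp add: mult_ac)
      also have "\<dots> = (\<Sum>l\<in>I. \<integral>w. (\<Sum>m\<in>I. (A' j l * A' k m) * (w l * w m)) \<partial>std_gauss I)"
        by (intro Bochner_Integration.integral_sum Bochner_Integration.integrable_sum integrable_mult_right iww)
      also have "\<dots> = (\<Sum>l\<in>I. \<Sum>m\<in>I. \<integral>w. (A' j l * A' k m) * (w l * w m) \<partial>std_gauss I)"
        by (intro sum.cong refl Bochner_Integration.integral_sum integrable_mult_right iww)
      also have "\<dots> = (\<Sum>l\<in>I. \<Sum>m\<in>I. if l = m then A' j l * A' k m else 0)"
        by (intro sum.cong refl) (simp add: integral_std_gauss_coordinates[OF fin])
      also have "\<dots> = (\<Sum>l\<in>I. A' j l * A' k l)" using fin by (simp add: sum.delta')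
      finally show ?thesis using eq[OF j k] by simp
    qed
  qed
qed

text \<open>Averaging the quadratic over a whitened vector removes the linear part and leaves the
  trace of the second-order part. The limiting number is thus the same for every
  \<open>white\<close> vector, and only the third moment enters the error.\<close>

lemma avg_quadratic_approx:
  assumes W: "white M X" and h: "local_on I f" "\<And>z. \<bar>f z\<bar> \<le> H"
    and approx: "\<forall>x. \<bar>f (\<lambda>k. z k - x k) - (quad I c0 c1 c2 (lin I B x))\<bar> \<le> K * (norm1 I (lin I B x)) ^ 3"
  shows "\<bar>avg M X f z - (c0 + (\<Sum>l\<in>I. c2 l l))\<bar> \<le> K * (\<integral>y. (norm1 I (lin I B (\<lambda>k. X k y))) ^ 3 \<partial>M)"
proof -
  interpret prob_space M using W unfolding white_def by simp
  have X: "\<And>k. X k \<in> borel_measurable M" using W unfolding white_def by simp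
  define U where "U l y = lin I B (\<lambda>k. X k y) l" for l y
  have U1: "integrable M (U l)" "(\<integral>y. U l y \<partial>M) = 0" if "l \<in> I" for l
    using W that unfolding white_def U_def by auto
  have U2: "integrable M (\<lambda>y. U l y * U m y)" "(\<integral>y. U l y * U m y \<partial>M) = (if l = m then 1 else 0)" if "l \<in> I" "m \<in> I" for l m
    using W that unfolding white_def U_def by auto
  have U3: "integrable M (\<lambda>y. (\<Sum>l\<in>I. \<bar>U l y\<bar>) ^ 3)"
    using W unfolding white_def U_def by auto
  have a1: "integrable M (\<lambda>y. \<Sum>l\<in>I. c1 l * U l y)"
    by (intro Bochner_Integration.integrable_sum integrable_mult_right U1)
  have a2: "integrable M (\<lambda>y. \<Sum>l\<in>I. \<Sum>m\<in>I. c2 l m * (U l y * U m y))"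
    by (intro Bochner_Integration.integrable_sum integrable_mult_right U2)
  define Q where "Q y = c0 + (\<Sum>l\<in>I. c1 l * U l y) + (\<Sum>l\<in>I. \<Sum>m\<in>I. c2 l m * (U l y * U m y))" for y
  have iQ: "integrable M Q"
    unfolding Q_def by (intro Bochner_Integration.integrable_add a1 a2 integrable_const)
  have "(\<integral>y. Q y \<partial>M) = c0 + (\<integral>y. (\<Sum>l\<in>I. c1 l * U l y) \<partial>M) + (\<integral>y. (\<Sum>l\<in>I. \<Sum>m\<in>I. c2 l m * (U l y * U m y)) \<partial>M)"
    unfolding Q_def using a1 a2 by (simp add: prob_space)
  also have "(\<integral>y. (\<Sum>l\<in>I. c1 l * U l y) \<partial>M) = (\<Sum>l\<in>I. \<integral>y. c1 l * U l y \<partial>M)"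
    by (intro Bochner_Integration.integral_sum integrable_mult_right U1)
  also have "\<dots> = 0" by (simp add: U1)
  also have "(\<integral>y. (\<Sum>l\<in>I. \<Sum>m\<in>I. c2 l m * (U l y * U m y)) \<partial>M) = (\<Sum>l\<in>I. \<integral>y. (\<Sum>m\<in>I. c2 l m * (U l y * U m y)) \<partial>M)"
    by (intro Bochner_Integration.integral_sum Bochner_Integration.integrable_sum integrable_mult_right U2)
  also have "\<dots> = (\<Sum>l\<in>I. \<Sum>m\<in>I. \<integral>y. c2 l m * (U l y * U m y) \<partial>M)"
    by (intro sum.cong refl Bochner_Integration.integral_sum integrable_mult_right U2)
  also have "\<dots> = (\<Sum>l\<in>I. \<Sum>m\<in>I. if l = m then c2 l m else 0)"
    by (intro sum.cong refl) (simp add: U2)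
  also have "\<dots> = (\<Sum>l\<in>I. c2 l l)"
    using fin by (simp add: sum.delta')
  finally have Q: "(\<integral>y. Q y \<partial>M) = c0 + (\<Sum>l\<in>I. c2 l l)" by simp
  have ifX: "integrable M (\<lambda>y. f (\<lambda>k. z k - X k y))"
    by (rule avg_integrable[OF prob_space_axioms X h])
  have "avg M X f z - (c0 + (\<Sum>l\<in>I. c2 l l)) = (\<integral>y. f (\<lambda>k. z k - X k y) - Q y \<partial>M)"
    unfolding avg_def Q[symmetric] using ifX iQ by simp
  also have "\<bar>\<dots>\<bar> \<le> (\<integral>y. \<bar>f (\<lambda>k. z k - X k y) - Q y\<bar> \<partial>M)" by (rule integral_abs_bound)
  also have "\<dots> \<le> (\<integral>y. K * (\<Sum>l\<in>I. \<bar>U l y\<bar>) ^ 3 \<partial>M)"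
  proof (intro integral_mono integrable_abs Bochner_Integration.integrable_diff ifX iQ integrable_mult_right U3)
    fix y
    show "\<bar>f (\<lambda>k. z k - X k y) - Q y\<bar> \<le> K * (\<Sum>l\<in>I. \<bar>U l y\<bar>) ^ 3"
      unfolding Q_def U_def by (rule approx[THEN spec, of "\<lambda>k. X k y"])
  qed
  finally show ?thesis unfolding U_def by simp
qed

abbreviation exchange_cost :: "'b measure \<Rightarrow> (nat \<Rightarrow> 'b \<Rightarrow> real) \<Rightarrow> real \<Rightarrow> bool" where
  "exchange_cost M X C \<equiv> \<forall>h H v z. local_on I h \<longrightarrow> (\<forall>z. \<bar>h z\<bar> \<le> H) \<longrightarrow> 0 < v \<longrightarrow>
    \<bar>avg M X (sm I A v h) z - sm I A 1 (sm I A v h) z\<bar> \<le> C * H / sqrt v ^ 3"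

text \<open>Both averages are close to the same number, the constant term plus the trace of the
  expansion at \<open>z\<close>. The errors carry the third moments \<open>b1\<close> of the summand
  and \<open>b2\<close> of its Gaussian substitute.\<close>

lemma avg_sm_gauss_swap:
  assumes W: "white M X"
  shows "\<exists>C>0. exchange_cost M X C"
proof -
  obtain C where C: "0 < C" "\<forall>h H v z. local_on I h \<longrightarrow> (\<forall>z. \<bar>h z\<bar> \<le> H) \<longrightarrow> 0 < v \<longrightarrow>
    (\<exists>c0 c1 c2. \<forall>x. \<bar>sm I A v h (\<lambda>k. z k - x k) - (quad I c0 c1 c2 (lin I B x))\<bar> \<le> C * H / (sqrt v) ^ 3 * (norm1 I (lin I B x)) ^ 3)"
    using sm_second_order by (elim exE conjE) (rule that)
  define b1 where "b1 = (\<integral>y. (norm1 I (lin I B (\<lambda>k. X k y))) ^ 3 \<partial>M)"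
  define b2 where "b2 = (\<integral>w. (norm1 I (lin I B (\<lambda>k. sqrt 1 * lin I A w k))) ^ 3 \<partial>std_gauss I)"
  have b: "0 \<le> b1" "0 \<le> b2" unfolding b1_def b2_def by (auto intro!: Bochner_Integration.integral_nonneg zero_le_power sum_nonneg)
  show ?thesis
  proof (rule exI[of _ "C * (b1 + b2 + 1)"], intro conjI allI impI)
    show "0 < C * (b1 + b2 + 1)" using C(1) b by (simp add: add_nonneg_pos)
    fix h and H v :: real and z :: "nat \<Rightarrow> real"
    assume h: "local_on I h" and bd: "\<forall>z. \<bar>h z\<bar> \<le> H" and v: "0 < v"
    have H0: "0 \<le> H" using bd[THEN spec, of "\<lambda>_. 0"] by linarith
    have bd': "\<And>z. \<bar>h z\<bar> \<le> H" using bd by simp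
    from C(2)[THEN spec[of _ h], THEN spec[of _ H], THEN spec[of _ v], THEN spec[of _ z], THEN mp, OF h, THEN mp, OF bd, THEN mp, OF v]
    obtain c0 c1 c2 where c: "\<forall>x. \<bar>sm I A v h (\<lambda>k. z k - x k) - (quad I c0 c1 c2 (lin I B x))\<bar> \<le> C * H / (sqrt v) ^ 3 * (norm1 I (lin I B x)) ^ 3"
      by (elim exE) (rule that)
    note s = sm_local_on[OF h] sm_bounds[OF h bd']
    have "\<bar>avg M X (sm I A v h) z - (c0 + (\<Sum>l\<in>I. c2 l l))\<bar> \<le> C * H / (sqrt v) ^ 3 * b1"
      unfolding b1_def by (rule avg_quadratic_approx[OF W s c])
    moreover have "\<bar>sm I A 1 (sm I A v h) z - (c0 + (\<Sum>l\<in>I. c2 l l))\<bar> \<le> C * H / (sqrt v) ^ 3 * b2"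
      unfolding b2_def sm_def[of I A 1] by (rule avg_quadratic_approx[OF white_std_gauss[OF refl] s c])
    ultimately have "\<bar>avg M X (sm I A v h) z - sm I A 1 (sm I A v h) z\<bar> \<le> C * H / (sqrt v) ^ 3 * b1 + C * H / (sqrt v) ^ 3 * b2"
      by linarith
    also have "\<dots> = C * H / (sqrt v) ^ 3 * (b1 + b2)" by (simp only: distrib_left)
    also have "\<dots> \<le> C * H / (sqrt v) ^ 3 * (b1 + b2 + 1)"
      using C(1) H0 v by (intro mult_left_mono divide_nonneg_nonneg) auto
    finally show "\<bar>avg M X (sm I A v h) z - sm I A 1 (sm I A v h) z\<bar> \<le> C * (b1 + b2 + 1) * H / sqrt v ^ 3"
      by (simp add: mult_ac)
  qed
qed

lemma avg_iterate_facts: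
  assumes M: "prob_space M" and X: "\<And>k. X k \<in> borel_measurable M"
  shows "local_on I ((avg M X ^^ n) (orthant I))" "\<bar>(avg M X ^^ n) (orthant I) z\<bar> \<le> 1"
    "(\<And>k. k \<in> I \<Longrightarrow> z k \<le> z' k) \<Longrightarrow> (avg M X ^^ n) (orthant I) z \<le> (avg M X ^^ n) (orthant I) z'"
proof -
  have "local_on I ((avg M X ^^ n) (orthant I)) \<and> (\<forall>z. \<bar>(avg M X ^^ n) (orthant I) z\<bar> \<le> 1) \<and>
    (\<forall>z z'. (\<forall>k\<in>I. z k \<le> z' k) \<longrightarrow> (avg M X ^^ n) (orthant I) z \<le> (avg M X ^^ n) (orthant I) z')"
  proof (induction n)
    case 0
    then show ?case using orthant_local_on[OF fin] orthant_bounds(2) by (auto intro: orthant_mono)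
  next
    case (Suc n)
    let ?F = "(avg M X ^^ n) (orthant I)"
    from Suc have F: "local_on I ?F" "\<And>z. \<bar>?F z\<bar> \<le> 1" "\<And>z z'. (\<And>k. k \<in> I \<Longrightarrow> z k \<le> z' k) \<Longrightarrow> ?F z \<le> ?F z'"
      by auto
    show ?case
      using avg_local_on[OF M X F(1)] avg_bounds[OF M X F(1,2)] avg_mono_pointwise[OF M X F(1,2,3)] by simp
  qed
  then show "local_on I ((avg M X ^^ n) (orthant I))" "\<bar>(avg M X ^^ n) (orthant I) z\<bar> \<le> 1"
    "(\<And>k. k \<in> I \<Longrightarrow> z k \<le> z' k) \<Longrightarrow> (avg M X ^^ n) (orthant I) z \<le> (avg M X ^^ n) (orthant I) z'"
    by auto
qed

text \<open>One step of the exchange: a summand \<open>X\<close> is replaced by a Gaussian one in the presence of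
  \<open>k\<close> further summands \<open>X\<close> and \<open>m\<close> Gaussian ones. The Gaussian part alone yields the first bound;
  replacing the \<open>k\<close> summands by Gaussians as well, at the price \<open>d\<close>, yields the second one.\<close>

lemma exchange_bounds:
  assumes M: "prob_space M" and X: "\<And>k. X k \<in> borel_measurable M"
    and C: "exchange_cost M X C"
    and m: "0 < m"
  defines "F \<equiv> \<lambda>k. (avg M X ^^ k) (orthant I)"
  shows "\<bar>sm I A m (F (Suc k)) z - sm I A (m + 1) (F k) z\<bar> \<le> C / sqrt m ^ 3"
    and "\<lbrakk>0 < k; \<And>z. \<bar>F k z - sm I A k (orthant I) z\<bar> \<le> d\<rbrakk> \<Longrightarrow>
      \<bar>sm I A m (F (Suc k)) z - sm I A (m + 1) (F k) z\<bar> \<le> C * d / sqrt m ^ 3 + C / sqrt (m + k) ^ 3"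
proof -
  have F: "local_on I (F k)" "\<And>z. \<bar>F k z\<bar> \<le> 1"
    unfolding F_def by (rule avg_iterate_facts(1,2)[where X=X, OF M X])+
  have O: "local_on I (orthant I)" "\<And>z. \<bar>orthant I z\<bar> \<le> 1"
    using orthant_local_on[OF fin] orthant_bounds(2) by auto
  have swap: "\<bar>avg M X (sm I A v h) z - sm I A 1 (sm I A v h) z\<bar> \<le> C * H / sqrt v ^ 3"
    if "local_on I h" "\<And>z. \<bar>h z\<bar> \<le> H" "0 < v" for h H v
    using C that by simp
  have eq1: "sm I A m (F (Suc k)) z = avg M X (sm I A m (F k)) z"
    unfolding F_def sm_def funpow.simps comp_def
    by (rule avg_commute[OF prob_space_std_gauss sm_measurable M X F(1,2)[unfolded F_def]])
  have eq2: "sm I A (m + 1) (F k) z = sm I A 1 (sm I A m (F k)) z"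
    using sm_sm[OF fin zero_less_one m F(1,2)] by (simp add: add.commute)
  show "\<bar>sm I A m (F (Suc k)) z - sm I A (m + 1) (F k) z\<bar> \<le> C / sqrt m ^ 3"
    unfolding eq1 eq2 using swap[OF F(1,2) m] by simp
  assume k: "0 < k" and d: "\<And>z. \<bar>F k z - sm I A k (orthant I) z\<bar> \<le> d"
  let ?G = "sm I A k (orthant I)"
  let ?h = "\<lambda>z. F k z - ?G z"
  note G = sm_local_on[OF O(1), of A "real k"] sm_bounds[OF O, of A "real k"]
  have h: "local_on I ?h" by (rule local_on_diff[OF F(1) G(1)])
  \<comment> \<open>\<open>F k\<close> splits into the error \<open>?h\<close>, which is small but
    smoothed with variance \<open>m\<close> only, and a Gaussian part, which is merely bounded by 1
    but has accumulated variance \<open>m + k\<close>. The two terms of the bound come from these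
    two parts.\<close>
  have s: "sm I A m (F k) = (\<lambda>z. sm I A m ?h z + sm I A (m + k) (orthant I) z)"
  proof
    fix z
    have "sm I A m ?h z = sm I A m (F k) z - sm I A m ?G z"
      unfolding sm_def[of I A m] by (rule avg_diff[OF prob_space_std_gauss sm_measurable F(1,2) G])
    moreover have "sm I A m ?G z = sm I A (m + k) (orthant I) z"
      using k by (intro sm_sm[OF fin m _ O]) auto
    ultimately show "sm I A m (F k) z = sm I A m ?h z + sm I A (m + k) (orthant I) z" by simp
  qed
  note h' = sm_local_on[OF h, of A m] sm_bounds[OF h d, of A m]
  note O' = sm_local_on[OF O(1), of A "m + k"] sm_bounds[OF O, of A "m + k"]
  have "\<bar>avg M X (sm I A m ?h) z - sm I A 1 (sm I A m ?h) z\<bar> \<le> C * d / sqrt m ^ 3"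
    by (rule swap[OF h d m])
  moreover have "\<bar>avg M X (sm I A (m + k) (orthant I)) z - sm I A 1 (sm I A (m + k) (orthant I)) z\<bar> \<le> C / sqrt (m + k) ^ 3"
    using swap[OF O, of "m + k"] m by simp
  moreover have "avg M X (sm I A m (F k)) z = avg M X (sm I A m ?h) z + avg M X (sm I A (m + k) (orthant I)) z"
    unfolding s by (rule avg_add[OF M X h' O'])
  moreover have "sm I A 1 (sm I A m (F k)) z = sm I A 1 (sm I A m ?h) z + sm I A 1 (sm I A (m + k) (orthant I)) z"
    unfolding s sm_def[of I A 1] by (rule avg_add[OF prob_space_std_gauss sm_measurable h' O'])
  ultimately show "\<bar>sm I A m (F (Suc k)) z - sm I A (m + 1) (F k) z\<bar> \<le> C * d / sqrt m ^ 3 + C / sqrt (m + k) ^ 3"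
    unfolding eq1 eq2 by linarith
qed

text \<open>The additional smoothing of variance \<open>w\<close> keeps the last exchanges, where
  few Gaussian summands remain, under control. The assumed bound \<open>D\<close> re-enters only
  with the factor \<open>4 * C / N\<close>, which a large \<open>N\<close> makes small.\<close>

lemma telescoped_exchange:
  assumes M: "prob_space M" and X: "\<And>k. X k \<in> borel_measurable M"
    and C: "0 < C" "exchange_cost M X C"
    and N: "1 \<le> N" and n: "1 \<le> n" and D: "0 \<le> D"
  defines "F \<equiv> \<lambda>k. (avg M X ^^ k) (orthant I)" and "w \<equiv> 1 + real N ^ 2"
  assumes IH: "\<And>k z. 1 \<le> k \<Longrightarrow> k < n \<Longrightarrow> \<bar>F k z - sm I A k (orthant I) z\<bar> \<le> D / sqrt k"
  shows "\<bar>sm I A w (F n) z - sm I A w (sm I A n (orthant I)) z\<bar> \<le> (3 * C + 4 * C * D / N) / sqrt n"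
proof -
  have w: "1 < w" using N unfolding w_def by simp
  have O: "local_on I (orthant I)" "\<And>z. \<bar>orthant I z\<bar> \<le> 1"
    using orthant_local_on[OF fin] orthant_bounds(2) by auto
  \<comment> \<open>Here \<open>k\<close> summands are original, \<open>n - k\<close> are Gaussian,
    and \<open>w\<close> is the additional smoothing. From \<open>a k\<close> to
    \<open>a (Suc k)\<close> one Gaussian summand is turned back into an original one while variance
    \<open>n - 1 - k + w\<close> remains.\<close>
  define a where "a k = sm I A (real (n - k) + w) (F k) z" for k
  \<comment> \<open>The factor 3 bounds \<open>2 * sqrt 2\<close>, the loss incurred when the
    Gaussian variance is only known to be at least \<open>n / 2\<close>.\<close>
  define e where "e = 3 * C / (real n * sqrt n)"
  have sn: "0 < sqrt n" "sqrt n * sqrt n = n" using n by auto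
  have bound: "\<bar>a (Suc k) - a k\<bar> \<le> e + 2 * C * D / sqrt n * (1 / sqrt (real (n - 1 - k) + w) ^ 3)"
    if k: "k < n" for k
  proof -
    define m where "m = real (n - 1 - k) + w"
    have m: "1 < m" using w unfolding m_def by simp
    have a1: "a (Suc k) = sm I A m (F (Suc k)) z" unfolding a_def m_def using k by simp
    have a0: "a k = sm I A (m + 1) (F k) z" unfolding a_def m_def using k by (simp add: of_nat_diff add_ac)
    have nc: "0 \<le> 2 * C * D / sqrt n * (1 / sqrt m ^ 3)" using C(1) D m by simp
    show ?thesis
    \<comment> \<open>In the first half at least variance \<open>n / 2\<close> is Gaussian and each
      exchange costs order n^(-3/2) outright. In the second half \<open>k\<close> is at least
      \<open>n / 2\<close>, so the induction hypothesis gives an error of at most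
      \<open>2 * D / sqrt n\<close>, to be multiplied by the summable factor
      \<open>1 / sqrt m ^ 3\<close>. The case \<open>k = 0\<close>, where that hypothesis is void,
      falls into the first half.\<close>
    proof (cases "2 * k < n")
      case True
      have nm: "real n \<le> 2 * m" unfolding m_def using True w k by (simp add: of_nat_diff)
      have "real n * sqrt n = sqrt n ^ 3" using sn by (simp add: power3_eq_cube)
      also have "\<dots> \<le> sqrt (2 * m) ^ 3" using nm by (intro power_mono) auto
      also have "\<dots> = sqrt 2 ^ 3 * sqrt m ^ 3" by (simp only: real_sqrt_mult power_mult_distrib)
      also have "sqrt 2 ^ 3 = 2 * sqrt 2" by (simp add: power3_eq_cube)
      also have "2 * sqrt 2 * sqrt m ^ 3 \<le> 3 * sqrt m ^ 3"
      proof (rule mult_right_mono)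
        have "sqrt 2 \<le> 3 / 2" by (rule real_le_lsqrt) (auto simp: power2_eq_square)
        then show "2 * sqrt 2 \<le> 3" by simp
      qed (use m in simp)
      finally have "real n * sqrt n \<le> 3 * sqrt m ^ 3" .
      then have "C * (real n * sqrt n) \<le> C * (3 * sqrt m ^ 3)" using C(1) by (intro mult_left_mono) auto
      then have "C / sqrt m ^ 3 \<le> e"
        unfolding e_def using m sn n by (simp add: divide_le_eq pos_le_divide_eq mult_ac)
      moreover have "\<bar>a (Suc k) - a k\<bar> \<le> C / sqrt m ^ 3"
        unfolding a1 a0 F_def by (rule exchange_bounds(1)[OF M X C(2)]) (use m in simp)
      ultimately show ?thesis using nc unfolding m_def by linarith
    next
      case False
      then have k0: "0 < k" using n by simp
      have "\<bar>a (Suc k) - a k\<bar> \<le> C * (D / sqrt k) / sqrt m ^ 3 + C / sqrt (m + k) ^ 3"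
        unfolding a1 a0 F_def
      proof (rule exchange_bounds(2)[OF M X C(2)])
        show "0 < m" "0 < k" using m k0 by auto
        show "\<bar>(avg M X ^^ k) (orthant I) z - sm I A k (orthant I) z\<bar> \<le> D / sqrt k" for z
          using IH[of k z] k0 k unfolding F_def by simp
      qed
      also have "C / sqrt (m + k) ^ 3 \<le> e"
      proof -
        have "real n \<le> m + k" unfolding m_def using k w by (simp add: of_nat_diff)
        then have "sqrt n ^ 3 \<le> sqrt (m + k) ^ 3" by (intro power_mono) auto
        then have "C / sqrt (m + k) ^ 3 \<le> C / sqrt n ^ 3"
          using C(1) sn m by (intro divide_left_mono) (auto intro!: mult_pos_pos)
        also have "\<dots> = C / (real n * sqrt n)" using sn by (simp add: power3_eq_cube)
        also have "\<dots> \<le> e" unfolding e_def using C(1) sn n by (simp add: divide_right_mono)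
        finally show ?thesis .
      qed
      also have "C * (D / sqrt k) / sqrt m ^ 3 \<le> 2 * C * D / sqrt n * (1 / sqrt m ^ 3)"
      proof -
        have "sqrt n \<le> sqrt (4 * k)" using False by (intro real_sqrt_le_mono) auto
        then have "sqrt n \<le> 2 * sqrt k" by (simp add: real_sqrt_mult)
        then have "1 / sqrt k \<le> 2 / sqrt n" using sn k0 by (simp add: field_simps)
        then have "(C * D / sqrt m ^ 3) * (1 / sqrt k) \<le> (C * D / sqrt m ^ 3) * (2 / sqrt n)"
          using C(1) D m by (intro mult_left_mono) auto
        then show ?thesis by (simp add: mult_ac)
      qed
      finally show ?thesis unfolding m_def by linarith
    qed
  qed
  have "sm I A w (F n) z - sm I A w (sm I A n (orthant I)) z = a n - a 0"
  proof -
    have "sm I A w (sm I A n (orthant I)) z = sm I A (real n + w) (orthant I) z"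
      using sm_sm[OF fin _ _ O, of w "real n" A z] w n by (simp add: add.commute)
    then show ?thesis unfolding a_def F_def by simp
  qed
  also have "\<dots> = (\<Sum>k<n. a (Suc k) - a k)" by (rule sum_lessThan_telescope[symmetric])
  also have "\<bar>\<dots>\<bar> \<le> (\<Sum>k<n. \<bar>a (Suc k) - a k\<bar>)" by (rule sum_abs)
  also have "\<dots> \<le> (\<Sum>k<n. e + 2 * C * D / sqrt n * (1 / sqrt (real (n - 1 - k) + w) ^ 3))"
    by (intro sum_mono bound) auto
  also have "\<dots> = n * e + 2 * C * D / sqrt n * (\<Sum>k<n. 1 / sqrt (real (n - 1 - k) + w) ^ 3)"
    unfolding sum.distrib sum_distrib_left[symmetric] by simp
  also have "(\<Sum>k<n. 1 / sqrt (real (n - 1 - k) + w) ^ 3) = (\<Sum>j<n. 1 / sqrt (real j + w) ^ 3)"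
    using sum.nat_diff_reindex[of "\<lambda>j. 1 / sqrt (real j + w) ^ 3" n] by simp
  also have "n * e = 3 * C / sqrt n" unfolding e_def using sn n by (simp add: field_simps)
  also have "2 * C * D / sqrt n * (\<Sum>j<n. 1 / sqrt (real j + w) ^ 3) \<le> 2 * C * D / sqrt n * (2 / N)"
    using C(1) D sn unfolding w_def by (intro mult_left_mono sum_inverse_sqrt_cube_bound N) auto
  finally have "\<bar>sm I A w (F n) z - sm I A w (sm I A n (orthant I)) z\<bar> \<le>
    3 * C / sqrt n + 2 * C * D / sqrt n * (2 / N)" by simp
  also have "\<dots> = (3 * C + 4 * C * D / N) / sqrt n" by (simp add: add_divide_distrib mult_ac)
  finally show ?thesis .
qed

lemma berry_esseen_avg:
  assumes W: "white M X"
  shows "\<exists>D>0. \<forall>n\<ge>1. \<forall>z. \<bar>(avg M X ^^ n) (orthant I) z - sm I A n (orthant I) z\<bar> \<le> D / sqrt n"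
proof -
  have M: "prob_space M" and X: "\<And>k. X k \<in> borel_measurable M" using W unfolding white_def by auto
  have O: "local_on I (orthant I)" "\<And>z. \<bar>orthant I z\<bar> \<le> 1"
    using orthant_local_on[OF fin] orthant_bounds(2) by auto
  obtain C where C: "0 < C" "exchange_cost M X C"
    using avg_sm_gauss_swap[OF W] by (elim exE conjE) (rule that)
  obtain C1 where C1: "0 < C1" "\<forall>h v z t. local_on I h \<longrightarrow> (\<forall>z. \<bar>h z\<bar> \<le> 1) \<longrightarrow> 0 < v \<longrightarrow> 0 \<le> t \<longrightarrow>
    \<bar>sm I A v h (\<lambda>k. z k + t) - sm I A v h z\<bar> \<le> C1 * t / sqrt v"
    using sm_first_order by (elim exE conjE) (rule that)
  obtain r where r: "0 < r" "3/4 \<le> \<P>(w in std_gauss I. \<forall>k\<in>I. \<bar>lin I A w k\<bar> \<le> r)"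
    using lin_box by (elim exE conjE) (rule that)
  \<comment> \<open>With \<open>16 * C \<le> N\<close> the term \<open>4 * C * D / N\<close>,
    doubled by the removal of the smoothing, takes at most half of \<open>D\<close>.\<close>
  obtain N :: nat where N: "1 \<le> N" "16 * C \<le> N"
  proof -
    obtain N0 :: nat where "16 * C \<le> N0" using real_arch_simple by blast
    then show ?thesis using that[of "N0 + 1"] by simp
  qed
  define w where "w = 1 + real N ^ 2"
  \<comment> \<open>Half of \<open>D\<close> is exactly the doubled sum of the terms free of
    \<open>D\<close>: \<open>3 * C\<close> from the exchanges and \<open>2 * C1 * r * sqrt w\<close>
    from the variation of the Gaussian distribution function. There is no circularity, as
    \<open>w\<close> depends on \<open>N\<close> alone and \<open>N\<close> on
    \<open>C\<close>.\<close>
  define D where "D = 4 * (3 * C + 2 * C1 * r * sqrt w)"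
  have w: "0 < w" unfolding w_def by (simp add: add_pos_nonneg)
  have D: "0 < D" unfolding D_def using C(1) C1(1) r(1) w by (simp add: add_pos_pos)
  have "\<bar>(avg M X ^^ n) (orthant I) z - sm I A n (orthant I) z\<bar> \<le> D / sqrt n" if "1 \<le> n" for n z
    using that
  proof (induction n arbitrary: z rule: less_induct)
    case (less n)
    let ?F = "(avg M X ^^ n) (orthant I)"
    let ?G = "sm I A n (orthant I)"
    have n: "0 < sqrt n" using less.prems by simp
    define d where "d = (3 * C + 4 * C * D / N) / sqrt n"
    define e where "e = C1 * (2 * r * sqrt w) / sqrt n"
    have "\<bar>?F z - ?G z\<bar> \<le> 2 * d + 2 * e"
    proof (rule desmooth[where F="?F" and G="?G", OF r w])
      show "local_on I ?F" by (rule avg_iterate_facts(1)[where X=X, OF M X])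
      show "\<bar>?F z\<bar> \<le> 1" for z by (rule avg_iterate_facts(2)[where X=X, OF M X])
      show "?F z \<le> ?F z'" if "\<And>k. k \<in> I \<Longrightarrow> z k \<le> z' k" for z z'
        using that by (rule avg_iterate_facts(3)[where X=X, OF M X])
      show "local_on I ?G" "\<And>z. \<bar>?G z\<bar> \<le> 1" using sm_local_on[OF O(1)] sm_bounds[OF O] by auto
      show "?G z \<le> ?G z'" if "\<And>k. k \<in> I \<Longrightarrow> z k \<le> z' k" for z z'
        unfolding sm_def
        by (rule avg_mono_pointwise[OF prob_space_std_gauss sm_measurable O]) (use that in \<open>auto intro: orthant_mono\<close>)
      show "\<bar>sm I A w ?F z - sm I A w ?G z\<bar> \<le> d" for z
        unfolding w_def d_def using less D
        by (intro telescoped_exchange[OF M X C N(1)]) auto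
      show "?G (\<lambda>k. z k + 2 * r * sqrt w) - ?G z \<le> e" for z
        using C1(2)[THEN spec[of _ "orthant I"], THEN spec[of _ "real n"], THEN spec[of _ z], THEN spec[of _ "2 * r * sqrt w"]]
          O r(1) w less.prems unfolding e_def by simp
    qed
    also have "\<dots> \<le> D / sqrt n"
    proof -
      have N0: "0 < real N" using N(1) by simp
      have "C * D / N * 16 \<le> D" using N(2) N0 D by (simp add: divide_le_eq mult_ac)
      then have "2 * (3 * C + 4 * C * D / N) + 2 * (C1 * (2 * r * sqrt w)) \<le> D"
      proof -
        define x where "x = C * D / N"
        define y where "y = C1 * r * sqrt w"
        have "D = 12 * C + 8 * y" unfolding D_def y_def by (simp add: algebra_simps)
        moreover have "4 * C * D / N = 4 * x" "C1 * (2 * r * sqrt w) = 2 * y" unfolding x_def y_def by simp_all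
        moreover have "x * 16 \<le> D" using \<open>C * D / N * 16 \<le> D\<close> unfolding x_def .
        ultimately show ?thesis by simp
      qed
      then have "(2 * (3 * C + 4 * C * D / N) + 2 * (C1 * (2 * r * sqrt w))) / sqrt n \<le> D / sqrt n"
        using n by (intro divide_right_mono) auto
      then show ?thesis unfolding d_def e_def by (simp add: add_divide_distrib)
    qed
    finally show ?case .
  qed
  then show ?thesis using D by blast
qed

end

section \<open>From iterated averages to probabilities of sums\<close>

lemma avg_iterate_PiM:
  assumes M: "prob_space M" and [measurable]: "\<And>k. X k \<in> borel_measurable M"
    and h: "local_on I h" and bd: "\<And>z. \<bar>h z\<bar> \<le> H"
  shows "(avg M X ^^ n) h z = (\<integral>y. h (\<lambda>k. z k - (\<Sum>i<n. X k (y i))) \<partial>PiM {..<n} (\<lambda>_. M))"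
  using h bd
proof (induction n arbitrary: h)
  case 0
  interpret P: prob_space "PiM {..<0::nat} (\<lambda>_. M)" by (intro prob_space_PiM M)
  show ?case using P.prob_space by simp
next
  case (Suc n)
  interpret P: product_prob_space "\<lambda>_. M" by (simp add: product_prob_spaceI M)
  interpret PP: prob_space "PiM (insert n {..<n}) (\<lambda>_. M)" by (intro prob_space_PiM M)
  note h = Suc.prems
  have [measurable]: "(\<lambda>y. \<Sum>i<Suc n. X k (y i)) \<in> borel_measurable (PiM (insert n {..<n}) (\<lambda>_. M))" for k
    unfolding lessThan_Suc[symmetric] by measurable
  have i: "integrable (PiM (insert n {..<n}) (\<lambda>_. M)) (\<lambda>y. h (\<lambda>k. z k - (\<Sum>i<Suc n. X k (y i))))"
    by (intro PP.integrable_const_bound[where B=H] local_on_measurable_comp[OF h(1)] AE_I2) (auto simp: h(2))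
  \<comment> \<open>The innermost average is absorbed into the test function, which is why the
    induction runs over all \<open>h\<close>.\<close>
  have "(avg M X ^^ Suc n) h z = (avg M X ^^ n) (avg M X h) z"
    by (simp only: funpow_Suc_right comp_def)
  also have "\<dots> = (\<integral>x. avg M X h (\<lambda>k. z k - (\<Sum>i<n. X k (x i))) \<partial>PiM {..<n} (\<lambda>_. M))"
    by (rule Suc.IH[OF avg_local_on[OF M assms(2) h(1)] avg_bounds[OF M assms(2) h]])
  also have "\<dots> = (\<integral>x. \<integral>y. h (\<lambda>k. z k - (\<Sum>i<Suc n. X k ((x(n := y)) i))) \<partial>M \<partial>PiM {..<n} (\<lambda>_. M))"
    unfolding avg_def by (simp add: diff_diff_eq)
  also have "\<dots> = (\<integral>y. h (\<lambda>k. z k - (\<Sum>i<Suc n. X k (y i))) \<partial>PiM (insert n {..<n}) (\<lambda>_. M))"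
    by (rule P.product_integral_insert[OF _ _ i, symmetric]) auto
  finally show ?case by (simp only: lessThan_Suc)
qed

lemma avg_iterate_orthant:
  assumes fin: "finite I" and M: "prob_space M" and [measurable]: "\<And>k. X k \<in> borel_measurable M"
  shows "(avg M X ^^ n) (orthant I) z = \<P>(y in PiM {..<n} (\<lambda>_. M). \<forall>k\<in>I. (\<Sum>i<n. X k (y i)) \<le> z k)"
proof -
  interpret P: prob_space "PiM {..<n} (\<lambda>_. M)" by (intro prob_space_PiM M)
  let ?S = "{y \<in> space (PiM {..<n} (\<lambda>_. M)). \<forall>k\<in>I. (\<Sum>i<n. X k (y i)) \<le> z k}"
  have S[measurable]: "?S \<in> sets (PiM {..<n} (\<lambda>_. M))" using fin by measurable
  have "(avg M X ^^ n) (orthant I) z = (\<integral>y. orthant I (\<lambda>k. z k - (\<Sum>i<n. X k (y i))) \<partial>PiM {..<n} (\<lambda>_. M))"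
    by (rule avg_iterate_PiM[OF M assms(3) orthant_local_on[OF fin] orthant_bounds(2)])
  also have "\<dots> = (\<integral>y. indicator ?S y \<partial>PiM {..<n} (\<lambda>_. M))"
    by (intro Bochner_Integration.integral_cong refl) (auto simp: orthant_def indicator_def)
  finally show ?thesis by (simp add: Int_absorb2)
qed

definition gauss_cdf :: "nat set \<Rightarrow> (nat \<Rightarrow> nat \<Rightarrow> real) \<Rightarrow> (nat \<Rightarrow> real) \<Rightarrow> real" where
  "gauss_cdf I A t = \<P>(w in std_gauss I. \<forall>k\<in>I. lin I A w k \<le> t k)"

lemma sm_orthant:
  assumes fin: "finite I" and v: "0 < v"
  shows "sm I A v (orthant I) (\<lambda>k. sqrt v * t k) = gauss_cdf I A t"
proof -
  interpret P: prob_space "std_gauss I" by (rule prob_space_std_gauss)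
  let ?S = "{w \<in> space (std_gauss I). \<forall>k\<in>I. lin I A w k \<le> t k}"
  have S[measurable]: "?S \<in> sets (std_gauss I)" using fin by measurable
  have "sm I A v (orthant I) (\<lambda>k. sqrt v * t k) = (\<integral>w. indicator ?S w \<partial>std_gauss I)"
    unfolding sm_def avg_def using v
    by (intro Bochner_Integration.integral_cong refl) (auto simp: orthant_def indicator_def)
  then show ?thesis unfolding gauss_cdf_def by (simp add: Int_absorb2)
qed

text \<open>Counted from \<open>Suc n\<close> because the semigroup law is available for positive
  variances only.\<close>

lemma sm_one_iterate:
  assumes fin: "finite I"
  shows "(sm I A 1 ^^ Suc n) (orthant I) = sm I A (Suc n) (orthant I)"
proof (induction n)
  case 0
  then show ?case by simp
next
  case (Suc n)
  show ?case
  proof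
    fix z
    have "(sm I A 1 ^^ Suc (Suc n)) (orthant I) z = sm I A 1 (sm I A (Suc n) (orthant I)) z"
      using Suc.IH by simp
    also have "\<dots> = sm I A (1 + real (Suc n)) (orthant I) z"
      by (rule sm_sm[OF fin _ _ orthant_local_on[OF fin] orthant_bounds(2)]) auto
    finally show "(sm I A 1 ^^ Suc (Suc n)) (orthant I) z = sm I A (real (Suc (Suc n))) (orthant I) z"
      by (simp add: add_ac)
  qed
qed

context factor
begin

theorem berry_esseen_orthant:
  assumes W: "white M X"
  shows "\<exists>D>0. \<forall>n\<ge>(1::nat). \<forall>t. \<bar>\<P>(y in PiM {..<n} (\<lambda>_. M). \<forall>k\<in>I. (\<Sum>i<n. X k (y i)) \<le> sqrt n * t k) - gauss_cdf I A t\<bar> \<le> D / sqrt n"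
proof -
  have M: "prob_space M" and X: "\<And>k. X k \<in> borel_measurable M" using W unfolding white_def by auto
  obtain D where D: "0 < D" "\<forall>n\<ge>(1::nat). \<forall>z. \<bar>(avg M X ^^ n) (orthant I) z - sm I A n (orthant I) z\<bar> \<le> D / sqrt n"
    using berry_esseen_avg[OF W] by (elim exE conjE) (rule that)
  show ?thesis
  proof (rule exI[of _ D], intro conjI allI impI D(1))
    fix n :: nat and t :: "nat \<Rightarrow> real" assume n: "1 \<le> n"
    then have "\<bar>(avg M X ^^ n) (orthant I) (\<lambda>k. sqrt n * t k) - sm I A n (orthant I) (\<lambda>k. sqrt n * t k)\<bar> \<le> D / sqrt n"
      using D(2) by simp
    moreover have "sm I A n (orthant I) (\<lambda>k. sqrt n * t k) = gauss_cdf I A t"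
      using n by (intro sm_orthant fin) auto
    ultimately show "\<bar>\<P>(y in PiM {..<n} (\<lambda>_. M). \<forall>k\<in>I. (\<Sum>i<n. X k (y i)) \<le> sqrt n * t k) - gauss_cdf I A t\<bar> \<le> D / sqrt n"
      unfolding avg_iterate_orthant[where X=X, OF fin M X] by simp
  qed
qed

text \<open>The Gaussian vectors \<open>A W\<close> and \<open>A' W\<close> have the same law if \<open>A A\<^sup>T = A' A'\<^sup>T\<close>: normalised sums of
  independent copies of \<open>A' W\<close> are again distributed like \<open>A' W\<close>, and they converge to \<open>A W\<close>.\<close>

lemma gauss_cdf_unique:
  assumes eq: "\<And>i j. i \<in> I \<Longrightarrow> j \<in> I \<Longrightarrow> (\<Sum>l\<in>I. A' i l * A' j l) = (\<Sum>l\<in>I. A i l * A j l)"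
  shows "gauss_cdf I A' t = gauss_cdf I A t"
proof -
  have W: "white (std_gauss I) (\<lambda>k w. sqrt 1 * lin I A' w k)"
    by (rule white_std_gauss[OF eq])
  obtain D where D: "0 < D" "\<forall>n\<ge>(1::nat). \<forall>z. \<bar>(sm I A' 1 ^^ n) (orthant I) z - sm I A n (orthant I) z\<bar> \<le> D / sqrt n"
    using berry_esseen_avg[OF W] unfolding sm_def[of I A' 1, symmetric] by (elim exE conjE) (rule that)
  have le: "\<bar>gauss_cdf I A' t - gauss_cdf I A t\<bar> \<le> D / sqrt (Suc n)" for n
  proof -
    let ?z = "\<lambda>k. sqrt (real (Suc n)) * t k"
    have "\<bar>(sm I A' 1 ^^ Suc n) (orthant I) ?z - sm I A (Suc n) (orthant I) ?z\<bar> \<le> D / sqrt (Suc n)"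
      using D(2) by (metis le_add1 plus_1_eq_Suc)
    then show ?thesis
      unfolding sm_one_iterate[OF fin] by (subst (asm) (1 2) sm_orthant[OF fin]) auto
  qed
  have "(\<lambda>n. D / sqrt (real (Suc n))) \<longlonglongrightarrow> 0"
    by (intro real_tendsto_divide_at_top[OF tendsto_const] filterlim_compose[OF sqrt_at_top]
      filterlim_compose[OF filterlim_real_sequentially filterlim_Suc])
  then have "\<bar>gauss_cdf I A' t - gauss_cdf I A t\<bar> \<le> 0"
    by (rule LIMSEQ_le_const) (use le in auto)
  then show ?thesis by simp
qed

end

section \<open>Cholesky factorisation of positive definite matrices\<close>

lemma sum_insert_if:
  fixes f g :: "nat \<Rightarrow> real"
  assumes "finite I" "k \<notin> I"
  shows "(\<Sum>l\<in>insert k I. (if l = k then a else f l) * (if l = k then b else g l)) = a * b + (\<Sum>l\<in>I. f l * g l)"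
proof -
  have "(\<Sum>l\<in>I. (if l = k then a else f l) * (if l = k then b else g l)) = (\<Sum>l\<in>I. f l * g l)"
    using assms by (intro sum.cong) auto
  then show ?thesis using assms by simp
qed

text \<open>The induction appends one row to the root and, at the same time, one row to its inverse.
  The square of the new diagonal entry is a Schur complement, positive because the quadratic form is
  positive at a suitable vector.\<close>

theorem cholesky:
  fixes V :: "nat \<Rightarrow> nat \<Rightarrow> real"
  assumes "finite I" and "\<And>i j. i \<in> I \<Longrightarrow> j \<in> I \<Longrightarrow> V i j = V j i"
    and "\<And>x. (\<exists>k\<in>I. x k \<noteq> 0) \<Longrightarrow> 0 < (\<Sum>j\<in>I. \<Sum>k\<in>I. x j * V j k * x k)"
  shows "\<exists>A B. factor I A B \<and> (\<forall>i\<in>I. \<forall>j\<in>I. (\<Sum>l\<in>I. A i l * A j l) = V i j)"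
  using assms
proof (induction I)
  case empty
  then show ?case by (auto simp: factor_def)
next
  case (insert k I)
  have kI: "\<And>l. l \<in> I \<Longrightarrow> l \<noteq> k" using insert.hyps by auto
  have pos: "0 < (\<Sum>j\<in>I. \<Sum>k\<in>I. x j * V j k * x k)" if "\<exists>k\<in>I. x k \<noteq> 0" for x
  proof -
    let ?x = "\<lambda>i. if i = k then 0 else x i"
    have "0 < (\<Sum>i\<in>insert k I. \<Sum>j\<in>insert k I. ?x i * V i j * ?x j)"
      using that kI by (intro insert.prems(2)) auto
    also have "\<dots> = (\<Sum>i\<in>I. \<Sum>j\<in>I. ?x i * V i j * ?x j)"
      using insert.hyps by simp
    also have "\<dots> = (\<Sum>i\<in>I. \<Sum>j\<in>I. x i * V i j * x j)"
      using kI by (intro sum.cong refl) auto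
    finally show ?thesis .
  qed
  have sym: "V i j = V j i" if "i \<in> insert k I" "j \<in> insert k I" for i j using insert.prems(1) that by blast
  obtain A B where F: "factor I A B" and AA: "\<And>i j. i \<in> I \<Longrightarrow> j \<in> I \<Longrightarrow> (\<Sum>l\<in>I. A i l * A j l) = V i j"
    using insert.IH[OF _ pos] sym by blast
  interpret factor I A B by (rule F)
  \<comment> \<open>\<open>c\<close> solves A c = V(., k) and becomes the new row of the root. The
    vector \<open>u\<close> below is V^(-1) V(., k), the coefficients of the best linear prediction
    of component \<open>k\<close> from those in \<open>I\<close>.\<close>
  define c where "c = lin I B (\<lambda>i. V i k)"
  define u where "u i = (\<Sum>p\<in>I. c p * B p i)" for i
  have Ac: "(\<Sum>l\<in>I. A i l * c l) = V i k" if "i \<in> I" for i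
    using lin_A_B[OF that, of "\<lambda>i. V i k"] unfolding c_def lin_def[of I A] .
  have uA: "(\<Sum>i\<in>I. u i * A i p) = c p" if p: "p \<in> I" for p
  proof -
    have "(\<Sum>i\<in>I. u i * A i p) = (\<Sum>i\<in>I. \<Sum>q\<in>I. c q * (B q i * A i p))"
      unfolding u_def by (simp add: sum_distrib_right mult.assoc)
    also have "\<dots> = (\<Sum>q\<in>I. c q * (\<Sum>i\<in>I. B q i * A i p))"
      by (subst sum.swap) (simp add: sum_distrib_left)
    also have "\<dots> = (\<Sum>q\<in>I. if q = p then c q else 0)"
      by (intro sum.cong refl) (simp add: BA p)
    also have "\<dots> = c p" using fin p by (simp add: sum.delta')
    finally show ?thesis .
  qed
  have uV: "(\<Sum>i\<in>I. u i * V i k) = (\<Sum>p\<in>I. c p * c p)"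
  proof -
    have "(\<Sum>i\<in>I. u i * V i k) = (\<Sum>i\<in>I. \<Sum>p\<in>I. u i * A i p * c p)"
      by (intro sum.cong refl) (simp add: Ac[symmetric] sum_distrib_left mult.assoc)
    also have "\<dots> = (\<Sum>p\<in>I. (\<Sum>i\<in>I. u i * A i p) * c p)"
      by (subst sum.swap) (simp add: sum_distrib_right)
    also have "\<dots> = (\<Sum>p\<in>I. c p * c p)" by (intro sum.cong refl) (simp add: uA)
    finally show ?thesis .
  qed
  have uVu: "(\<Sum>i\<in>I. \<Sum>j\<in>I. u i * V i j * u j) = (\<Sum>p\<in>I. c p * c p)"
  proof -
    have "(\<Sum>i\<in>I. \<Sum>j\<in>I. u i * V i j * u j) = (\<Sum>i\<in>I. \<Sum>j\<in>I. \<Sum>p\<in>I. (u i * A i p) * (u j * A j p))"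
      by (intro sum.cong refl) (simp add: AA[symmetric] sum_distrib_left sum_distrib_right mult_ac)
    also have "\<dots> = (\<Sum>p\<in>I. \<Sum>i\<in>I. \<Sum>j\<in>I. (u i * A i p) * (u j * A j p))"
      by (subst (2) sum.swap, subst sum.swap) (rule refl)
    also have "\<dots> = (\<Sum>p\<in>I. (\<Sum>i\<in>I. u i * A i p) * (\<Sum>j\<in>I. u j * A j p))"
      unfolding sum_product ..
    also have "\<dots> = (\<Sum>p\<in>I. c p * c p)" by (intro sum.cong refl) (simp add: uA)
    finally show ?thesis .
  qed
  \<comment> \<open>The Schur complement. It is the value of the quadratic form at the vector with
    entry 1 at \<open>k\<close> and \<open>- u\<close> on \<open>I\<close>, which gives its
    positivity.\<close>
  define d2 where "d2 = V k k - (\<Sum>p\<in>I. c p * c p)"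
  have "0 < d2"
  proof -
    let ?x = "\<lambda>i. if i = k then 1 else - u i"
    have "0 < (\<Sum>i\<in>insert k I. \<Sum>j\<in>insert k I. ?x i * V i j * ?x j)"
      by (intro insert.prems(2)) auto
    also have "\<dots> = V k k + (\<Sum>j\<in>I. V k j * ?x j) + (\<Sum>i\<in>I. ?x i * V i k + (\<Sum>j\<in>I. ?x i * V i j * ?x j))"
      using insert.hyps by simp
    also have "(\<Sum>j\<in>I. V k j * ?x j) = - (\<Sum>i\<in>I. u i * V i k)"
      unfolding sum_negf[symmetric] using kI sym by (intro sum.cong refl) auto
    also have "(\<Sum>i\<in>I. ?x i * V i k + (\<Sum>j\<in>I. ?x i * V i j * ?x j)) =
      - (\<Sum>i\<in>I. u i * V i k) + (\<Sum>i\<in>I. \<Sum>j\<in>I. u i * V i j * u j)"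
      unfolding sum_negf[symmetric] sum.distrib[symmetric] using kI by (intro sum.cong arg_cong2[of _ _ _ _ "(+)"] refl) auto
    finally show ?thesis unfolding d2_def uV uVu by simp
  qed
  define d where "d = sqrt d2"
  have d: "0 < d" "d * d = d2" unfolding d_def using \<open>0 < d2\<close> by auto
  define A' where "A' i l = (if l = k then (if i = k then d else 0) else (if i = k then c l else A i l))" for i l
  define B' where "B' i l = (if l = k then (if i = k then 1 / d else 0) else (if i = k then - u l / d else B i l))" for i l
  \<comment> \<open>The same two matrices with the case distinctions nested the other way, so that
    \<open>sum_insert_if\<close> also matches when the summation index is the row index.\<close>
  define A'' where "A'' i l = (if i = k then (if l = k then d else c l) else (if l = k then 0 else A i l))" for i l
  define B'' where "B'' i l = (if i = k then (if l = k then 1 / d else - u l / d) else (if l = k then 0 else B i l))" for i l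
  have A'': "A' = A''" and B'': "B' = B''" unfolding A'_def A''_def B'_def B''_def by (auto simp: fun_eq_iff)
  note si = sum_insert_if[OF insert.hyps]
  have "factor (insert k I) A' B'"
  proof
    show "finite (insert k I)" using insert.hyps by simp
    fix i j assume i: "i \<in> insert k I" and j: "j \<in> insert k I"
    have "(\<Sum>l\<in>insert k I. A' i l * B' l j) = (\<Sum>l\<in>insert k I. (if l = k then (if i = k then d else 0) else (if i = k then c l else A i l)) *
        (if l = k then (if j = k then 1 / d else - u j / d) else (if j = k then 0 else B l j)))"
      unfolding A'_def B'' B''_def ..
    also have "\<dots> = (if i = k then d else 0) * (if j = k then 1 / d else - u j / d) + (\<Sum>l\<in>I. (if i = k then c l else A i l) * (if j = k then 0 else B l j))"
      by (rule si)
    also have "\<dots> = (if i = j then 1 else 0)"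
      using i j d kI AB by (auto simp: u_def)
    finally show "(\<Sum>l\<in>insert k I. A' i l * B' l j) = (if i = j then 1 else 0)" .
    have "(\<Sum>l\<in>insert k I. B' i l * A' l j) = (\<Sum>l\<in>insert k I. (if l = k then (if i = k then 1 / d else 0) else (if i = k then - u l / d else B i l)) *
        (if l = k then (if j = k then d else c j) else (if j = k then 0 else A l j)))"
      unfolding B'_def A'' A''_def ..
    also have "\<dots> = (if i = k then 1 / d else 0) * (if j = k then d else c j) + (\<Sum>l\<in>I. (if i = k then - u l / d else B i l) * (if j = k then 0 else A l j))"
      by (rule si)
    also have "\<dots> = (if i = j then 1 else 0)"
    proof -
      have "(\<Sum>l\<in>I. - u l / d * A l j) = - (\<Sum>l\<in>I. u l * A l j) / d"
        by (simp add: sum_negf sum_divide_distrib)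
      then show ?thesis using i j d kI BA uA by auto
    qed
    finally show "(\<Sum>l\<in>insert k I. B' i l * A' l j) = (if i = j then 1 else 0)" .
  qed
  moreover have "(\<Sum>l\<in>insert k I. A' i l * A' j l) = V i j" if i: "i \<in> insert k I" and j: "j \<in> insert k I" for i j
  proof -
    have "(\<Sum>l\<in>insert k I. A' i l * A' j l) = (if i = k then d else 0) * (if j = k then d else 0) +
      (\<Sum>l\<in>I. (if i = k then c l else A i l) * (if j = k then c l else A j l))"
      unfolding A'_def by (rule si)
    also have "\<dots> = V i j"
    proof -
      have "(\<Sum>l\<in>I. c l * A j l) = V k j" if "j \<in> I" for j
        using Ac[OF that] sym[of j k] that by (simp add: mult.commute)
      then show ?thesis using i j d AA Ac kI by (auto simp: d2_def)
    qed
    finally show ?thesis .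
  qed
  ultimately show ?case by blast
qed

section \<open>Gaussian orthant probabilities\<close>

context factor
begin

text \<open>\<open>gauss_orthant\<close> speaks of every root of \<open>V\<close>. By
  \<open>gauss_cdf_unique\<close> the probability is the same for all of them, so the one root at
  hand decides.\<close>

lemma gauss_orthant_iff:
  assumes V: "\<And>i j. i \<in> I \<Longrightarrow> j \<in> I \<Longrightarrow> (\<Sum>l\<in>I. A i l * A j l) = V i j"
  shows "gauss_orthant I V b p \<longleftrightarrow> gauss_cdf I A (\<lambda>_. b) = p"
proof
  assume "gauss_orthant I V b p"
  then show "gauss_cdf I A (\<lambda>_. b) = p"
    unfolding gauss_orthant_def gauss_cdf_def lin_def using V by blast
next
  assume p: "gauss_cdf I A (\<lambda>_. b) = p"
  show "gauss_orthant I V b p"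
    unfolding gauss_orthant_def
  proof (intro allI impI)
    fix A' assume "\<forall>i\<in>I. \<forall>j\<in>I. (\<Sum>l\<in>I. A' i l * A' j l) = V i j"
    then have "gauss_cdf I A' (\<lambda>_. b) = gauss_cdf I A (\<lambda>_. b)"
      using V by (intro gauss_cdf_unique) auto
    then show "\<P>(w in std_gauss I. \<forall>i\<in>I. (\<Sum>l\<in>I. A' i l * w l) \<le> b) = p"
      unfolding gauss_cdf_def lin_def p[symmetric] .
  qed
qed

section \<open>Variation along the diagonal direction\<close>

lemma gauss_cdf_mono:
  assumes "\<And>k. k \<in> I \<Longrightarrow> s k \<le> t k"
  shows "gauss_cdf I A s \<le> gauss_cdf I A t"
proof -
  interpret prob_space "std_gauss I" by (rule prob_space_std_gauss)
  show ?thesis unfolding gauss_cdf_def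
    by (rule finite_measure_mono) (use assms fin in \<open>auto intro: order_trans\<close>)
qed

lemma gauss_cdf_lipschitz:
  "\<exists>C>0. \<forall>t h. 0 \<le> h \<longrightarrow> gauss_cdf I A (\<lambda>k. t k + h) - gauss_cdf I A t \<le> C * h"
proof -
  obtain C where C: "0 < C" "\<forall>h v z t. local_on I h \<longrightarrow> (\<forall>z. \<bar>h z\<bar> \<le> 1) \<longrightarrow> 0 < v \<longrightarrow> 0 \<le> t \<longrightarrow>
    \<bar>sm I A v h (\<lambda>k. z k + t) - sm I A v h z\<bar> \<le> C * t / sqrt v"
    using sm_first_order by (elim exE conjE) (rule that)
  have cdf: "sm I A 1 (orthant I) t = gauss_cdf I A t" for t
    using sm_orthant[OF fin, of 1 A t] by simp
  show ?thesis
  proof (rule exI[of _ C], intro conjI allI impI C(1))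
    fix t :: "nat \<Rightarrow> real" and h :: real assume "0 \<le> h"
    then show "gauss_cdf I A (\<lambda>k. t k + h) - gauss_cdf I A t \<le> C * h"
      using C(2)[THEN spec[of _ "orthant I"], THEN spec[of _ 1], THEN spec[of _ t], THEN spec[of _ h]]
        orthant_local_on[OF fin] orthant_bounds(2) unfolding cdf by auto
  qed
qed

text \<open>Markov's inequality for the sum of the absolute components. The decay
  \<open>C / b\<close> is enough both for the existence of quantiles and for the remaining
  alternatives, where \<open>b\<close> is of order \<open>sqrt n\<close>. The lower tail needs at
  least one component.\<close>

lemma gauss_cdf_tails:
  assumes ne: "I \<noteq> {}"
  shows "\<exists>C>0. \<forall>b>0. 1 - gauss_cdf I A (\<lambda>_. b) \<le> C / b \<and> gauss_cdf I A (\<lambda>_. - b) \<le> C / b"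
proof -
  interpret G: prob_space "std_gauss I" by (rule prob_space_std_gauss)
  define T where "T w = (\<Sum>k\<in>I. \<bar>lin I A w k\<bar>)" for w
  have [measurable]: "T \<in> borel_measurable (std_gauss I)" unfolding T_def by measurable
  have iT: "integrable (std_gauss I) T"
    unfolding T_def lin_def using fin by (intro Bochner_Integration.integrable_sum integrable_abs integrable_std_gauss_quadratic)
  have T0: "0 \<le> T w" for w unfolding T_def by (intro sum_nonneg) auto
  have Tk: "\<bar>lin I A w k\<bar> \<le> T w" if "k \<in> I" for w k
    unfolding T_def using that fin by (intro member_le_sum[where f="\<lambda>k. \<bar>lin I A w k\<bar>"]) auto
  define E where "E = (\<integral>w. T w \<partial>std_gauss I) + 1"
  have E: "0 < E" unfolding E_def using T0 by (simp add: add_nonneg_pos)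
  have markov: "\<P>(w in std_gauss I. b \<le> T w) \<le> E / b" if b: "0 < b" for b
  proof -
    have "\<P>(w in std_gauss I. b \<le> T w) \<le> (\<integral>w. T w \<partial>std_gauss I) / b"
      using integral_Markov_inequality_measure[OF iT, of "{}" b] b T0 by simp
    also have "\<dots> \<le> E / b" using b unfolding E_def by (intro divide_right_mono) auto
    finally show ?thesis .
  qed
  show ?thesis
  proof (rule exI[of _ E], intro conjI allI impI E)
    fix b :: real assume b: "0 < b"
    let ?S = "{w \<in> space (std_gauss I). \<forall>k\<in>I. lin I A w k \<le> b}"
    have [measurable]: "?S \<in> sets (std_gauss I)" using fin by measurable
    have "1 - gauss_cdf I A (\<lambda>_. b) = measure (std_gauss I) (space (std_gauss I) - ?S)"
      unfolding gauss_cdf_def by (subst G.prob_compl) auto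
    also have "\<dots> \<le> \<P>(w in std_gauss I. b \<le> T w)"
    proof (rule G.finite_measure_mono)
      show "space (std_gauss I) - ?S \<subseteq> {w \<in> space (std_gauss I). b \<le> T w}"
      proof safe
        fix w k assume "k \<in> I" "\<not> lin I A w k \<le> b"
        then show "b \<le> T w" using Tk[of k w] by linarith
      qed
    qed simp
    also note markov[OF b]
    finally show "1 - gauss_cdf I A (\<lambda>_. b) \<le> E / b" .
    obtain k where k: "k \<in> I" using ne by auto
    have "gauss_cdf I A (\<lambda>_. - b) \<le> \<P>(w in std_gauss I. b \<le> T w)"
      unfolding gauss_cdf_def
    proof (rule G.finite_measure_mono)
      show "{w \<in> space (std_gauss I). \<forall>k\<in>I. lin I A w k \<le> - b} \<subseteq> {w \<in> space (std_gauss I). b \<le> T w}"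
      proof safe
        fix w assume "\<forall>k\<in>I. lin I A w k \<le> - b"
        then have "lin I A w k \<le> - b" using k by blast
        then show "b \<le> T w" using Tk[OF k, of w] by linarith
      qed
    qed simp
    also note markov[OF b]
    finally show "gauss_cdf I A (\<lambda>_. - b) \<le> E / b" .
  qed
qed

text \<open>For \<open>h \<ge> 0\<close> and nonempty \<open>I\<close>, the indicator that the
  largest component of A w lies in the half-open interval from \<open>s\<close> (excluded) to
  \<open>s + h\<close> (included).\<close>

definition cdf_inc :: "real \<Rightarrow> real \<Rightarrow> (nat \<Rightarrow> real) \<Rightarrow> real" where
  "cdf_inc s h w = orthant I (\<lambda>k. s + h - lin I A w k) - orthant I (\<lambda>k. s - lin I A w k)"

lemma cdf_inc_measurable [measurable]: "cdf_inc s h \<in> borel_measurable (std_gauss I)"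
  unfolding cdf_inc_def
  by (intro borel_measurable_diff local_on_measurable_comp[OF orthant_local_on[OF fin]]) measurable

lemma cdf_inc_bounds: "0 \<le> h \<Longrightarrow> 0 \<le> cdf_inc s h w" "0 \<le> h \<Longrightarrow> cdf_inc s h w \<le> 1"
proof -
  assume "0 \<le> h"
  then have "orthant I (\<lambda>k. s - lin I A w k) \<le> orthant I (\<lambda>k. s + h - lin I A w k)" by (intro orthant_mono) auto
  then show "0 \<le> cdf_inc s h w" unfolding cdf_inc_def by simp
  show "cdf_inc s h w \<le> 1" unfolding cdf_inc_def orthant_def by auto
qed

lemma cdf_inc_integral:
  assumes h: "0 \<le> h"
  shows "(\<integral>w. cdf_inc s h w \<partial>std_gauss I) = gauss_cdf I A (\<lambda>_. s + h) - gauss_cdf I A (\<lambda>_. s)"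
proof -
  have cdf: "(\<integral>w. orthant I (\<lambda>k. t - lin I A w k) \<partial>std_gauss I) = gauss_cdf I A (\<lambda>_. t)" for t
    using sm_orthant[OF fin, of 1 A "\<lambda>_. t"] unfolding sm_def avg_def by simp
  have i: "integrable (std_gauss I) (\<lambda>w. orthant I (\<lambda>k. t - lin I A w k))" for t
    using sm_integrable[OF orthant_local_on[OF fin] orthant_bounds(2), of "\<lambda>_. t" 1 A] by simp
  show ?thesis unfolding cdf_inc_def using i by (simp add: cdf)
qed

text \<open>A Gaussian shift by \<open>\<tau>\<close> times \<open>lin I B (\<lambda>_. 1)\<close>
  adds \<open>\<tau>\<close> to every component of A w. Increments at \<open>s\<close> and at
  \<open>s + \<tau>\<close> therefore differ only by a Cameron--Martin weight.\<close>

lemma cdf_inc_shift: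
  assumes h: "0 \<le> h"
  defines "x \<equiv> lin I B (\<lambda>_. 1)"
  shows "gauss_cdf I A (\<lambda>_. s + h) - gauss_cdf I A (\<lambda>_. s) =
    (\<integral>w. tilt I (\<lambda>l. \<tau> * x l) w * cdf_inc (s + \<tau>) h w \<partial>std_gauss I)"
proof -
  have "(\<integral>w. tilt I (\<lambda>l. \<tau> * x l) w * cdf_inc (s + \<tau>) h w \<partial>std_gauss I) =
    (\<integral>w. cdf_inc (s + \<tau>) h (\<lambda>l\<in>I. w l + \<tau> * x l) \<partial>std_gauss I)"
    unfolding tilt_def by (rule integral_std_gauss_shift[OF fin cdf_inc_measurable, symmetric])
  also have "\<dots> = (\<integral>w. cdf_inc s h w \<partial>std_gauss I)"
  proof (intro Bochner_Integration.integral_cong refl)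
    fix w
    have e: "lin I A (\<lambda>l\<in>I. w l + \<tau> * x l) k = lin I A w k + \<tau>" if "k \<in> I" for k
      unfolding lin_add lin_scale x_def using lin_A_B[OF that] by simp
    have "orthant I (\<lambda>k. c + \<tau> - lin I A (\<lambda>l\<in>I. w l + \<tau> * x l) k) = orthant I (\<lambda>k. c - lin I A w k)" for c
      by (rule local_onD[OF orthant_local_on[OF fin]]) (simp add: e)
    from this[of s] this[of "s + h"]
    show "cdf_inc (s + \<tau>) h (\<lambda>l\<in>I. w l + \<tau> * x l) = cdf_inc s h w"
      unfolding cdf_inc_def by (simp add: add_ac)
  qed
  finally show ?thesis using cdf_inc_integral[OF h] by simp
qed

text \<open>If one unit increment vanished, its indicator would be almost surely 0, and by the shift
  identity all unit increments would vanish. The function would then agree at -n and n for every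
  natural n, which contradicts the tails.\<close>

lemma gauss_cdf_strict_unit:
  assumes ne: "I \<noteq> {}"
  shows "gauss_cdf I A (\<lambda>_. b) < gauss_cdf I A (\<lambda>_. b + 1)"
proof (rule ccontr)
  interpret G: prob_space "std_gauss I" by (rule prob_space_std_gauss)
  let ?G = "\<lambda>b. gauss_cdf I A (\<lambda>_. b)"
  have mono: "?G s \<le> ?G t" if "s \<le> t" for s t using that by (intro gauss_cdf_mono)
  assume "\<not> ?G b < ?G (b + 1)"
  then have "?G (b + 1) - ?G b = 0" using mono[of b "b + 1"] by simp
  then have z: "(\<integral>w. cdf_inc b 1 w \<partial>std_gauss I) = 0" using cdf_inc_integral[of 1 b] by simp
  have "integrable (std_gauss I) (cdf_inc b 1)"
    by (rule G.integrable_const_bound[where B=1]) (auto simp: cdf_inc_bounds abs_of_nonneg)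
  then have ae: "AE w in std_gauss I. cdf_inc b 1 w = 0"
    using z by (subst (asm) integral_nonneg_eq_0_iff_AE) (auto simp: cdf_inc_bounds)
  have step: "?G (s + 1) = ?G s" for s
  proof -
    have "?G (s + 1) - ?G s = (\<integral>w. tilt I (\<lambda>l. (b - s) * lin I B (\<lambda>_. 1) l) w * cdf_inc b 1 w \<partial>std_gauss I)"
      using cdf_inc_shift[of 1 s "b - s"] by simp
    also have "\<dots> = (\<integral>w. 0 \<partial>std_gauss I)"
    proof (rule integral_cong_AE)
      show "(\<lambda>w. tilt I (\<lambda>l. (b - s) * lin I B (\<lambda>_. 1) l) w * cdf_inc b 1 w) \<in> borel_measurable (std_gauss I)"
        unfolding tilt_def by measurable
      show "AE w in std_gauss I. tilt I (\<lambda>l. (b - s) * lin I B (\<lambda>_. 1) l) w * cdf_inc b 1 w = 0"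
        using ae by eventually_elim simp
    qed simp
    finally show ?thesis by simp
  qed
  have const: "?G (real n) = ?G (- real n)" for n :: nat
  proof -
    have "?G (- real n + real m) = ?G (- real n)" for m :: nat
    proof (induction m)
      case (Suc m)
      have "?G (- real n + real (Suc m)) = ?G ((- real n + real m) + 1)" by (simp add: add_ac)
      then show ?case using step Suc.IH by simp
    qed simp
    from this[of "2 * n"] show ?thesis by simp
  qed
  obtain C where C: "0 < C" "\<forall>b>0. 1 - ?G b \<le> C / b \<and> ?G (- b) \<le> C / b"
    using gauss_cdf_tails[OF ne] by (elim exE conjE) (rule that)
  obtain n :: nat where n: "2 * C + 1 < n" using reals_Archimedean2 by blast
  then have n0: "0 < real n" using C(1) by linarith
  have "1 - ?G (real n) \<le> C / n" "?G (- real n) \<le> C / n" using C(2) n0 by blast+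
  then have "1 \<le> C / n + C / n" using const[of n] by linarith
  then have "n \<le> 2 * C" using n0 by (simp add: field_simps)
  then show False using n by simp
qed

text \<open>A lower bound on the slope without any density of the maximum. The interval from
  \<open>b\<close> to \<open>b + 1\<close> is cut into \<open>N\<close> pieces of length
  \<open>1 / N\<close>; each is a bounded translate of the interval at \<open>s\<close>, so up to a
  constant its truncated mass is at most the increment at \<open>s\<close>. Adding up,
  \<open>N\<close> times that increment is bounded below.\<close>

lemma gauss_cdf_increment:
  assumes ne: "I \<noteq> {}"
  shows "\<exists>c>0. \<forall>s h. \<bar>s - b\<bar> \<le> 1 \<longrightarrow> 0 \<le> h \<longrightarrow> h \<le> 1 \<longrightarrow>
    c * h \<le> gauss_cdf I A (\<lambda>_. s + h) - gauss_cdf I A (\<lambda>_. s)"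
proof -
  interpret G: prob_space "std_gauss I" by (rule prob_space_std_gauss)
  let ?G = "\<lambda>b. gauss_cdf I A (\<lambda>_. b)"
  have mono: "?G s \<le> ?G t" if "s \<le> t" for s t using that by (intro gauss_cdf_mono)
  define x where "x = lin I B (\<lambda>_. 1)"
  define q where "q = (\<Sum>l\<in>I. (x l)\<^sup>2)"
  have q: "0 \<le> q" unfolding q_def by (intro sum_nonneg) auto
  define Y where "Y w = \<bar>\<Sum>l\<in>I. x l * w l\<bar>" for w
  have Y[measurable]: "Y \<in> borel_measurable (std_gauss I)" unfolding Y_def by measurable
  have iY: "integrable (std_gauss I) Y"
    unfolding Y_def by (intro integrable_abs integrable_std_gauss_quadratic fin)
  \<comment> \<open>Half of the mass of the unit interval. The other half is sacrificed to the
    truncation at \<open>\<rho>\<close>, which is chosen by Markov's inequality so that the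
    discarded event has probability at most \<open>\<eta>\<close>.\<close>
  define \<eta> where "\<eta> = (?G (b + 1) - ?G b) / 2"
  have \<eta>: "0 < \<eta>" unfolding \<eta>_def using gauss_cdf_strict_unit[OF ne, of b] by simp
  define \<rho> where "\<rho> = (\<integral>w. Y w \<partial>std_gauss I) / \<eta> + 1"
  have EY: "0 \<le> (\<integral>w. Y w \<partial>std_gauss I)" unfolding Y_def by simp
  have \<rho>: "0 < \<rho>" unfolding \<rho>_def using \<eta> EY by (intro add_nonneg_pos divide_nonneg_pos) auto
  let ?E = "{w \<in> space (std_gauss I). \<rho> \<le> Y w}"
  have E[measurable]: "?E \<in> sets (std_gauss I)" by measurable
  have PE: "measure (std_gauss I) ?E \<le> \<eta>"
  proof -
    have "measure (std_gauss I) ?E \<le> (\<integral>w. Y w \<partial>std_gauss I) / \<rho>"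
      using integral_Markov_inequality_measure[OF iY, of "{}" \<rho>] \<rho> by (simp add: Y_def)
    also have "\<dots> \<le> \<eta>" using \<eta> \<rho> EY unfolding \<rho>_def by (simp add: field_simps)
    finally show ?thesis .
  qed
  \<comment> \<open>A lower bound for the Cameron--Martin weight of shifts with
    \<open>\<bar>\<tau>\<bar> \<le> 2\<close> where \<open>Y w < \<rho>\<close>: the linear term is
    at least \<open>- 2 * \<rho>\<close> and the quadratic one at most \<open>2 * q\<close>. No
    positive lower bound would hold on the whole space in general, which is the reason for the
    truncation.\<close>
  define \<kappa> where "\<kappa> = exp (- 2 * \<rho> - 2 * q)"
  have \<kappa>: "0 < \<kappa>" unfolding \<kappa>_def by simp
  have iI: "integrable (std_gauss I) (cdf_inc s h)" if "0 \<le> h" for s h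
    using that by (intro G.integrable_const_bound[where B=1]) (auto simp: cdf_inc_bounds abs_of_nonneg)
  define g where "g s h w = (if \<rho> \<le> Y w then 0 else cdf_inc s h w)" for s h w
  have gm[measurable]: "g s h \<in> borel_measurable (std_gauss I)" for s h unfolding g_def by measurable
  have ig: "integrable (std_gauss I) (g s h)" if "0 \<le> h" for s h
    using that by (intro G.integrable_const_bound[where B=1]) (auto simp: g_def cdf_inc_bounds abs_of_nonneg)
  have tile: "\<kappa> * (\<integral>w. g (s + \<tau>) h w \<partial>std_gauss I) \<le> ?G (s + h) - ?G s" if "\<bar>\<tau>\<bar> \<le> 2" "0 \<le> h" for s \<tau> h
  proof -
    have it: "integrable (std_gauss I) (\<lambda>w. tilt I (\<lambda>l. \<tau> * x l) w * cdf_inc (s + \<tau>) h w)"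
    proof (rule Bochner_Integration.integrable_bound[OF integrable_tilt(1)[OF fin, of "\<lambda>l. \<tau> * x l"]])
      show "(\<lambda>w. tilt I (\<lambda>l. \<tau> * x l) w * cdf_inc (s + \<tau>) h w) \<in> borel_measurable (std_gauss I)"
        unfolding tilt_def by measurable
      show "AE w in std_gauss I. norm (tilt I (\<lambda>l. \<tau> * x l) w * cdf_inc (s + \<tau>) h w) \<le> norm (tilt I (\<lambda>l. \<tau> * x l) w)"
        using cdf_inc_bounds[OF that(2)] by (intro AE_I2) (simp add: abs_mult abs_of_nonneg mult_left_le tilt_def)
    qed
    have "\<kappa> * (\<integral>w. g (s + \<tau>) h w \<partial>std_gauss I) = (\<integral>w. \<kappa> * g (s + \<tau>) h w \<partial>std_gauss I)" by simp
    also have "\<dots> \<le> (\<integral>w. tilt I (\<lambda>l. \<tau> * x l) w * cdf_inc (s + \<tau>) h w \<partial>std_gauss I)"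
    proof (rule integral_mono[OF _ it])
      show "integrable (std_gauss I) (\<lambda>w. \<kappa> * g (s + \<tau>) h w)" using ig[OF that(2)] by simp
      fix w
      show "\<kappa> * g (s + \<tau>) h w \<le> tilt I (\<lambda>l. \<tau> * x l) w * cdf_inc (s + \<tau>) h w"
      proof (cases "\<rho> \<le> Y w")
        case True
        then show ?thesis using cdf_inc_bounds(1)[OF that(2)] by (simp add: g_def tilt_def)
      next
        case False
        have "\<bar>\<Sum>l\<in>I. \<tau> * x l * w l\<bar> = \<bar>\<tau>\<bar> * Y w"
          unfolding Y_def by (simp add: mult.assoc sum_distrib_left[symmetric] abs_mult)
        also have "\<dots> \<le> 2 * \<rho>" using that(1) False by (intro mult_mono) (auto simp: Y_def)
        finally have 1: "- 2 * \<rho> \<le> (\<Sum>l\<in>I. \<tau> * x l * w l)" by linarith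
        have "(\<Sum>l\<in>I. (\<tau> * x l)\<^sup>2) = \<bar>\<tau>\<bar>\<^sup>2 * q"
          unfolding q_def by (simp add: power_mult_distrib sum_distrib_left)
        also have "\<dots> \<le> 2\<^sup>2 * q" using that(1) q by (intro mult_right_mono power_mono) auto
        finally have 2: "(\<Sum>l\<in>I. (\<tau> * x l)\<^sup>2) / 2 \<le> 2 * q" by simp
        have "\<kappa> \<le> tilt I (\<lambda>l. \<tau> * x l) w" unfolding \<kappa>_def tilt_def using 1 2 by simp
        then show ?thesis using False cdf_inc_bounds(1)[OF that(2)] by (simp add: g_def mult_right_mono)
      qed
    qed
    also have "\<dots> = ?G (s + h) - ?G s" unfolding x_def by (rule cdf_inc_shift[OF that(2), symmetric])
    finally show ?thesis .
  qed
  \<comment> \<open>The translations used are \<open>b - s + j / N\<close>, of absolute value at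
    most 2. The truncation event does not depend on the piece, so the truncated pieces add up to the
    truncated unit increment.\<close>
  have grid: "\<kappa> * \<eta> \<le> N * (?G (s + 1 / N) - ?G s)" if s: "\<bar>s - b\<bar> \<le> 1" and N: "1 \<le> N" for s and N :: nat
  proof -
    have N0: "0 < real N" using N by simp
    have split: "(\<Sum>j<N. cdf_inc (b + j / N) (1 / N) w) = cdf_inc b 1 w" for w
    proof -
      let ?o = "\<lambda>j::nat. orthant I (\<lambda>k. b + j / N - lin I A w k)"
      have "(\<Sum>j<N. cdf_inc (b + j / N) (1 / N) w) = (\<Sum>j<N. ?o (Suc j) - ?o j)"
        unfolding cdf_inc_def by (intro sum.cong refl) (simp add: add_divide_distrib add_ac)
      also have "\<dots> = ?o N - ?o 0" by (rule sum_lessThan_telescope)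
      finally show ?thesis unfolding cdf_inc_def using N0 by simp
    qed
    have "\<kappa> * \<eta> \<le> \<kappa> * (\<integral>w. g b 1 w \<partial>std_gauss I)"
    proof (rule mult_left_mono)
      have "2 * \<eta> = (\<integral>w. cdf_inc b 1 w \<partial>std_gauss I)" unfolding \<eta>_def using cdf_inc_integral[of 1 b] by simp
      also have "\<dots> \<le> (\<integral>w. g b 1 w + indicator ?E w \<partial>std_gauss I)"
      proof (intro integral_mono Bochner_Integration.integrable_add integrable_real_indicator iI ig)
        show "cdf_inc b 1 w \<le> g b 1 w + indicator ?E w" if "w \<in> space (std_gauss I)" for w
          using cdf_inc_bounds(2)[of 1 b w] that by (simp add: g_def indicator_def)
      qed (simp_all add: G.emeasure_eq_measure)
      also have "\<dots> = (\<integral>w. g b 1 w \<partial>std_gauss I) + measure (std_gauss I) ?E"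
        using ig[of 1 b] by (subst Bochner_Integration.integral_add)
          (auto simp: G.emeasure_eq_measure Int_absorb2 intro!: integrable_real_indicator)
      finally show "\<eta> \<le> (\<integral>w. g b 1 w \<partial>std_gauss I)" using PE by simp
    qed (use \<kappa> in simp)
    also have "(\<integral>w. g b 1 w \<partial>std_gauss I) = (\<integral>w. (\<Sum>j<N. g (b + j / N) (1 / N) w) \<partial>std_gauss I)"
      by (intro Bochner_Integration.integral_cong refl) (simp add: g_def split)
    also have "\<dots> = (\<Sum>j<N. \<integral>w. g (b + j / N) (1 / N) w \<partial>std_gauss I)"
      by (intro Bochner_Integration.integral_sum ig) simp
    also have "\<kappa> * \<dots> = (\<Sum>j<N. \<kappa> * (\<integral>w. g (s + (b - s + j / N)) (1 / N) w \<partial>std_gauss I))"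
      by (simp add: sum_distrib_left)
    also have "\<dots> \<le> (\<Sum>j<N. ?G (s + 1 / N) - ?G s)"
    proof (intro sum_mono tile)
      fix j assume "j \<in> {..<N}"
      then have "0 \<le> real j / N" "real j / N \<le> 1" using N0 by auto
      then show "\<bar>b - s + real j / N\<bar> \<le> 2" using s by linarith
    qed simp
    finally show ?thesis by simp
  qed
  show ?thesis
  proof (rule exI[of _ "\<kappa> * \<eta> / 2"], intro conjI allI impI)
    show "0 < \<kappa> * \<eta> / 2" using \<kappa> \<eta> by simp
    fix s h :: real assume s: "\<bar>s - b\<bar> \<le> 1" and h: "0 \<le> h" "h \<le> 1"
    show "\<kappa> * \<eta> / 2 * h \<le> ?G (s + h) - ?G s"
    proof (cases "h = 0")
      case False
      \<comment> \<open>The finest grid needed: \<open>1 / N \<le> h\<close>, while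
        \<open>N * h \<le> 2\<close> loses only a factor 2.\<close>
      define N where "N = nat \<lceil>1 / h\<rceil>"
      have h0: "0 < h" using False h by simp
      have N1: "1 / h \<le> real N" unfolding N_def by linarith
      have N2: "real N \<le> 1 / h + 1" unfolding N_def using h0 by simp
      have "1 \<le> 1 / h" using h0 h by simp
      then have N: "1 \<le> N" using N1 by linarith
      have N0: "0 < real N" using N by simp
      have hN: "real N * h \<le> 2" using N2 h0 h by (simp add: field_simps)
      have le: "1 / N \<le> h" using N1 h0 N0 by (simp add: field_simps)
      have "\<kappa> * \<eta> * (real N * h) \<le> \<kappa> * \<eta> * 2" using hN \<kappa> \<eta> by (intro mult_left_mono) auto
      also have "\<dots> \<le> N * (?G (s + 1 / N) - ?G s) * 2" using grid[OF s N] by simp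
      also have "\<dots> \<le> N * (?G (s + h) - ?G s) * 2" using mono[of "s + 1 / N" "s + h"] le N0 by simp
      finally have "N * (\<kappa> * \<eta> * h) \<le> N * ((?G (s + h) - ?G s) * 2)" by (simp only: mult_ac)
      then have "\<kappa> * \<eta> * h \<le> (?G (s + h) - ?G s) * 2" using N0 by (simp only: mult_le_cancel_left_pos)
      then show ?thesis by simp
    qed simp
  qed
qed

text \<open>The Lipschitz bound gives continuity and the tails put \<open>p\<close> between two
  values, so the intermediate value theorem applies. Uniqueness is strict monotonicity, a
  consequence of the linear lower bound on increments.\<close>

lemma gauss_cdf_ex1:
  assumes ne: "I \<noteq> {}" and p: "0 < p" "p < 1"
  shows "\<exists>!b. gauss_cdf I A (\<lambda>_. b) = p"
proof -
  let ?G = "\<lambda>b. gauss_cdf I A (\<lambda>_. b)"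
  have mono: "?G s \<le> ?G t" if "s \<le> t" for s t using that by (intro gauss_cdf_mono)
  have strict: "?G s < ?G t" if "s < t" for s t
  proof -
    obtain c where c: "0 < c" "\<forall>s' h. \<bar>s' - s\<bar> \<le> 1 \<longrightarrow> 0 \<le> h \<longrightarrow> h \<le> 1 \<longrightarrow> c * h \<le> ?G (s' + h) - ?G s'"
      using gauss_cdf_increment[OF ne, of s] by (elim exE conjE) (rule that)
    define h where "h = min 1 (t - s)"
    have h: "0 < h" "h \<le> 1" "s + h \<le> t" unfolding h_def using that by auto
    have "c * h \<le> ?G (s + h) - ?G s" using c(2) h by simp
    moreover have "0 < c * h" using c(1) h by simp
    ultimately show ?thesis using mono[OF h(3)] by linarith
  qed
  obtain L where L: "0 < L" "\<forall>t h. 0 \<le> h \<longrightarrow> gauss_cdf I A (\<lambda>k. t k + h) - gauss_cdf I A t \<le> L * h"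
    using gauss_cdf_lipschitz by (elim exE conjE) (rule that)
  have lip: "\<bar>?G t - ?G s\<bar> \<le> L * \<bar>t - s\<bar>" for s t
  proof -
    have *: "\<bar>?G t - ?G s\<bar> \<le> L * \<bar>t - s\<bar>" if "s \<le> t" for s t
      using L(2)[THEN spec[of _ "\<lambda>_. s"], THEN spec[of _ "t - s"]] mono[OF that] that by simp
    show ?thesis using *[of s t] *[of t s] by (cases "s \<le> t") (auto simp: abs_minus_commute)
  qed
  have cont: "isCont ?G x" for x
    unfolding isCont_def
  proof (rule LIM_zero_cancel, rule Lim_null_comparison)
    show "\<forall>\<^sub>F y in at x. norm (?G y - ?G x) \<le> L * \<bar>y - x\<bar>" using lip by simp
    show "((\<lambda>y. L * \<bar>y - x\<bar>) \<longlongrightarrow> 0) (at x)" by (auto intro!: tendsto_eq_intros)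
  qed
  obtain C where C: "0 < C" "\<forall>b>0. 1 - ?G b \<le> C / b \<and> ?G (- b) \<le> C / b"
    using gauss_cdf_tails[OF ne] by (elim exE conjE) (rule that)
  define b where "b = C / min p (1 - p)"
  have b: "0 < b" unfolding b_def using C(1) p by simp
  have Cb: "C / b = min p (1 - p)" unfolding b_def using C(1) p by simp
  have "?G (- b) \<le> p" "p \<le> ?G b" using C(2)[THEN spec[of _ b]] b Cb by auto
  then obtain x where "?G x = p"
    using IVT[of ?G "- b" p b] cont b by auto
  moreover have "y = x" if "?G y = p" for y
    using strict[of x y] strict[of y x] that \<open>?G x = p\<close> by (cases x y rule: linorder_cases) auto
  ultimately show ?thesis by blast
qed

end

section \<open>Testing by log-likelihood ratios\<close>

locale llr_testing =
  fixes P :: "nat \<Rightarrow> 'a measure" and K :: nat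
  assumes K_pos: "1 \<le> K"
    and prob: "\<And>k. k \<le> K \<Longrightarrow> prob_space (P k)"
    and common_space: "\<And>k. k \<le> K \<Longrightarrow> sets (P k) = sets (P 0)"
    and abs_cont: "\<And>k. k \<in> {1..K} \<Longrightarrow> absolutely_continuous (P k) (P 0)"
    and V_posdef: "\<And>x::nat \<Rightarrow> real. (\<exists>k\<in>{1..K}. x k \<noteq> 0) \<Longrightarrow>
                     0 < (\<Sum>j\<in>{1..K}. \<Sum>k\<in>{1..K}. x j * covV P j k * x k)"
    and KL_finite: "\<And>k. k \<in> {1..K} \<Longrightarrow> integrable (P 0) (llr0 P k)"
    and third_moment: "integrable (P 0)
                     (\<lambda>y. (sqrt (\<Sum>k\<in>{1..K}. (llr0 P k y - KLk P k)\<^sup>2)) ^ 3)"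
begin

abbreviation rn :: "nat \<Rightarrow> 'a \<Rightarrow> ennreal" where
  "rn k \<equiv> RN_deriv (P k) (P 0)"

lemma prob_space_prodP: "k \<le> K \<Longrightarrow> prob_space (prodP P k n)"
  unfolding prodP_def by (intro prob_space_PiM prob)

lemma sets_prodP: "k \<le> K \<Longrightarrow> sets (prodP P k n) = sets (prodP P 0 n)"
  unfolding prodP_def by (intro sets_PiM_cong common_space refl)

lemma space_prodP: "k \<le> K \<Longrightarrow> space (prodP P k n) = space (prodP P 0 n)"
  by (rule sets_eq_imp_space_eq[OF sets_prodP])

lemma RN_measurable:
  assumes "k \<in> {1..K}"
  shows "rn k \<in> borel_measurable (P 0)"
  using borel_measurable_RN_deriv[of "P k" "P 0"] common_space[of k] assms
  by (simp cong: measurable_cong_sets)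

lemma RN_component_measurable:
  assumes "k \<in> {1..K}" "i < n"
  shows "(\<lambda>x. rn k (x i)) \<in> borel_measurable (prodP P 0 n)"
  unfolding prodP_def using measurable_component_singleton[of i "{..<n}" "\<lambda>_. P 0"] assms(2)
  by (intro measurable_compose[OF _ RN_measurable[OF assms(1)]]) simp

lemma llr0_eq: "llr0 P k y = ln (enn2real (rn k y))"
  unfolding llr0_def entropy_density_def by (simp add: log_def)

lemma llr0_measurable:
  assumes "k \<in> {1..K}"
  shows "llr0 P k \<in> borel_measurable (P 0)"
proof -
  note RN_measurable[OF assms, measurable]
  show ?thesis unfolding llr0_eq[abs_def] by measurable
qed

lemma llrE_measurable:
  assumes "k \<in> {1..K}"
  shows "llrE P k \<in> borel_measurable (P 0)"
proof -
  note RN_measurable[OF assms, measurable]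
  show ?thesis unfolding llrE_def[abs_def] lnE_def by measurable
qed

text \<open>The real-valued counterpart of \<open>llrE_n\<close>. The two agree where all
  Radon--Nikodym derivatives are neither zero nor infinite; elsewhere \<open>S\<close> only reflects
  the totalisation of \<open>ln\<close> and \<open>enn2real\<close>.\<close>

definition S :: "nat \<Rightarrow> nat \<Rightarrow> (nat \<Rightarrow> 'a) \<Rightarrow> real" where
  "S n k ys = (\<Sum>i<n. llr0 P k (ys i))"

lemma S_measurable:
  assumes "k \<in> {1..K}"
  shows "S n k \<in> borel_measurable (prodP P 0 n)"
proof -
  note llr0_measurable[OF assms, measurable]
  show ?thesis unfolding S_def[abs_def] prodP_def by measurable
qed

lemma llrE_n_measurable:
  assumes "k \<in> {1..K}"
  shows "llrE_n P n k \<in> borel_measurable (prodP P 0 n)"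
proof -
  note llrE_measurable[OF assms, measurable]
  show ?thesis unfolding llrE_n_def[abs_def] prodP_def by measurable
qed

text \<open>The value \<open>0\<close> outside \<open>{1..K}\<close> makes all components measurable.\<close>

definition X :: "nat \<Rightarrow> 'a \<Rightarrow> real" where
  "X k y = (if k \<in> {1..K} then KLk P k - llr0 P k y else 0)"

lemma X_measurable: "X k \<in> borel_measurable (P 0)"
proof (cases "k \<in> {1..K}")
  case True
  note llr0_measurable[OF True, measurable]
  have "X k = (\<lambda>y. KLk P k - llr0 P k y)" using True by (auto simp: X_def)
  then show ?thesis by simp
next
  case False
  then have "X k = (\<lambda>y. 0)" by (auto simp: X_def)
  then show ?thesis by simp
qed

lemma X_cube: "k \<in> {1..K} \<Longrightarrow> integrable (P 0) (\<lambda>y. \<bar>X k y\<bar> ^ 3)"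
proof (rule Bochner_Integration.integrable_bound[OF third_moment])
  assume k: "k \<in> {1..K}"
  note X_measurable[measurable]
  show "(\<lambda>y. \<bar>X k y\<bar> ^ 3) \<in> borel_measurable (P 0)" by measurable
  show "AE y in P 0. norm (\<bar>X k y\<bar> ^ 3) \<le> norm (sqrt (\<Sum>k\<in>{1..K}. (llr0 P k y - KLk P k)\<^sup>2) ^ 3)"
  proof (rule AE_I2)
    fix y
    have "(llr0 P k y - KLk P k)\<^sup>2 \<le> (\<Sum>k\<in>{1..K}. (llr0 P k y - KLk P k)\<^sup>2)"
      using k by (intro member_le_sum[where f="\<lambda>k. (llr0 P k y - KLk P k)\<^sup>2"]) auto
    then have "\<bar>X k y\<bar> \<le> sqrt (\<Sum>k\<in>{1..K}. (llr0 P k y - KLk P k)\<^sup>2)"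
      using k real_sqrt_le_mono by (fastforce simp: X_def abs_minus_commute)
    then have "\<bar>X k y\<bar> ^ 3 \<le> sqrt (\<Sum>k\<in>{1..K}. (llr0 P k y - KLk P k)\<^sup>2) ^ 3" by (intro power_mono) auto
    then show "norm (\<bar>X k y\<bar> ^ 3) \<le> norm (sqrt (\<Sum>k\<in>{1..K}. (llr0 P k y - KLk P k)\<^sup>2) ^ 3)"
      by simp
  qed
qed

text \<open>The centred sum enters with reversed sign because acceptance means large log-likelihood
  ratios, while the Berry--Esseen theorem is about lower orthants.\<close>

abbreviation BE_bound :: "nat set \<Rightarrow> (nat \<Rightarrow> nat \<Rightarrow> real) \<Rightarrow> real \<Rightarrow> bool" where
  "BE_bound J A D \<equiv> \<forall>n\<ge>(1::nat). \<forall>t. \<bar>\<P>(ys in prodP P 0 n.     \<forall>k\<in>J. n * KLk P k - S n k ys \<le> sqrt n * t k) - gauss_cdf J A t\<bar> \<le> D / sqrt n"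

text \<open>Principal submatrices of the covariance stay positive definite: test vectors on
  \<open>J\<close> are extended by zero. The lemma serves for \<open>Imin P K\<close> as well as for
  single components.\<close>

lemma berry_esseen_llr:
  assumes J: "J \<subseteq> {1..K}"
  shows "\<exists>A B D. factor J A B \<and> (\<forall>i\<in>J. \<forall>j\<in>J. (\<Sum>l\<in>J. A i l * A j l) = covV P i j) \<and> 0 < D \<and>
    (BE_bound J A D)"
proof -
  have finJ: "finite J" using J finite_subset by blast
  have pos: "0 < (\<Sum>j\<in>J. \<Sum>k\<in>J. x j * covV P j k * x k)" if "\<exists>k\<in>J. x k \<noteq> 0" for x :: "nat \<Rightarrow> real"
  proof -
    let ?x = "\<lambda>i. if i \<in> J then x i else 0"
    have "0 < (\<Sum>i\<in>{1..K}. \<Sum>j\<in>{1..K}. ?x i * covV P i j * ?x j)"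
      using that J by (intro V_posdef) auto
    also have "\<dots> = (\<Sum>i\<in>{1..K}. \<Sum>j\<in>J. ?x i * covV P i j * ?x j)"
      using J by (intro sum.cong refl sum.mono_neutral_right) auto
    also have "\<dots> = (\<Sum>i\<in>J. \<Sum>j\<in>J. ?x i * covV P i j * ?x j)"
      using J by (intro sum.mono_neutral_right) auto
    also have "\<dots> = (\<Sum>i\<in>J. \<Sum>j\<in>J. x i * covV P i j * x j)"
      by (intro sum.cong refl) auto
    finally show ?thesis .
  qed
  have "\<exists>A B. factor J A B \<and> (\<forall>i\<in>J. \<forall>j\<in>J. (\<Sum>l\<in>J. A i l * A j l) = covV P i j)"
    by (rule cholesky[OF finJ _ pos]) (simp_all add: covV_def mult.commute)
  then obtain A B where F: "factor J A B" and AA: "\<forall>i\<in>J. \<forall>j\<in>J. (\<Sum>l\<in>J. A i l * A j l) = covV P i j"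
    by blast
  interpret F: factor J A B by (rule F)
  interpret P0: prob_space "P 0" by (rule prob) simp
  have W: "F.white (P 0) X"
  proof (rule F.white_of_covariance[OF P0.prob_space_axioms X_measurable])
    fix k assume k: "k \<in> J"
    then have k': "k \<in> {1..K}" using J by auto
    show "integrable (P 0) (\<lambda>y. \<bar>X k y\<bar> ^ 3)" by (rule X_cube[OF k'])
    have "(\<integral>y. KLk P k - llr0 P k y \<partial>P 0) = KLk P k - (\<integral>y. llr0 P k y \<partial>P 0)"
      using KL_finite[OF k'] by (simp add: P0.prob_space)
    moreover have "KLk P k = (\<integral>y. llr0 P k y \<partial>P 0)"
      unfolding KLk_def KL_divergence_def llr0_def ..
    ultimately show "(\<integral>y. X k y \<partial>P 0) = 0" using k' by (simp add: X_def)
  next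
    fix j k assume j: "j \<in> J" and k: "k \<in> J"
    then have "j \<in> {1..K}" "k \<in> {1..K}" using J by auto
    then have "(\<lambda>y. X j y * X k y) = (\<lambda>y. (llr0 P j y - KLk P j) * (llr0 P k y - KLk P k))"
      by (auto simp: X_def algebra_simps)
    then have "(\<integral>y. X j y * X k y \<partial>P 0) = covV P j k" unfolding covV_def by simp
    then show "(\<integral>y. X j y * X k y \<partial>P 0) = (\<Sum>l\<in>J. A j l * A k l)" using AA j k by simp
  qed
  obtain D where D: "0 < D" "\<forall>n\<ge>(1::nat). \<forall>t. \<bar>\<P>(y in PiM {..<n} (\<lambda>_. P 0). \<forall>k\<in>J. (\<Sum>i<n. X k (y i)) \<le> sqrt n * t k) - gauss_cdf J A t\<bar> \<le> D / sqrt n"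
    using F.berry_esseen_orthant[OF W] by (elim exE conjE) (rule that)
  have XS: "(\<Sum>i<n. X k (y i)) = n * KLk P k - S n k y" if "k \<in> J" for n :: nat and k y
    using that J by (auto simp: X_def S_def sum_subtractf)
  have "\<bar>\<P>(ys in prodP P 0 n. \<forall>k\<in>J. n * KLk P k - S n k ys \<le> sqrt n * t k)
      - gauss_cdf J A t\<bar> \<le> D / sqrt n" if "1 \<le> n" for n :: nat and t
  proof -
    have "{y \<in> space (prodP P 0 n). \<forall>k\<in>J. (\<Sum>i<n. X k (y i)) \<le> sqrt n * t k} =
      {ys \<in> space (prodP P 0 n). \<forall>k\<in>J. n * KLk P k - S n k ys \<le> sqrt n * t k}"
      by (auto simp: XS)
    then show ?thesis using D(2)[folded prodP_def, THEN spec[of _ n], THEN mp, OF that, THEN spec[of _ t]] by simp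
  qed
  then show ?thesis using F AA D(1) by blast
qed

text \<open>Two distribution function values a unit apart: each is approximated up to
  \<open>D / sqrt n\<close>, and the Gaussian one varies by at most \<open>L / sqrt n\<close> after
  normalisation. The interval is closed below and open above because the sign reversal turns
  differences of lower half-lines into such intervals.\<close>

lemma S_concentration:
  assumes k: "k \<in> {1..K}"
  shows "\<exists>C>0. \<forall>n\<ge>(1::nat). \<forall>t. \<P>(ys in prodP P 0 n. t \<le> S n k ys \<and> S n k ys < t + 1) \<le> C / sqrt n"
proof -
  have J: "{k} \<subseteq> {1..K}" using k by simp
  obtain A B D where F: "factor {k} A B" and D: "0 < D" and
    BE: "BE_bound {k} A D"
    using berry_esseen_llr[OF J] by (elim exE conjE) (rule that)
  interpret F: factor "{k}" A B by (rule F)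
  obtain L where L: "0 < L" "\<forall>t h. 0 \<le> h \<longrightarrow> gauss_cdf {k} A (\<lambda>k. t k + h) - gauss_cdf {k} A t \<le> L * h"
    using F.gauss_cdf_lipschitz by (elim exE conjE) (rule that)
  note S_measurable[OF k, measurable]
  show ?thesis
  proof (rule exI[of _ "2 * D + L"], intro conjI allI impI)
    show "0 < 2 * D + L" using D L by simp
    fix n :: nat and t :: real assume n: "1 \<le> n"
    interpret Q: prob_space "prodP P 0 n" by (rule prob_space_prodP) simp
    have sn: "0 < sqrt n" using n by simp
    define T where "T u = {ys \<in> space (prodP P 0 n). n * KLk P k - S n k ys \<le> u}" for u
    have Tm[measurable]: "T u \<in> sets (prodP P 0 n)" for u unfolding T_def by measurable
    define u where "u = (n * KLk P k - t - 1) / sqrt n"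
    have be: "\<bar>measure (prodP P 0 n) (T (sqrt n * v)) - gauss_cdf {k} A (\<lambda>_. v)\<bar> \<le> D / sqrt n" for v
      using BE[THEN spec[of _ n], THEN mp, OF n, THEN spec[of _ "\<lambda>_. v"]] unfolding T_def by simp
    have su: "sqrt n * u = n * KLk P k - t - 1" "sqrt n * (u + 1 / sqrt n) = n * KLk P k - t"
      unfolding u_def using sn by (simp_all add: field_simps)
    have "\<P>(ys in prodP P 0 n. t \<le> S n k ys \<and> S n k ys < t + 1) =
      measure (prodP P 0 n) (T (n * KLk P k - t) - T (n * KLk P k - t - 1))"
      unfolding T_def by (rule arg_cong[where f="measure (prodP P 0 n)"]) auto
    also have "\<dots> = measure (prodP P 0 n) (T (n * KLk P k - t)) - measure (prodP P 0 n) (T (n * KLk P k - t - 1))"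
      by (rule Q.finite_measure_Diff) (auto simp: T_def)
    also have "\<dots> \<le> gauss_cdf {k} A (\<lambda>_. u + 1 / sqrt n) - gauss_cdf {k} A (\<lambda>_. u) + 2 * (D / sqrt n)"
      using be[of u] be[of "u + 1 / sqrt n"] unfolding su by linarith
    also have "gauss_cdf {k} A (\<lambda>_. u + 1 / sqrt n) - gauss_cdf {k} A (\<lambda>_. u) \<le> L * (1 / sqrt n)"
      using L(2)[THEN spec[of _ "\<lambda>_. u"], THEN spec[of _ "1 / sqrt n"]] by simp
    finally show "\<P>(ys in prodP P 0 n. t \<le> S n k ys \<and> S n k ys < t + 1) \<le> (2 * D + L) / sqrt n"
      by (simp add: add_divide_distrib)
  qed
qed

section \<open>Change of measure between the hypotheses\<close>

lemma prodP_density: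
  assumes k: "k \<in> {1..K}"
  shows "prodP P 0 n = density (prodP P k n) (\<lambda>x. \<Prod>i<n. rn k (x i))"
proof -
  interpret Pk: prob_space "P k" using k by (intro prob) auto
  have d: "density (P k) (rn k) = P 0"
    using abs_cont[OF k] common_space[of k] k by (intro Pk.density_RN_deriv) auto
  have "PiM {..<n} (\<lambda>_. density (P k) (rn k)) =
    density (PiM {..<n} (\<lambda>_. P k)) (\<lambda>x. \<Prod>i<n. rn k (x i))"
    by (rule PiM_density) (auto simp: d Pk.prob_space_axioms prob)
  then show ?thesis unfolding prodP_def d .
qed

lemma AE_prodP_RN_finite:
  assumes k: "k \<in> {1..K}"
  shows "AE x in prodP P k n. \<forall>i\<in>{..<n}. rn k (x i) \<noteq> \<infinity>"
proof -
  interpret Pk: prob_space "P k" using k by (intro prob) auto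
  interpret P0: prob_space "P 0" by (rule prob) simp
  have "AE y in P k. rn k y \<noteq> \<infinity>"
    using abs_cont[OF k] common_space[of k] k by (intro Pk.RN_deriv_finite P0.sigma_finite_measure_axioms) auto
  then show ?thesis unfolding prodP_def using k
    by (intro eventually_ball_finite ballI AE_PiM_component prob) auto
qed

text \<open>Under \<open>P 0\<close> the derivative cannot vanish, since it is the density of
  \<open>P 0\<close> itself; infinite values are excluded already under \<open>P k\<close>.\<close>

lemma AE_prodP_RN_regular:
  assumes k: "k \<in> {1..K}"
  shows "AE x in prodP P 0 n. \<forall>i\<in>{..<n}. rn k (x i) \<noteq> 0 \<and> rn k (x i) \<noteq> \<infinity>"
proof -
  interpret Pk: prob_space "P k" using k by (intro prob) auto
  interpret P0: prob_space "P 0" by (rule prob) simp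
  have f: "AE y in P k. rn k y \<noteq> \<infinity>"
    using abs_cont[OF k] common_space[of k] k by (intro Pk.RN_deriv_finite P0.sigma_finite_measure_axioms) auto
  have d: "density (P k) (rn k) = P 0"
    using abs_cont[OF k] common_space[of k] k by (intro Pk.density_RN_deriv) auto
  have "AE y in density (P k) (rn k). rn k y \<noteq> 0 \<and> rn k y \<noteq> \<infinity>"
    using f by (subst AE_density) auto
  then show ?thesis unfolding prodP_def d
    by (intro eventually_ball_finite ballI AE_PiM_component prob) auto
qed

lemma prod_RN_eq:
  assumes "\<forall>i\<in>{..<n}. rn k (x i) \<noteq> 0 \<and> rn k (x i) \<noteq> \<infinity>"
  shows "(\<Prod>i<n. rn k (x i)) = ennreal (exp (S n k x))"
proof -
  have "rn k (x i) = ennreal (exp (llr0 P k (x i)))" if "i < n" for i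
  proof -
    have "rn k (x i) \<noteq> 0" "rn k (x i) \<noteq> top" using assms that by auto
    then obtain r where r: "rn k (x i) = ennreal r" "0 < r"
      by (cases "rn k (x i)") (auto simp: ennreal_eq_0_iff not_le)
    then show ?thesis unfolding llr0_eq by simp
  qed
  then have "(\<Prod>i<n. rn k (x i)) = (\<Prod>i<n. ennreal (exp (llr0 P k (x i))))" by simp
  also have "\<dots> = ennreal (exp (S n k x))" unfolding S_def by (simp add: prod_ennreal exp_sum)
  finally show ?thesis .
qed

lemma llrE_n_eq:
  assumes "\<forall>i\<in>{..<n}. rn k (x i) \<noteq> 0 \<and> rn k (x i) \<noteq> \<infinity>"
  shows "llrE_n P n k x = ereal (S n k x)"
proof -
  have "llrE_n P n k x = (\<Sum>i<n. ereal (llr0 P k (x i)))"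
    unfolding llrE_n_def using assms by (intro sum.cong refl) (auto simp: llrE_def lnE_def llr0_eq)
  then show ?thesis unfolding S_def by simp
qed

text \<open>Under \<open>P k\<close> a factor of the likelihood ratio may vanish with positive
  probability; the sum is then below every threshold and the test decides for H1. The finiteness
  assumption matters because in \<open>ereal\<close> an infinite summand would win against the
  negative one.\<close>

lemma llrE_n_minus_infinity:
  assumes fin: "\<forall>i\<in>{..<n}. rn k (x i) \<noteq> \<infinity>" and j: "j < n" "rn k (x j) = 0"
  shows "llrE_n P n k x = -\<infinity>"
proof -
  have "llrE_n P n k x = llrE P k (x j) + (\<Sum>i\<in>{..<n} - {j}. llrE P k (x i))"
    unfolding llrE_n_def using j by (intro sum.remove) auto
  moreover have "llrE P k (x j) = -\<infinity>" using j by (simp add: llrE_def lnE_def)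
  moreover have "(\<Sum>i\<in>{..<n} - {j}. llrE P k (x i)) \<noteq> \<infinity>"
    using fin by (subst sum_Pinfty) (auto simp: llrE_def lnE_def split: if_splits)
  ultimately show ?thesis by (cases "\<Sum>i\<in>{..<n} - {j}. llrE P k (x i)") auto
qed

abbreviation llr_error :: "nat \<Rightarrow> real \<Rightarrow> bool" where
  "llr_error k C \<equiv> \<forall>n\<ge>(1::nat). \<forall>\<tau>. \<P>(x in prodP P k n. ereal \<tau> \<le> llrE_n P n k x) \<le> C * exp (- \<tau>) / sqrt n"

text \<open>The factor \<open>1 / sqrt n\<close> beyond the Chernoff bound \<open>exp (- \<tau>)\<close> comes from the concentration of
  \<open>S n k\<close> on unit intervals.\<close>

lemma llr_error_bound:
  assumes k: "k \<in> {1..K}"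
  shows "\<exists>C>0. llr_error k C"
proof -
  obtain C where C: "0 < C" "\<forall>n\<ge>(1::nat). \<forall>t. \<P>(ys in prodP P 0 n. t \<le> S n k ys \<and> S n k ys < t + 1) \<le> C / sqrt n"
    using S_concentration[OF k] by (elim exE conjE) (rule that)
  have kK: "k \<le> K" using k by simp
  define q where "q = 1 / (1 - exp (- 1 :: real))"
  have q: "0 < q" unfolding q_def by simp
  show ?thesis
  proof (rule exI[of _ "C * q"], intro conjI allI impI)
    show "0 < C * q" using C q by simp
    fix n :: nat and \<tau> :: real assume n: "1 \<le> n"
    let ?R = "prodP P k n" and ?Q = "prodP P 0 n"
    interpret R: prob_space ?R using kK by (rule prob_space_prodP)
    interpret Q: prob_space ?Q by (rule prob_space_prodP) simp
    note sets_eq = sets_prodP[OF kK, of n] and space_eq = space_prodP[OF kK, of n]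
    note [measurable] = S_measurable[OF k, of n] llrE_n_measurable[OF k, of n] RN_measurable[OF k]
    have fm[measurable]: "(\<lambda>x. rn k (x i)) \<in> borel_measurable ?Q" if "i < n" for i
      using that by (rule RN_component_measurable[OF k])
    \<comment> \<open>The region above the threshold is cut into unit slices. Each has probability
      at most \<open>C / sqrt n\<close> under \<open>P 0\<close>, and under \<open>P k\<close> this
      is reduced by the factor \<open>exp (- \<tau> - j)\<close>. Summing the geometric series
      yields \<open>q\<close>.\<close>
    define E where "E j = {x \<in> space ?Q. (\<forall>i\<in>{..<n}. rn k (x i) \<noteq> 0 \<and> rn k (x i) \<noteq> \<infinity>) \<and>
      \<tau> + real j \<le> S n k x \<and> S n k x < \<tau> + real j + 1}" for j :: nat
    have E: "E j \<in> sets ?Q" for j unfolding E_def by measurable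
    then have E': "E j \<in> sets ?R" for j using sets_eq by simp
    have EQ: "measure ?Q (E j) \<le> C / sqrt n" for j
    proof -
      have "measure ?Q (E j) \<le> \<P>(ys in ?Q. \<tau> + real j \<le> S n k ys \<and> S n k ys < \<tau> + real j + 1)"
        by (rule Q.finite_measure_mono) (auto simp: E_def)
      also have "\<dots> \<le> C / sqrt n" using C(2) n by simp
      finally show ?thesis .
    qed
    have ER: "emeasure ?R (E j) \<le> ennreal (exp (- \<tau>) * C / sqrt n * exp (- 1) ^ j)" for j
    proof -
      have "ennreal (exp (\<tau> + real j)) * emeasure ?R (E j) = (\<integral>\<^sup>+x. ennreal (exp (\<tau> + real j)) * indicator (E j) x \<partial>?R)"
        using E' by (simp add: nn_integral_cmult_indicator)
      also have "\<dots> \<le> (\<integral>\<^sup>+x. (\<Prod>i<n. rn k (x i)) * indicator (E j) x \<partial>?R)"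
        by (intro nn_integral_mono) (auto simp: E_def prod_RN_eq indicator_def intro!: ennreal_leI)
      also have "\<dots> = emeasure ?Q (E j)"
      proof -
        have "(\<lambda>x. \<Prod>i<n. rn k (x i)) \<in> borel_measurable ?Q" by measurable
        then have "(\<lambda>x. \<Prod>i<n. rn k (x i)) \<in> borel_measurable ?R" using sets_eq by (simp cong: measurable_cong_sets)
        then have "emeasure (density ?R (\<lambda>x. \<Prod>i<n. rn k (x i))) (E j) = (\<integral>\<^sup>+x. (\<Prod>i<n. rn k (x i)) * indicator (E j) x \<partial>?R)"
          using E' by (rule emeasure_density)
        then show ?thesis unfolding prodP_density[OF k, of n, symmetric] by simp
      qed
      also have "\<dots> \<le> ennreal (C / sqrt n)" unfolding Q.emeasure_eq_measure using EQ by (intro ennreal_leI)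
      finally have "ennreal (exp (\<tau> + real j)) * emeasure ?R (E j) \<le> ennreal (C / sqrt n)" .
      then have "exp (\<tau> + real j) * measure ?R (E j) \<le> C / sqrt n"
        unfolding R.emeasure_eq_measure using C(1) by (simp add: ennreal_mult[symmetric] ennreal_le_iff)
      then have "measure ?R (E j) \<le> C / sqrt n / exp (\<tau> + real j)"
        by (subst pos_le_divide_eq) (simp_all add: mult.commute)
      also have "\<dots> = exp (- \<tau>) * C / sqrt n * exp (- 1) ^ j"
        by (simp add: exp_add exp_minus field_simps exp_of_nat_mult[symmetric])
      finally show ?thesis unfolding R.emeasure_eq_measure by (rule ennreal_leI)
    qed
    let ?A = "{x \<in> space ?R. ereal \<tau> \<le> llrE_n P n k x}"
    have "emeasure ?R ?A \<le> emeasure ?R (\<Union>j. E j)"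
    proof (rule emeasure_mono_AE)
      show "AE x in ?R. x \<in> ?A \<longrightarrow> x \<in> (\<Union>j. E j)"
        using AE_prodP_RN_finite[OF k, of n]
      proof eventually_elim
        case (elim x)
        show ?case
        proof
          assume x: "x \<in> ?A"
          \<comment> \<open>Where a derivative vanishes, the extended log-likelihood ratio is
            negative infinity and cannot reach \<open>\<tau>\<close>; so the slices cover the event
            up to a null set of \<open>P k\<close>.\<close>
          have nz: "rn k (x i) \<noteq> 0" if "i < n" for i
            using llrE_n_minus_infinity[OF elim that] x by auto
          then have reg: "\<forall>i\<in>{..<n}. rn k (x i) \<noteq> 0 \<and> rn k (x i) \<noteq> \<infinity>" using elim by auto
          have "\<tau> \<le> S n k x" using x llrE_n_eq[OF reg] by simp
          then have "\<tau> + real (nat \<lfloor>S n k x - \<tau>\<rfloor>) \<le> S n k x \<and> S n k x < \<tau> + real (nat \<lfloor>S n k x - \<tau>\<rfloor>) + 1"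
            by linarith
          then have "x \<in> E (nat \<lfloor>S n k x - \<tau>\<rfloor>)" using x reg space_eq unfolding E_def by auto
          then show "x \<in> (\<Union>j. E j)" by blast
        qed
      qed
      show "(\<Union>j. E j) \<in> sets ?R" using E' by auto
    qed
    also have "\<dots> \<le> (\<Sum>j. emeasure ?R (E j))" using E' by (intro emeasure_subadditive_countably) auto
    also have "\<dots> \<le> (\<Sum>j. ennreal (exp (- \<tau>) * C / sqrt n * exp (- 1) ^ j))" by (intro suminf_le ER) auto
    also have "\<dots> = ennreal (exp (- \<tau>) * C / sqrt n * q)"
    proof -
      have "(\<lambda>j. exp (- 1 :: real) ^ j) sums q" unfolding q_def by (rule geometric_sums) simp
      then have s: "(\<lambda>j. exp (- \<tau>) * C / sqrt n * exp (- 1) ^ j) sums (exp (- \<tau>) * C / sqrt n * q)" by (rule sums_mult)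
      then show ?thesis using C(1) by (subst suminf_ennreal2) (auto simp: sums_iff)
    qed
    finally have "measure ?R ?A \<le> exp (- \<tau>) * C / sqrt n * q"
      unfolding R.emeasure_eq_measure using C(1) q by (simp add: ennreal_le_iff)
    then show "measure ?R ?A \<le> C * q * exp (- \<tau>) / sqrt n" by (simp add: mult_ac)
  qed
qed

lemma is_test_integrable:
  assumes "is_test P n \<phi>" "k \<le> K"
  shows "integrable (prodP P k n) \<phi>"
proof -
  interpret R: prob_space "prodP P k n" by (rule prob_space_prodP[OF assms(2)])
  have "\<phi> \<in> borel_measurable (prodP P k n)"
    using assms sets_prodP[OF assms(2), of n] unfolding is_test_def by (simp cong: measurable_cong_sets)
  then show ?thesis
    using assms space_prodP[OF assms(2), of n] unfolding is_test_def
    by (intro R.integrable_const_bound[where B=1]) (auto intro!: AE_I2)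
qed

lemma type2_err_nonneg: "is_test P n \<phi> \<Longrightarrow> k \<le> K \<Longrightarrow> 0 \<le> type2_err P n k \<phi>"
  unfolding type2_err_def is_test_def using space_prodP[of k n]
  by (intro Bochner_Integration.integral_nonneg) auto

text \<open>On the event \<open>S n k x \<le> \<tau>\<close> the density of the null law with
  respect to the alternative is at most \<open>exp \<tau>\<close>. Points where a derivative
  vanishes contribute nothing to the integral under the null law, and infinite derivatives form a
  null set of the alternative.\<close>

lemma type2_err_lower:
  assumes k: "k \<in> {1..K}" and t: "is_test P n \<phi>"
  shows "exp (- \<tau>) * (\<integral>x. (1 - \<phi> x) * indicator {x \<in> space (prodP P 0 n). S n k x \<le> \<tau>} x \<partial>prodP P 0 n) \<le> type2_err P n k \<phi>"
proof -
  let ?R = "prodP P k n" and ?Q = "prodP P 0 n"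
  let ?A = "{x \<in> space ?Q. S n k x \<le> \<tau>}"
  have kK: "k \<le> K" using k by simp
  interpret R: prob_space ?R using kK by (rule prob_space_prodP)
  interpret Q: prob_space ?Q by (rule prob_space_prodP) simp
  note sets_eq = sets_prodP[OF kK, of n] and space_eq = space_prodP[OF kK, of n]
  note [measurable] = S_measurable[OF k, of n] RN_measurable[OF k]
  have A[measurable]: "?A \<in> sets ?Q" by measurable
  have \<phi>: "\<phi> \<in> borel_measurable ?Q" "\<And>x. x \<in> space ?Q \<Longrightarrow> 0 \<le> \<phi> x \<and> \<phi> x \<le> 1" using t unfolding is_test_def by auto
  note [measurable] = \<phi>(1)
  have iQ: "integrable ?Q (\<lambda>x. (1 - \<phi> x) * indicator ?A x)"
    using \<phi>(2) by (intro Q.integrable_const_bound[where B=1] AE_I2) (auto simp: indicator_def)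
  have iR: "integrable ?R (\<lambda>x. exp \<tau> * (1 - \<phi> x))"
    using is_test_integrable[OF t kK] by simp
  have fm[measurable]: "(\<lambda>x. rn k (x i)) \<in> borel_measurable ?Q" if "i < n" for i
    using that by (rule RN_component_measurable[OF k])
  have pm: "(\<lambda>x. \<Prod>i<n. rn k (x i)) \<in> borel_measurable ?R"
  proof -
    have "(\<lambda>x. \<Prod>i<n. rn k (x i)) \<in> borel_measurable ?Q" by measurable
    then show ?thesis using sets_eq by (simp cong: measurable_cong_sets)
  qed
  have gm: "(\<lambda>x. ennreal ((1 - \<phi> x) * indicator ?A x)) \<in> borel_measurable ?R"
  proof -
    have "(\<lambda>x. ennreal ((1 - \<phi> x) * indicator ?A x)) \<in> borel_measurable ?Q" by measurable
    then show ?thesis using sets_eq by (simp cong: measurable_cong_sets)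
  qed
  have "ennreal (\<integral>x. (1 - \<phi> x) * indicator ?A x \<partial>?Q) = (\<integral>\<^sup>+x. ennreal ((1 - \<phi> x) * indicator ?A x) \<partial>?Q)"
    using \<phi>(2) by (intro nn_integral_eq_integral[symmetric] iQ AE_I2) (auto simp: indicator_def)
  also have "\<dots> = (\<integral>\<^sup>+x. (\<Prod>i<n. rn k (x i)) * ennreal ((1 - \<phi> x) * indicator ?A x) \<partial>?R)"
    unfolding prodP_density[OF k, of n] using pm gm
    by (subst nn_integral_density) (auto simp: prodP_density[OF k, of n, symmetric])
  also have "\<dots> \<le> (\<integral>\<^sup>+x. ennreal (exp \<tau> * (1 - \<phi> x)) \<partial>?R)"
  proof (rule nn_integral_mono_AE)
    show "AE x in ?R. (\<Prod>i<n. rn k (x i)) * ennreal ((1 - \<phi> x) * indicator ?A x) \<le> ennreal (exp \<tau> * (1 - \<phi> x))"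
      using AE_prodP_RN_finite[OF k, of n] AE_space
    proof eventually_elim
      case (elim x)
      have p: "0 \<le> 1 - \<phi> x" using \<phi>(2)[of x] elim(2) space_eq by auto
      show ?case
      proof (cases "(\<forall>i\<in>{..<n}. rn k (x i) \<noteq> 0) \<and> x \<in> ?A")
        case True
        then have "(\<Prod>i<n. rn k (x i)) = ennreal (exp (S n k x))" using elim(1) by (intro prod_RN_eq) auto
        then show ?thesis using True p by (auto simp: ennreal_mult[symmetric] intro!: ennreal_leI mult_right_mono)
      next
        case False
        then consider i where "i < n" "rn k (x i) = 0" | "x \<notin> ?A" by blast
        then show ?thesis
        proof cases
          case 1
          then have z: "(\<Prod>i<n. rn k (x i)) = 0" by (intro prod_zero) auto
          show ?thesis unfolding z by simp
        next
          case 2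
          then show ?thesis by simp
        qed
      qed
    qed
  qed
  also have "\<dots> = ennreal (\<integral>x. exp \<tau> * (1 - \<phi> x) \<partial>?R)"
    using \<phi>(2) space_eq by (intro nn_integral_eq_integral iR AE_I2) auto
  finally have "ennreal (\<integral>x. (1 - \<phi> x) * indicator ?A x \<partial>?Q) \<le> ennreal (exp \<tau> * type2_err P n k \<phi>)"
    unfolding type2_err_def by simp
  then have "(\<integral>x. (1 - \<phi> x) * indicator ?A x \<partial>?Q) \<le> exp \<tau> * type2_err P n k \<phi>"
    using type2_err_nonneg[OF t kK] by (simp add: ennreal_le_iff)
  then have "exp (- \<tau>) * (\<integral>x. (1 - \<phi> x) * indicator ?A x \<partial>?Q) \<le> exp (- \<tau>) * (exp \<tau> * type2_err P n k \<phi>)"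
    by (intro mult_left_mono) auto
  also have "\<dots> = type2_err P n k \<phi>" by (simp add: exp_minus)
  finally show ?thesis .
qed

lemma max_type2_ge: "k \<in> {1..K} \<Longrightarrow> type2_err P n k \<phi> \<le> max_type2 P K n \<phi>"
  unfolding max_type2_def by (intro Max_ge) auto

lemma Imin_facts: "Imin P K \<subseteq> {1..K}" "Imin P K \<noteq> {}" "finite (Imin P K)"
proof -
  show 1: "Imin P K \<subseteq> {1..K}" unfolding Imin_def by auto
  have "Dmin P K \<in> KLk P ` {1..K}" unfolding Dmin_def using K_pos by (intro Min_in) auto
  then show "Imin P K \<noteq> {}" unfolding Imin_def by auto
  show "finite (Imin P K)" using 1 finite_subset by blast
qed

text \<open>Outside the event that all \<open>S n k\<close> with \<open>k\<close> in
  \<open>Imin P K\<close> exceed \<open>\<tau>\<close>, some component is at most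
  \<open>\<tau>\<close>, and accepting there is paid for under that alternative. A union bound over
  the components costs the factor \<open>card (Imin P K)\<close>, which is independent of
  \<open>n\<close>.\<close>

lemma max_type2_lower:
  assumes t: "is_test P n \<phi>" and e: "type1_err P n \<phi> \<le> \<epsilon>"
  shows "exp (- \<tau>) * (1 - \<epsilon> - \<P>(x in prodP P 0 n. \<forall>k\<in>Imin P K. \<tau> < S n k x))
    \<le> card (Imin P K) * max_type2 P K n \<phi>"
proof -
  let ?Q = "prodP P 0 n" and ?I = "Imin P K"
  interpret Q: prob_space ?Q by (rule prob_space_prodP) simp
  have Sm: "S n k \<in> borel_measurable ?Q" if "k \<in> ?I" for k using that Imin_facts(1) by (intro S_measurable) auto
  let ?A = "\<lambda>k. {x \<in> space ?Q. S n k x \<le> \<tau>}"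
  let ?B = "{x \<in> space ?Q. \<forall>k\<in>?I. \<tau> < S n k x}"
  have A: "?A k \<in> sets ?Q" if "k \<in> ?I" for k using Sm[OF that] by measurable
  have B: "?B \<in> sets ?Q" using Sm Imin_facts(3) by measurable
  have \<phi>: "\<phi> \<in> borel_measurable ?Q" "\<And>x. x \<in> space ?Q \<Longrightarrow> 0 \<le> \<phi> x \<and> \<phi> x \<le> 1" using t unfolding is_test_def by auto
  note [measurable] = \<phi>(1) B
  have i\<phi>: "integrable ?Q \<phi>" by (rule is_test_integrable[OF t]) simp
  have iA: "integrable ?Q (\<lambda>x. (1 - \<phi> x) * indicator (?A k) x)" if "k \<in> ?I" for k
    using \<phi>(2) A[OF that] by (intro Q.integrable_const_bound[where B=1] AE_I2) (auto simp: indicator_def)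
  have iB: "integrable ?Q (\<lambda>x. indicator ?B x :: real)" using B by (simp add: Q.emeasure_eq_measure)
  have "1 - \<epsilon> - measure ?Q ?B \<le> (\<integral>x. (1 - \<phi> x) - indicator ?B x \<partial>?Q)"
    using e i\<phi> iB B unfolding type1_err_def by (simp add: Q.prob_space Int_absorb2)
  also have "\<dots> \<le> (\<integral>x. (\<Sum>k\<in>?I. (1 - \<phi> x) * indicator (?A k) x) \<partial>?Q)"
  proof (intro integral_mono Bochner_Integration.integrable_diff Q.integrable_const i\<phi> iB Bochner_Integration.integrable_sum iA)
    fix x assume x: "x \<in> space ?Q"
    have nn: "0 \<le> (1 - \<phi> x) * indicator (?A k) x" for k using \<phi>(2)[OF x] by (auto simp: indicator_def)
    show "(1 - \<phi> x) - indicator ?B x \<le> (\<Sum>k\<in>?I. (1 - \<phi> x) * indicator (?A k) x)"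
    proof (cases "x \<in> ?B")
      case True
      then have "(1 - \<phi> x) - indicator ?B x \<le> 0" using \<phi>(2)[OF x] by simp
      also have "0 \<le> (\<Sum>k\<in>?I. (1 - \<phi> x) * indicator (?A k) x)" by (intro sum_nonneg nn)
      finally show ?thesis .
    next
      case False
      then obtain k where k: "k \<in> ?I" "x \<in> ?A k" using x by (auto simp: not_less)
      have "(1 - \<phi> x) - indicator ?B x = (1 - \<phi> x) * indicator (?A k) x" using False k by simp
      also have "\<dots> \<le> (\<Sum>k\<in>?I. (1 - \<phi> x) * indicator (?A k) x)"
        using Imin_facts(3) k nn by (intro member_le_sum[where f="\<lambda>k. (1 - \<phi> x) * indicator (?A k) x"]) auto
      finally show ?thesis .
    qed
  qed
  also have "\<dots> = (\<Sum>k\<in>?I. \<integral>x. (1 - \<phi> x) * indicator (?A k) x \<partial>?Q)"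
    by (intro Bochner_Integration.integral_sum iA)
  finally have "exp (- \<tau>) * (1 - \<epsilon> - measure ?Q ?B) \<le> exp (- \<tau>) * (\<Sum>k\<in>?I. \<integral>x. (1 - \<phi> x) * indicator (?A k) x \<partial>?Q)"
    by (intro mult_left_mono) auto
  also have "\<dots> = (\<Sum>k\<in>?I. exp (- \<tau>) * (\<integral>x. (1 - \<phi> x) * indicator (?A k) x \<partial>?Q))" by (rule sum_distrib_left)
  also have "\<dots> \<le> (\<Sum>k\<in>?I. max_type2 P K n \<phi>)"
  proof (intro sum_mono)
    fix k assume "k \<in> ?I"
    then have k: "k \<in> {1..K}" using Imin_facts(1) by auto
    show "exp (- \<tau>) * (\<integral>x. (1 - \<phi> x) * indicator (?A k) x \<partial>?Q) \<le> max_type2 P K n \<phi>"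
      using type2_err_lower[OF k t] max_type2_ge[OF k] by (rule order_trans)
  qed
  finally show ?thesis by simp
qed

end

section \<open>Converse and achievability for large n\<close>

lemma eventually_sqrt_ge: "\<forall>\<^sub>F n in sequentially. M \<le> sqrt (real n)"
  using filterlim_compose[OF sqrt_at_top filterlim_real_sequentially]
  unfolding filterlim_at_top by simp

lemma exp_rate:
  assumes "1 \<le> n"
  shows "exp (- real n * D + sqrt (real n) * b - ln (real n) / 2) = exp (- real n * D + sqrt (real n) * b) / sqrt n"
proof -
  have "ln (real n) / 2 = ln (sqrt n)" using assms by (simp add: ln_sqrt)
  then show ?thesis using assms by (simp add: exp_diff)
qed

context llr_testing
begin

text \<open>The order of quantifiers matters: \<open>E\<close> must not depend on
  \<open>\<beta>\<close> and \<open>\<gamma>\<close>, because the constant by which the threshold is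
  lowered, taken as \<open>\<gamma>\<close>, is itself computed from these \<open>E\<close>. Only
  the index from which the bound holds may depend on them.\<close>

abbreviation far_bound :: "nat \<Rightarrow> real \<Rightarrow> bool" where
  "far_bound k E \<equiv> \<forall>\<beta> \<gamma>. \<forall>\<^sub>F n in sequentially. \<P>(x in prodP P 0 n. S n k x < real n * Dmin P K - sqrt (real n) * \<beta> - \<gamma>) \<le> E / sqrt (real n)"

text \<open>\<open>S n k\<close> is centred at \<open>n * KLk P k\<close>, which exceeds
  \<open>n * Dmin P K\<close> by \<open>2 * n * \<delta>\<close>. Half of the gap absorbs the
  lower-order terms; the other half is a deviation of \<open>sqrt n * \<delta>\<close> in normalised
  units, so the crude Gaussian tail and the Berry--Esseen error are both of order
  \<open>1 / sqrt n\<close>.\<close>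

lemma far_alternative:
  assumes k: "k \<in> {1..K}" and far: "Dmin P K < KLk P k"
  shows "\<exists>E>0. far_bound k E"
proof -
  have J: "{k} \<subseteq> {1..K}" using k by simp
  obtain A B D where F: "factor {k} A B" and D: "0 < D" and
    BE: "BE_bound {k} A D"
    using berry_esseen_llr[OF J] by (elim exE conjE) (rule that)
  interpret F: factor "{k}" A B by (rule F)
  obtain C where C: "0 < C" "\<forall>b>0. 1 - gauss_cdf {k} A (\<lambda>_. b) \<le> C / b \<and> gauss_cdf {k} A (\<lambda>_. - b) \<le> C / b"
    using F.gauss_cdf_tails[OF insert_not_empty] by (elim exE conjE) (rule that)
  define \<delta> where "\<delta> = (KLk P k - Dmin P K) / 2"
  have \<delta>: "0 < \<delta>" unfolding \<delta>_def using far by simp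
  show ?thesis
  proof (rule exI[of _ "C / \<delta> + D"], intro conjI allI)
    show "0 < C / \<delta> + D" using C D \<delta> by (simp add: add_pos_pos)
    fix \<beta> \<gamma> :: real
    show "\<forall>\<^sub>F n in sequentially. \<P>(x in prodP P 0 n. S n k x < real n * Dmin P K - sqrt (real n) * \<beta> - \<gamma>) \<le> (C / \<delta> + D) / sqrt (real n)"
      using eventually_sqrt_ge[of "max 1 ((\<bar>\<beta>\<bar> + \<bar>\<gamma>\<bar>) / \<delta>)"]
    proof eventually_elim
      case (elim n)
      define r where "r = sqrt (real n)"
      have r: "1 \<le> r" "(\<bar>\<beta>\<bar> + \<bar>\<gamma>\<bar>) / \<delta> \<le> r" using elim unfolding r_def by auto
      have rr: "real n = r * r" unfolding r_def by simp
      have n: "1 \<le> n" using r(1) rr by (cases n) auto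
      interpret Q: prob_space "prodP P 0 n" by (rule prob_space_prodP) simp
      note S_measurable[OF k, measurable]
      let ?T = "{x \<in> space (prodP P 0 n). n * KLk P k - S n k x \<le> r * (r * \<delta>)}"
      have T[measurable]: "?T \<in> sets (prodP P 0 n)" by measurable
      have be: "\<bar>measure (prodP P 0 n) ?T - gauss_cdf {k} A (\<lambda>_. r * \<delta>)\<bar> \<le> D / r"
        using BE[THEN spec[of _ n], THEN mp, OF n, THEN spec[of _ "\<lambda>_. r * \<delta>"]] unfolding r_def by simp
      have tail: "1 - gauss_cdf {k} A (\<lambda>_. r * \<delta>) \<le> C / (r * \<delta>)" using C(2) r \<delta> by simp
      have "\<P>(x in prodP P 0 n. S n k x < real n * Dmin P K - sqrt (real n) * \<beta> - \<gamma>)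
        \<le> measure (prodP P 0 n) (space (prodP P 0 n) - ?T)"
      proof (rule Q.finite_measure_mono)
        show "{x \<in> space (prodP P 0 n). S n k x < real n * Dmin P K - sqrt (real n) * \<beta> - \<gamma>} \<subseteq> space (prodP P 0 n) - ?T"
        proof safe
          fix x assume a: "S n k x < real n * Dmin P K - sqrt (real n) * \<beta> - \<gamma>" and b: "n * KLk P k - S n k x \<le> r * (r * \<delta>)"
          have "\<bar>\<beta>\<bar> + \<bar>\<gamma>\<bar> \<le> r * \<delta>" using r(2) \<delta> by (simp add: pos_divide_le_eq)
          then have "r * (\<bar>\<beta>\<bar> + \<bar>\<gamma>\<bar>) \<le> r * (r * \<delta>)" using r(1) by (intro mult_left_mono) auto
          moreover have "r * \<bar>\<beta>\<bar> + \<bar>\<gamma>\<bar> \<le> r * (\<bar>\<beta>\<bar> + \<bar>\<gamma>\<bar>)" using r(1) mult_right_mono[of 1 r "\<bar>\<gamma>\<bar>"] by (simp add: distrib_left)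
          moreover have "- (r * \<beta>) \<le> r * \<bar>\<beta>\<bar>" using r(1) mult_left_mono[of "- \<beta>" "\<bar>\<beta>\<bar>" r] by simp
          ultimately have "- (r * \<beta>) - \<gamma> \<le> r * (r * \<delta>)" by linarith
          moreover have "n * KLk P k - n * Dmin P K = 2 * (r * (r * \<delta>))" unfolding \<delta>_def rr by (simp add: algebra_simps)
          ultimately show False using a b unfolding r_def[symmetric] by linarith
        qed
      qed simp
      also have "\<dots> = 1 - measure (prodP P 0 n) ?T" by (rule Q.prob_compl[OF T])
      also have "\<dots> \<le> C / (r * \<delta>) + D / r" using be tail by linarith
      also have "\<dots> = (C / \<delta> + D) / r" by (simp add: add_divide_distrib mult.commute)
      finally show ?case unfolding r_def .
    qed
  qed
qed

text \<open>Raising the threshold by \<open>C = (D + 1) / c\<close> lowers the orthant probability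
  by at least \<open>(D + 1) / sqrt n\<close>. Of this, \<open>D / sqrt n\<close> covers the
  Berry--Esseen error; the surplus \<open>1 / sqrt n\<close> is null-hypothesis acceptance
  probability that every admissible test must place below the threshold, and it becomes the term
  \<open>- ln n / 2\<close> of the exponent.\<close>

lemma converse_bound:
  assumes F: "factor (Imin P K) A B" and D: "0 < D"
    and BE: "BE_bound (Imin P K) A D"
    and b: "gauss_cdf (Imin P K) A (\<lambda>_. b) = 1 - \<epsilon>"
  shows "\<exists>c>0. \<forall>\<^sub>F n in sequentially. \<forall>\<phi>. is_test P n \<phi> \<longrightarrow> type1_err P n \<phi> \<le> \<epsilon> \<longrightarrow>
    c * exp (- real n * Dmin P K + sqrt (real n) * b - ln (real n) / 2) \<le> max_type2 P K n \<phi>"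
proof -
  interpret F: factor "Imin P K" A B by (rule F)
  let ?G = "\<lambda>s. gauss_cdf (Imin P K) A (\<lambda>_. s)"
  obtain c where c: "0 < c" "\<forall>s h. \<bar>s - b\<bar> \<le> 1 \<longrightarrow> 0 \<le> h \<longrightarrow> h \<le> 1 \<longrightarrow> c * h \<le> ?G (s + h) - ?G s"
    using F.gauss_cdf_increment[OF Imin_facts(2), of b] by (elim exE conjE) (rule that)
  define C where "C = (D + 1) / c"
  have C: "0 < C" unfolding C_def using D c(1) by simp
  have m: "0 < real (card (Imin P K))" using Imin_facts by (simp add: card_gt_0_iff)
  show ?thesis
  proof (rule exI[of _ "exp (- C) / card (Imin P K)"], intro conjI)
    show "0 < exp (- C) / card (Imin P K)" using m by simp
    show "\<forall>\<^sub>F n in sequentially. \<forall>\<phi>. is_test P n \<phi> \<longrightarrow> type1_err P n \<phi> \<le> \<epsilon> \<longrightarrow>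
      exp (- C) / card (Imin P K) * exp (- real n * Dmin P K + sqrt (real n) * b - ln (real n) / 2) \<le> max_type2 P K n \<phi>"
      \<comment> \<open>For \<open>C \<le> sqrt n\<close> the normalised displacement is at most 1,
        the range in which the lower bound on increments holds.\<close>
      using eventually_sqrt_ge[of "max 1 C"]
    proof eventually_elim
      case (elim n)
      define r where "r = sqrt (real n)"
      have r: "1 \<le> r" "C \<le> r" using elim unfolding r_def by auto
      have rr: "real n = r * r" unfolding r_def by simp
      have n: "1 \<le> n" using r(1) rr by (cases n) auto
      interpret Q: prob_space "prodP P 0 n" by (rule prob_space_prodP) simp
      have Sm[measurable]: "S n k \<in> borel_measurable (prodP P 0 n)" if "k \<in> Imin P K" for k
        using that Imin_facts(1) by (intro S_measurable) auto
      define \<tau> where "\<tau> = real n * Dmin P K - r * b + C"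
      let ?W = "{x \<in> space (prodP P 0 n). \<forall>k\<in>Imin P K. \<tau> < S n k x}"
      let ?W' = "{x \<in> space (prodP P 0 n). \<forall>k\<in>Imin P K. n * KLk P k - S n k x \<le> r * (b - C / r)}"
      have "measure (prodP P 0 n) ?W \<le> measure (prodP P 0 n) ?W'"
      proof (rule Q.finite_measure_mono)
        show "?W \<subseteq> ?W'"
        proof safe
          fix x k assume k: "k \<in> Imin P K" and "\<forall>k\<in>Imin P K. \<tau> < S n k x"
          then have "\<tau> < S n k x" by blast
          moreover have "KLk P k = Dmin P K" using k by (simp add: Imin_def)
          moreover have "r * (b - C / r) = r * b - C" using r by (simp add: right_diff_distrib)
          ultimately show "n * KLk P k - S n k x \<le> r * (b - C / r)" unfolding \<tau>_def by simp
        qed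
        show "?W' \<in> sets (prodP P 0 n)" using Imin_facts(3) by measurable
      qed
      also have "\<dots> \<le> ?G (b - C / r) + D / r"
        using BE[THEN spec[of _ n], THEN mp, OF n, THEN spec[of _ "\<lambda>_. b - C / r"]] unfolding r_def by linarith
      also have "?G (b - C / r) \<le> 1 - \<epsilon> - c * (C / r)"
        using c(2)[THEN spec[of _ "b - C / r"], THEN spec[of _ "C / r"]] r C b by simp
      also have "c * (C / r) = (D + 1) / r" unfolding C_def using c(1) by simp
      finally have W: "measure (prodP P 0 n) ?W \<le> 1 - \<epsilon> - 1 / r" by (simp add: add_divide_distrib)
      show ?case
      proof (intro allI impI)
        fix \<phi> assume t: "is_test P n \<phi>" and e: "type1_err P n \<phi> \<le> \<epsilon>"
        have "exp (- \<tau>) * (1 / r) \<le> exp (- \<tau>) * (1 - \<epsilon> - measure (prodP P 0 n) ?W)"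
          using W by (intro mult_left_mono) auto
        also have "\<dots> \<le> card (Imin P K) * max_type2 P K n \<phi>" by (rule max_type2_lower[OF t e])
        finally have "exp (- \<tau>) / r / card (Imin P K) \<le> max_type2 P K n \<phi>"
          by (subst pos_divide_le_eq[OF m]) (simp add: mult.commute)
        moreover have "exp (- \<tau>) = exp (- C) * exp (- real n * Dmin P K + sqrt (real n) * b)"
          unfolding \<tau>_def r_def exp_add[symmetric] by simp
        ultimately show "exp (- C) / card (Imin P K) * exp (- real n * Dmin P K + sqrt (real n) * b - ln (real n) / 2) \<le> max_type2 P K n \<phi>"
          unfolding exp_rate[OF n] r_def by (simp add: mult_ac)
      qed
    qed
  qed
qed

lemma llr_test_is_test: "is_test P n (llr_test P K n \<tau>)"
proof -
  have m[measurable]: "llrE_n P n k \<in> borel_measurable (prodP P 0 n)" if "k \<in> {1..K}" for k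
    using that by (rule llrE_n_measurable)
  have "{x \<in> space (prodP P 0 n). \<forall>k\<in>{1..K}. ereal (\<tau> k) \<le> llrE_n P n k x} \<in> sets (prodP P 0 n)"
    by measurable
  then have "llr_test P K n \<tau> \<in> borel_measurable (prodP P 0 n)"
    unfolding llr_test_def[abs_def] by measurable
  then show ?thesis unfolding is_test_def by (auto simp: llr_test_def)
qed

text \<open>Under the null law the extended log-likelihood ratios are almost surely finite, so the
  test may be evaluated with the real sums \<open>S\<close>.\<close>

lemma type1_err_llr_test:
  "type1_err P n (llr_test P K n \<tau>) = 1 - \<P>(x in prodP P 0 n. \<forall>k\<in>{1..K}. \<tau> k \<le> S n k x)"
proof -
  interpret Q: prob_space "prodP P 0 n" by (rule prob_space_prodP) simp
  let ?W = "{x \<in> space (prodP P 0 n). \<forall>k\<in>{1..K}. \<tau> k \<le> S n k x}"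
  have m[measurable]: "S n k \<in> borel_measurable (prodP P 0 n)" if "k \<in> {1..K}" for k
    using that by (rule S_measurable)
  have W[measurable]: "?W \<in> sets (prodP P 0 n)" by measurable
  have "AE x in prodP P 0 n. \<forall>k\<in>{1..K}. \<forall>i\<in>{..<n}. rn k (x i) \<noteq> 0 \<and> rn k (x i) \<noteq> \<infinity>"
    by (intro eventually_ball_finite ballI AE_prodP_RN_regular) auto
  then have "AE x in prodP P 0 n. llr_test P K n \<tau> x = 1 - indicator ?W x"
    using AE_space
  proof eventually_elim
    case (elim x)
    then have "llrE_n P n k x = ereal (S n k x)" if "k \<in> {1..K}" for k using that by (intro llrE_n_eq) auto
    then show ?case using elim(2) by (auto simp: llr_test_def)
  qed
  then have "type1_err P n (llr_test P K n \<tau>) = (\<integral>x. 1 - indicator ?W x \<partial>prodP P 0 n)"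
    unfolding type1_err_def using llr_test_is_test[of n \<tau>] by (intro integral_cong_AE) (auto simp: is_test_def)
  also have "\<dots> = 1 - measure (prodP P 0 n) ?W"
    using W by (subst Bochner_Integration.integral_diff) (auto simp: Q.prob_space Q.emeasure_eq_measure Int_absorb2)
  finally show ?thesis .
qed

lemma type2_err_llr_test_le:
  assumes k: "k \<in> {1..K}"
  shows "type2_err P n k (llr_test P K n \<tau>) \<le> \<P>(x in prodP P k n. ereal (\<tau> k) \<le> llrE_n P n k x)"
proof -
  have kK: "k \<le> K" using k by simp
  interpret R: prob_space "prodP P k n" using kK by (rule prob_space_prodP)
  let ?A = "{x \<in> space (prodP P k n). ereal (\<tau> k) \<le> llrE_n P n k x}"
  have [measurable]: "llrE_n P n k \<in> borel_measurable (prodP P k n)"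
    using llrE_n_measurable[OF k, of n] sets_prodP[OF kK, of n] by (simp cong: measurable_cong_sets)
  have A: "?A \<in> sets (prodP P k n)" by measurable
  have "type2_err P n k (llr_test P K n \<tau>) \<le> (\<integral>x. indicator ?A x \<partial>prodP P k n)"
    unfolding type2_err_def
  proof (rule integral_mono)
    show "integrable (prodP P k n) (\<lambda>x. 1 - llr_test P K n \<tau> x)"
      using is_test_integrable[OF llr_test_is_test kK] by simp
    show "integrable (prodP P k n) (\<lambda>x. indicator ?A x :: real)" using A by (simp add: R.emeasure_eq_measure)
    show "1 - llr_test P K n \<tau> x \<le> indicator ?A x" if "x \<in> space (prodP P k n)" for x
      using that k by (auto simp: llr_test_def)
  qed
  then show ?thesis using A by (simp add: Int_absorb2)
qed

text \<open>One threshold serves all components. Lowering it by \<open>C = (D + Es) / c\<close>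
  raises the orthant probability of \<open>Imin P K\<close> by at least
  \<open>(D + Es) / sqrt n\<close>, which pays for the Berry--Esseen error and for the components
  outside \<open>Imin P K\<close>. The type-I constraint is thus met exactly, at the cost of the
  constant factor \<open>exp C\<close> in the type-II errors.\<close>

lemma achievability_bound:
  assumes F: "factor (Imin P K) A B" and D: "0 < D"
    and BE: "BE_bound (Imin P K) A D"
    and b: "gauss_cdf (Imin P K) A (\<lambda>_. b) = 1 - \<epsilon>"
  shows "\<exists>\<tau>. \<exists>C>0. \<forall>\<^sub>F n in sequentially. type1_err P n (llr_test P K n (\<tau> n)) \<le> \<epsilon> \<and>
    max_type2 P K n (llr_test P K n (\<tau> n)) \<le> C * exp (- real n * Dmin P K + sqrt (real n) * b - ln (real n) / 2)"
proof -
  interpret F: factor "Imin P K" A B by (rule F)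
  let ?G = "\<lambda>s. gauss_cdf (Imin P K) A (\<lambda>_. s)"
  obtain c where c: "0 < c" "\<forall>s h. \<bar>s - b\<bar> \<le> 1 \<longrightarrow> 0 \<le> h \<longrightarrow> h \<le> 1 \<longrightarrow> c * h \<le> ?G (s + h) - ?G s"
    using F.gauss_cdf_increment[OF Imin_facts(2), of b] by (elim exE conjE) (rule that)
  define Far where "Far = {1..K} - Imin P K"
  have finFar: "finite Far" unfolding Far_def by simp
  have "\<forall>k\<in>Far. \<exists>E>0. far_bound k E"
  proof
    fix k assume "k \<in> Far"
    then have k: "k \<in> {1..K}" "k \<notin> Imin P K" unfolding Far_def by auto
    have "Dmin P K \<le> KLk P k" unfolding Dmin_def using k by (intro Min_le) auto
    then have "Dmin P K < KLk P k" using k unfolding Imin_def by auto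
    with k(1) show "\<exists>E>0. far_bound k E"
      by (rule far_alternative)
  qed
  from bchoice[OF this] obtain E where E0: "\<forall>k\<in>Far. 0 < E k \<and> (far_bound k (E k))"
    by (rule exE)
  have E: "0 < E k" "\<forall>\<^sub>F n in sequentially. \<P>(x in prodP P 0 n. S n k x < real n * Dmin P K - sqrt (real n) * \<beta> - \<gamma>) \<le> E k / sqrt (real n)"
    if "k \<in> Far" for k \<beta> \<gamma>
    using E0 that by simp_all
  define Es where "Es = (\<Sum>k\<in>Far. E k)"
  have Es: "0 \<le> Es" unfolding Es_def using E(1) by (intro sum_nonneg) (auto intro: less_imp_le)
  have "\<forall>k\<in>{1..K}. \<exists>C>0. llr_error k C"
    by (intro ballI llr_error_bound)
  from bchoice[OF this] obtain L where L0: "\<forall>k\<in>{1..K}. 0 < L k \<and> (llr_error k (L k))"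
    by (rule exE)
  have L: "0 < L k" "1 \<le> n \<Longrightarrow> \<P>(x in prodP P k n. ereal \<tau> \<le> llrE_n P n k x) \<le> L k * exp (- \<tau>) / sqrt (real n)"
    if "k \<in> {1..K}" for k n \<tau>
    using L0[THEN bspec, OF that] by simp_all
  define Ls where "Ls = (\<Sum>k\<in>{1..K}. L k)"
  have Lk: "L k \<le> Ls" if "k \<in> {1..K}" for k
    unfolding Ls_def using that L(1) by (intro member_le_sum) (auto intro: less_imp_le)
  have Ls: "0 < Ls" unfolding Ls_def using L(1) K_pos by (intro sum_pos) auto
  define C where "C = (D + Es) / c"
  have C: "0 \<le> C" unfolding C_def using D c(1) Es by simp
  define \<tau> where "\<tau> n = real n * Dmin P K - sqrt (real n) * b - C" for n :: nat
  have "\<forall>\<^sub>F n in sequentially. \<forall>k\<in>Far. \<P>(x in prodP P 0 n. S n k x < \<tau> n) \<le> E k / sqrt (real n)"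
    unfolding \<tau>_def by (intro eventually_ball_finite finFar ballI E(2))
  then have "\<forall>\<^sub>F n in sequentially. type1_err P n (llr_test P K n (\<lambda>_. \<tau> n)) \<le> \<epsilon> \<and>
    max_type2 P K n (llr_test P K n (\<lambda>_. \<tau> n)) \<le> Ls * exp C * exp (- real n * Dmin P K + sqrt (real n) * b - ln (real n) / 2)"
    using eventually_sqrt_ge[of "max 1 C"]
  proof eventually_elim
    case (elim n)
    define r where "r = sqrt (real n)"
    have r: "1 \<le> r" "C \<le> r" using elim unfolding r_def by auto
    have rr: "real n = r * r" unfolding r_def by simp
    have n: "1 \<le> n" using r(1) rr by (cases n) auto
    let ?Q = "prodP P 0 n"
    interpret Q: prob_space ?Q by (rule prob_space_prodP) simp
    have Sm[measurable]: "S n k \<in> borel_measurable ?Q" if "k \<in> {1..K}" for k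
      using that by (rule S_measurable)
    let ?W = "{x \<in> space ?Q. \<forall>k\<in>{1..K}. \<tau> n \<le> S n k x}"
    let ?N = "{x \<in> space ?Q. \<forall>k\<in>Imin P K. n * KLk P k - S n k x \<le> r * (b + C / r)}"
    let ?B = "\<lambda>k. {x \<in> space ?Q. S n k x < \<tau> n}"
    have Wm: "?W \<in> sets ?Q" by measurable
    have Bm: "?B k \<in> sets ?Q" if "k \<in> Far" for k
    proof -
      have [measurable]: "S n k \<in> borel_measurable ?Q" using that unfolding Far_def by (intro Sm) auto
      show ?thesis by measurable
    qed
    have sub: "?N \<subseteq> ?W \<union> (\<Union>k\<in>Far. ?B k)"
    proof
      fix x assume x: "x \<in> ?N"
      show "x \<in> ?W \<union> (\<Union>k\<in>Far. ?B k)"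
      proof (cases "\<forall>k\<in>Far. \<tau> n \<le> S n k x")
        case True
        have "\<tau> n \<le> S n k x" if k: "k \<in> {1..K}" for k
        proof (cases "k \<in> Far")
          case False
          then have kI: "k \<in> Imin P K" using k unfolding Far_def by simp
          then have "n * KLk P k - S n k x \<le> r * (b + C / r)" using x by blast
          moreover have "KLk P k = Dmin P K" using kI by (simp add: Imin_def)
          moreover have "r * (b + C / r) = r * b + C" using r by (simp add: distrib_left)
          ultimately show ?thesis unfolding \<tau>_def r_def by simp
        qed (use True in blast)
        then show ?thesis using x by blast
      next
        case False
        then show ?thesis using x by (auto simp: not_le)
      qed
    qed
    have "?G (b + C / r) - D / r \<le> measure ?Q ?N"
      using BE[THEN spec[of _ n], THEN mp, OF n, THEN spec[of _ "\<lambda>_. b + C / r"]] unfolding r_def by linarith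
    also have "\<dots> \<le> measure ?Q (?W \<union> (\<Union>k\<in>Far. ?B k))"
      using Wm Bm finFar by (intro Q.finite_measure_mono sub) auto
    also have "\<dots> \<le> measure ?Q ?W + measure ?Q (\<Union>k\<in>Far. ?B k)"
      using Wm Bm finFar by (intro measure_Un_le) auto
    also have "measure ?Q (\<Union>k\<in>Far. ?B k) \<le> (\<Sum>k\<in>Far. measure ?Q (?B k))"
      using Bm finFar by (intro measure_UNION_le) auto
    also have "\<dots> \<le> (\<Sum>k\<in>Far. E k / r)" using elim(1) unfolding r_def by (intro sum_mono) auto
    also have "\<dots> = Es / r" unfolding Es_def by (rule sum_divide_distrib[symmetric])
    finally have 1: "?G (b + C / r) - D / r - Es / r \<le> measure ?Q ?W" by linarith
    have "c * (C / r) \<le> ?G (b + C / r) - ?G b"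
      using c(2)[THEN spec[of _ b], THEN spec[of _ "C / r"]] r C by simp
    moreover have "c * (C / r) = (D + Es) / r" unfolding C_def using c(1) by simp
    moreover have "(D + Es) / r = D / r + Es / r" by (rule add_divide_distrib)
    ultimately have "1 - \<epsilon> \<le> measure ?Q ?W" using 1 b by linarith
    then have type1: "type1_err P n (llr_test P K n (\<lambda>_. \<tau> n)) \<le> \<epsilon>" unfolding type1_err_llr_test by simp
    have "type2_err P n k (llr_test P K n (\<lambda>_. \<tau> n)) \<le> Ls * exp (- \<tau> n) / r" if k: "k \<in> {1..K}" for k
    proof -
      have "type2_err P n k (llr_test P K n (\<lambda>_. \<tau> n)) \<le> L k * exp (- \<tau> n) / sqrt n"
        by (rule order_trans[OF type2_err_llr_test_le[OF k] L(2)[OF k n]])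
      also have "\<dots> \<le> Ls * exp (- \<tau> n) / sqrt n" using Lk[OF k] by (intro divide_right_mono mult_right_mono) auto
      finally show ?thesis unfolding r_def .
    qed
    then have "max_type2 P K n (llr_test P K n (\<lambda>_. \<tau> n)) \<le> Ls * exp (- \<tau> n) / r"
      unfolding max_type2_def using K_pos by (intro Max.boundedI) auto
    moreover have "exp (- \<tau> n) = exp C * exp (- real n * Dmin P K + sqrt (real n) * b)"
      unfolding \<tau>_def exp_add[symmetric] by simp
    ultimately show ?case using type1 unfolding exp_rate[OF n] r_def by (simp add: mult_ac)
  qed
  then show ?thesis using Ls by (intro exI[of _ "\<lambda>n _. \<tau> n"] exI[of _ "Ls * exp C"]) auto
qed

lemma minimax_beta_le:
  assumes "is_test P n \<phi>" "type1_err P n \<phi> \<le> \<epsilon>"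
  shows "minimax_beta P K \<epsilon> n \<le> max_type2 P K n \<phi>"
  unfolding minimax_beta_def
proof (rule cINF_lower)
  show "bdd_below ((\<lambda>\<phi>. max_type2 P K n \<phi>) ` {\<phi>. is_test P n \<phi> \<and> type1_err P n \<phi> \<le> \<epsilon>})"
  proof (rule bdd_belowI2)
    fix \<phi> assume "\<phi> \<in> {\<phi>. is_test P n \<phi> \<and> type1_err P n \<phi> \<le> \<epsilon>}"
    then have t: "is_test P n \<phi>" by simp
    have k: "1 \<in> {1..K}" using K_pos by simp
    show "0 \<le> max_type2 P K n \<phi>"
      using type2_err_nonneg[OF t K_pos] max_type2_ge[OF k] by (rule order_trans)
  qed
qed (use assms in simp)

lemma minimax_beta_ge:
  assumes e: "0 \<le> \<epsilon>" and "\<And>\<phi>. is_test P n \<phi> \<Longrightarrow> type1_err P n \<phi> \<le> \<epsilon> \<Longrightarrow> x \<le> max_type2 P K n \<phi>"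
  shows "x \<le> minimax_beta P K \<epsilon> n"
  unfolding minimax_beta_def
proof (rule cINF_greatest)
  \<comment> \<open>The test that always decides for H0 is admissible, so the infimum ranges over a
    nonempty set.\<close>
  have "is_test P n (\<lambda>_. 0)" "type1_err P n (\<lambda>_. 0) \<le> \<epsilon>"
    using e by (simp_all add: is_test_def type1_err_def)
  then show "{\<phi>. is_test P n \<phi> \<and> type1_err P n \<phi> \<le> \<epsilon>} \<noteq> {}" by blast
qed (use assms(2) in simp)

end

text \<open>The O(1) in the exponent is rendered by constant factors \<open>c\<close> and
  \<open>C\<close> around \<open>exp (g n)\<close>, and attainment by log-likelihood-ratio tests is
  meant in the same sense. Their lower bound is the converse applied to these very tests.\<close>

theorem theorem5:
  fixes P :: "nat \<Rightarrow> 'a measure" and K :: nat and \<epsilon>0 :: real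
  assumes K_pos: "1 \<le> K"
    and prob: "\<And>k. k \<le> K \<Longrightarrow> prob_space (P k)"
    and common_space: "\<And>k. k \<le> K \<Longrightarrow> sets (P k) = sets (P 0)"
    and abs_cont: "\<And>k. k \<in> {1..K} \<Longrightarrow> absolutely_continuous (P k) (P 0)"
    and KL_finite: "\<And>k. k \<in> {1..K} \<Longrightarrow> integrable (P 0) (llr0 P k)"
    and KL_pos: "\<And>k. k \<in> {1..K} \<Longrightarrow> 0 < KLk P k"
    and V_posdef: "\<And>x::nat \<Rightarrow> real. (\<exists>k\<in>{1..K}. x k \<noteq> 0) \<Longrightarrow>
                     0 < (\<Sum>j\<in>{1..K}. \<Sum>k\<in>{1..K}. x j * covV P j k * x k)"
    and third_moment: "integrable (P 0)
                     (\<lambda>y. (sqrt (\<Sum>k\<in>{1..K}. (llr0 P k y - KLk P k)\<^sup>2)) ^ 3)"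
    and eps: "0 < \<epsilon>0" "\<epsilon>0 < 1"
  shows "(\<exists>!b. gauss_orthant (Imin P K) (covV P) b (1 - \<epsilon>0)) \<and>
         (\<forall>b. gauss_orthant (Imin P K) (covV P) b (1 - \<epsilon>0) \<longrightarrow>
            (let g = (\<lambda>n::nat. - real n * Dmin P K + sqrt (real n) * b - ln (real n) / 2) in
              (\<exists>c>0. \<exists>C>0. eventually (\<lambda>n. c * exp (g n) \<le> minimax_beta P K \<epsilon>0 n \<and>
                                       minimax_beta P K \<epsilon>0 n \<le> C * exp (g n)) sequentially) \<and>
              (\<exists>\<tau> :: nat \<Rightarrow> nat \<Rightarrow> real. \<exists>c>0. \<exists>C>0. eventually (\<lambda>n.
                   is_test P n (llr_test P K n (\<tau> n)) \<and>
                   type1_err P n (llr_test P K n (\<tau> n)) \<le> \<epsilon>0 \<and>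
                   c * exp (g n) \<le> max_type2 P K n (llr_test P K n (\<tau> n)) \<and>
                   max_type2 P K n (llr_test P K n (\<tau> n)) \<le> C * exp (g n)) sequentially)))"
proof -
  interpret llr_testing P K
    by (rule llr_testing.intro; fact)
  obtain A B D where F: "factor (Imin P K) A B"
    and AA: "\<forall>i\<in>Imin P K. \<forall>j\<in>Imin P K. (\<Sum>l\<in>Imin P K. A i l * A j l) = covV P i j" and D: "0 < D" and
    BE: "BE_bound (Imin P K) A D"
    using berry_esseen_llr[OF Imin_facts(1)] by (elim exE conjE) (rule that)
  interpret F: factor "Imin P K" A B by (rule F)
  have iff: "gauss_orthant (Imin P K) (covV P) b (1 - \<epsilon>0) \<longleftrightarrow> gauss_cdf (Imin P K) A (\<lambda>_. b) = 1 - \<epsilon>0" for b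
    using AA by (intro F.gauss_orthant_iff) auto
  have "\<exists>!b. gauss_orthant (Imin P K) (covV P) b (1 - \<epsilon>0)"
    unfolding iff using eps by (intro F.gauss_cdf_ex1 Imin_facts(2)) auto
  moreover have "(\<exists>c>0. \<exists>C>0. eventually (\<lambda>n. c * exp (g n) \<le> minimax_beta P K \<epsilon>0 n \<and>
        minimax_beta P K \<epsilon>0 n \<le> C * exp (g n)) sequentially) \<and>
      (\<exists>\<tau> :: nat \<Rightarrow> nat \<Rightarrow> real. \<exists>c>0. \<exists>C>0. eventually (\<lambda>n.
        is_test P n (llr_test P K n (\<tau> n)) \<and>
        type1_err P n (llr_test P K n (\<tau> n)) \<le> \<epsilon>0 \<and>
        c * exp (g n) \<le> max_type2 P K n (llr_test P K n (\<tau> n)) \<and>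
        max_type2 P K n (llr_test P K n (\<tau> n)) \<le> C * exp (g n)) sequentially)"
    if b: "gauss_orthant (Imin P K) (covV P) b (1 - \<epsilon>0)"
      and g: "g = (\<lambda>n::nat. - real n * Dmin P K + sqrt (real n) * b - ln (real n) / 2)" for b g
  proof -
    note b' = b[unfolded iff]
    obtain c where c: "0 < c" "\<forall>\<^sub>F n in sequentially. \<forall>\<phi>. is_test P n \<phi> \<longrightarrow> type1_err P n \<phi> \<le> \<epsilon>0 \<longrightarrow>
        c * exp (g n) \<le> max_type2 P K n \<phi>"
      using converse_bound[OF F D BE b'] unfolding g by blast
    obtain \<tau> C where C: "0 < C" "\<forall>\<^sub>F n in sequentially. type1_err P n (llr_test P K n (\<tau> n)) \<le> \<epsilon>0 \<and>
        max_type2 P K n (llr_test P K n (\<tau> n)) \<le> C * exp (g n)"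
      using achievability_bound[OF F D BE b'] unfolding g by blast
    have "\<forall>\<^sub>F n in sequentially. c * exp (g n) \<le> minimax_beta P K \<epsilon>0 n \<and> minimax_beta P K \<epsilon>0 n \<le> C * exp (g n)"
      using c(2) C(2)
    proof eventually_elim
      case (elim n)
      have "c * exp (g n) \<le> minimax_beta P K \<epsilon>0 n" using eps elim(1) by (intro minimax_beta_ge) auto
      moreover have "minimax_beta P K \<epsilon>0 n \<le> max_type2 P K n (llr_test P K n (\<tau> n))"
        using elim(2) by (intro minimax_beta_le llr_test_is_test) auto
      ultimately show ?case using elim(2) by linarith
    qed
    moreover have "\<forall>\<^sub>F n in sequentially. is_test P n (llr_test P K n (\<tau> n)) \<and>
        type1_err P n (llr_test P K n (\<tau> n)) \<le> \<epsilon>0 \<and>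
        c * exp (g n) \<le> max_type2 P K n (llr_test P K n (\<tau> n)) \<and>
        max_type2 P K n (llr_test P K n (\<tau> n)) \<le> C * exp (g n)"
      using c(2) C(2) by eventually_elim (simp add: llr_test_is_test)
    ultimately show ?thesis using c(1) C(1) by blast
  qed
  ultimately show ?thesis unfolding Let_def by blast
qed

end
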